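(* Let $\mathbb{F}=\mathbb{R}$ or $\mathbb{C}$, let $n \geq 1$ and let $\mathcal{V} \subseteq M_n(\mathbb{F})$ be a nilpotent algebra. Then for any integer $r \geq 1$ with $r \geq n - 1$, the minimum size of a coherent decomposition of $\mathbb{F}^{rn}$ into chains relative to $\mathcal{V} \otimes M_r(\mathbb{F})$ equals $r$ times the maximum dimension of an antichain for $\mathcal{V}$.
   Context: A linear subspace $\mathcal{V} \subseteq M_n(\mathbb{F})$ is a nilpotent algebra if $\mathcal{V}^2 \subseteq \mathcal{V}$ and $\mathcal{V}^n = \{0\}$ (that is, products of two elements of $\mathcal{V}$ lie in $\mathcal{V}$ and every product of $n$ elements of $\mathcal{V}$ is zero). $\mathcal{V}\otimes M_r(\mathbb{F})$ is regarded as a linear subspace of $M_n(\mathbb{F})\otimes M_r(\mathbb{F}) \cong M_{rn}(\mathbb{F})$, acting on $\mathbb{F}^n\otimes\mathbb{F}^r\cong\mathbb{F}^{rn}$. Given a linear subspace $\mathcal{W} \subseteq M_N(\mathbb{F})$, a coherent chain in $\mathbb{F}^N$ relative to $\mathcal{W}$ is a sequence of the form $(v, Av, \ldots, A^{k-1}v)$ ($k \geq 1$) for some $v \in \mathbb{F}^N$ and some $A \in \mathcal{W}$. A coherent decomposition of $\mathbb{F}^N$ into chains relative to $\mathcal{W}$ is a collection of coherent chains which are all implemented by one single $A \in \mathcal{W}$ and whose elements collectively form a basis of $\mathbb{F}^N$. Its size is the number of coherent chains in the collection. An antichain for $\mathcal{V}$ is a linear subspace $C$ of $\mathbb{F}^n$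 such that $\mathcal{V}[C] \subseteq C^\perp$, where $\mathcal{V}[C] = \mathrm{span}\{Av : A \in \mathcal{V},\ v \in C\}$ and $\perp$ refers to the standard inner product. Equivalently, $P\mathcal{V}P=\{0\}$ where $P$ is the orthogonal projection onto $C$. *)

theory Defs
  imports "Jordan_Normal_Form.VS_Connect" "HOL.Complex"
begin

definition nilpotent_algebra :: "nat \<Rightarrow> 'a::field mat set \<Rightarrow> bool" where
  "nilpotent_algebra n V \<longleftrightarrow>
     VectorSpace.subspace class_ring V (module_mat TYPE('a) n n) \<and>
     (\<forall>A\<in>V. \<forall>B\<in>V. A * B \<in> V) \<and>
     (\<forall>As. length As = n \<and> set As \<subseteq> V \<longrightarrow> foldr (*) As (1\<^sub>m n) = 0\<^sub>m n n)"

text \<open>Kronecker product.  The basis vector \<open>e\<^sub>i \<otimes> e\<^sub>a\<close> of the tensor product has index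
  \<open>i * r + a\<close>, where \<open>r\<close> is the dimension of the second factor.\<close>

definition kronecker :: "'a::semiring_0 mat \<Rightarrow> 'a mat \<Rightarrow> 'a mat" where
  "kronecker A B = mat (dim_row A * dim_row B) (dim_col A * dim_col B)
     (\<lambda>(i, j). A $$ (i div dim_row B, j div dim_col B) * B $$ (i mod dim_row B, j mod dim_col B))"

text \<open>\<open>V \<otimes> M\<^sub>r\<close>, where \<open>V\<close> consists of \<open>n \<times> n\<close> matrices.\<close>

definition tensor_full :: "nat \<Rightarrow> nat \<Rightarrow> 'a::field mat set \<Rightarrow> 'a mat set" where
  "tensor_full n r V =
     LinearCombinations.module.span class_ring (module_mat TYPE('a) (r * n) (r * n))
       {kronecker A B | A B. A \<in> V \<and> B \<in> carrier_mat r r}"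

text \<open>A chain that is coherent relative to \<open>W\<close> is one implemented by some \<open>A \<in> W\<close>; the matrix is kept
  explicit, since in a decomposition all chains share it.\<close>

definition coherent_chain_by :: "nat \<Rightarrow> 'a::field mat \<Rightarrow> 'a vec list \<Rightarrow> bool" where
  "coherent_chain_by N A c \<longleftrightarrow>
     (\<exists>v\<in>carrier_vec N. \<exists>k\<ge>1. c = map (\<lambda>i. (A ^\<^sub>m i) *\<^sub>v v) [0..<k])"

text \<open>The family of all entries of all chains is a basis; hence distinctness is required as well.
  The order of the chains in the list \<open>cs\<close> is irrelevant, and \<open>length cs\<close> is the size.\<close>

definition coherent_decomposition :: "nat \<Rightarrow> 'a::field mat set \<Rightarrow> 'a vec list list \<Rightarrow> bool" where
  "coherent_decomposition N W cs \<longleftrightarrow>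
     (\<exists>A\<in>W. \<forall>c\<in>set cs. coherent_chain_by N A c) \<and>
     distinct (concat cs) \<and>
     vectorspace.basis class_ring (module_vec TYPE('a) N) (set (concat cs))"

definition minimum_decomposition_size :: "nat \<Rightarrow> 'a::field mat set \<Rightarrow> nat \<Rightarrow> bool" where
  "minimum_decomposition_size N W m \<longleftrightarrow>
     (\<exists>cs. coherent_decomposition N W cs \<and> length cs = m) \<and>
     (\<forall>cs. coherent_decomposition N W cs \<longrightarrow> m \<le> length cs)"

definition apply_span :: "nat \<Rightarrow> 'a::field mat set \<Rightarrow> 'a vec set \<Rightarrow> 'a vec set" where
  "apply_span n V C =
     LinearCombinations.module.span class_ring (module_vec TYPE('a) n)
       {A *\<^sub>v v | A v. A \<in> V \<and> v \<in> C}"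

text \<open>The orthogonal complement in \<open>VS_Connect\<close> is taken with respect to the bilinear form
  \<open>\<bullet>\<close>; here we need the sesquilinear standard inner product \<open>\<bullet>c\<close> (over the reals, conjugation is
  the identity).\<close>

definition orth_compl :: "nat \<Rightarrow> 'a::conjugatable_field vec set \<Rightarrow> 'a vec set" where
  "orth_compl n C = {w \<in> carrier_vec n. \<forall>v\<in>C. w \<bullet>c v = 0}"

definition antichain :: "nat \<Rightarrow> 'a::conjugatable_field mat set \<Rightarrow> 'a vec set \<Rightarrow> bool" where
  "antichain n V C \<longleftrightarrow>
     VectorSpace.subspace class_ring C (module_vec TYPE('a) n) \<and>
     apply_span n V C \<subseteq> orth_compl n C"

definition subspace_dim :: "nat \<Rightarrow> 'a::field vec set \<Rightarrow> nat" where
  "subspace_dim n C = vectorspace.dim class_ring ((module_vec TYPE('a) n)\<lparr>carrier := C\<rparr>)"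

definition maximum_antichain_dim :: "nat \<Rightarrow> 'a::conjugatable_field mat set \<Rightarrow> nat \<Rightarrow> bool" where
  "maximum_antichain_dim n V d \<longleftrightarrow>
     (\<exists>C. antichain n V C \<and> subspace_dim n C = d) \<and>
     (\<forall>C. antichain n V C \<longrightarrow> subspace_dim n C \<le> d)"

end

theory Submission
  imports Defs "HOL-Library.Function_Algebras" "Jordan_Normal_Form.Char_Poly"
    "HOL-Computational_Algebra.Formal_Laurent_Series"
begin

text \<open>For a nilpotent matrix \<open>A\<close> of size \<open>N\<close> the least number of chains is \<open>N - rank A\<close>, so the minimum is governed by the maximal
  rank of block matrices with blocks in \<open>V\<close>. If \<open>U\<close> is a subspace, then \<open>U\<close> intersected with the orthogonal complement
  of \<open>V[U]\<close> is an antichain of dimension at least \<open>dim U - dim V[U]\<close>; conversely an antichain \<open>C\<close> gives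
  \<open>U = C + V[C]\<close> with \<open>dim U - dim V[U] \<ge> dim C\<close>, because \<open>V\<close> is an algebra. It remains to see that the maximal rank
  \<open>f(r)\<close> of \<open>r \<times> r\<close> block matrices equals \<open>r \<rho>\<close>, where \<open>n - \<rho>\<close> is the maximum of \<open>dim U - dim V[U]\<close>; this is the
  regularity of blow-ups in the theory of noncommutative rank, and it needs \<open>r \<ge> \<rho>\<close>, where \<open>\<rho> \<le> n - 1\<close> by nilpotency.

  First, \<open>r\<close> divides \<open>f(r)\<close>: over an extension field the coefficients can be moved into a division algebra of
  degree \<open>r\<close>, over which block Gaussian elimination applies. Second, for a generic block matrix with \<open>m\<close> block rows
  the increments of the rank, as block columns are added, are nonincreasing integers in \<open>{0..n}\<close>. When two consecutive ones coincide,
  a first-order variation produces a subspace \<open>U\<close> that accounts for the rank exactly. For large \<open>m\<close> this happens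
  close to the last column, which gives \<open>f(m) > m (\<rho> - 1)\<close> and hence \<open>f(m) = m \<rho>\<close> by divisibility. Third,
  deleting a suitable block row and block column shows \<open>m\<^sup>2 f(m - 1) \<ge> (m - 1)\<^sup>2 f(m)\<close>, so that
  \<open>f(m) = m \<rho>\<close> implies \<open>f(m - 1) = (m - 1) \<rho>\<close> as long as \<open>m > \<rho>\<close>, again by divisibility.\<close>

section \<open>Linear algebra in function spaces\<close>

text \<open>The obstacle is that no direct construction reaches the rank r \<rho> at size r. The
  plateau argument needs a large size m and still falls short by up to n (n + 1), and each averaging
  step from m to m - 1 loses something again. All these losses are smaller than the current number
  of block rows, so they disappear once maximal ranks are known to be multiples of that number; this
  is what the division algebra is for. Since the complex numbers admit no finite-dimensional
  division algebra of degree above 1, the scalars are extended to Laurent series in two variables.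
  Roots of unity come from the complex coefficients, and real scalars enter through their embedding
  into them. The way back is possible because the ground field is infinite: a rank attained with
  some coefficients in a large field is also attained, or exceeded, with coefficients from any
  infinite subset.\<close>

definition scl :: "'a::field \<Rightarrow> ('i \<Rightarrow> 'a) \<Rightarrow> ('i \<Rightarrow> 'a)" where
  "scl c f = (\<lambda>i. c * f i)"

lemma scl_apply [simp]: "scl c f i = c * f i"
  by (simp add: scl_def)

interpretation fv: vector_space scl
  by unfold_locales (auto simp: fun_eq_iff algebra_simps)

interpretation fvp: vector_space_pair scl scl ..

text \<open>The ambient spaces consist of all functions on a type and may have infinite dimension,
  where \<open>fv.dim\<close> carries no information; finiteness is therefore a separate hypothesis
  on subsets.\<close>

definition findim :: "('i \<Rightarrow> 'a::field) set \<Rightarrow> bool" where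
  "findim S \<longleftrightarrow> (\<exists>B. finite B \<and> S \<subseteq> fv.span B)"

lemma findim_subset: "findim T \<Longrightarrow> S \<subseteq> T \<Longrightarrow> findim S"
  unfolding findim_def by blast

lemma findim_span [simp]: "finite B \<Longrightarrow> findim (fv.span B)"
  unfolding findim_def by blast

lemma findim_independent:
  assumes "findim S" "fv.independent B" "B \<subseteq> S"
  shows "finite B" "card B \<le> fv.dim S"
proof -
  obtain C where C: "finite C" "S \<subseteq> fv.span C" using assms(1) unfolding findim_def by blast
  show fin: "finite B" using fv.independent_span_bound[OF C(1) assms(2)] assms(3) C(2) by blast
  obtain D where D: "B \<subseteq> D" "D \<subseteq> S" "fv.independent D" "S \<subseteq> fv.span D"
    using fv.maximal_independent_subset_extend[OF assms(3,2)] by blast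
  have "finite D" using fv.independent_span_bound[OF C(1) D(3)] D(2) C(2) by blast
  moreover have "card D = fv.dim S" by (rule fv.basis_card_eq_dim) (use D in auto)
  ultimately show "card B \<le> fv.dim S" using D(1) card_mono by fastforce
qed

lemma findim_basis:
  assumes "findim S"
  obtains B where "B \<subseteq> S" "fv.independent B" "S \<subseteq> fv.span B" "finite B" "card B = fv.dim S"
  using fv.basis_exists[of S] findim_independent[OF assms] by metis

lemma dim_mono:
  assumes "findim T" "S \<subseteq> T"
  shows "fv.dim S \<le> fv.dim T"
  using findim_basis[OF findim_subset[OF assms]] findim_independent[OF assms(1)] assms(2)
  by (metis subset_trans)

lemma subspace_eqI:
  assumes "findim T" "fv.subspace S" "S \<subseteq> T" "fv.dim T \<le> fv.dim S"
  shows "S = T"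
proof -
  obtain B where B: "B \<subseteq> S" "fv.independent B" "S \<subseteq> fv.span B" "finite B" "card B = fv.dim S"
    using findim_basis[OF findim_subset[OF assms(1,3)]] .
  have "T \<subseteq> fv.span B"
  proof
    fix x assume x: "x \<in> T"
    show "x \<in> fv.span B"
    proof (rule ccontr)
      assume nx: "x \<notin> fv.span B"
      then have "fv.independent (insert x B)" using B(2) by (rule fv.independent_insertI)
      moreover have "insert x B \<subseteq> T" using x B(1) assms(3) by blast
      ultimately have "card (insert x B) \<le> fv.dim T" using findim_independent(2)[OF assms(1)] by blast
      moreover have "x \<notin> B" using nx fv.span_base by blast
      ultimately show False using B(4,5) assms(4) by simp
    qed
  qed
  moreover have "fv.span B \<subseteq> S" using B(1) assms(2) by (simp add: fv.span_minimal)
  ultimately show ?thesis using assms(3) by blast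
qed

lemma dim_zero [simp]: "fv.dim {0} = 0"
  by (metis fv.span_empty fv.dim_span card.empty fv.dim_eq_card_independent fv.independent_empty)

lemma findim_image:
  assumes "Vector_Spaces.linear scl scl f" "findim S"
  shows "findim (f ` S)"
proof -
  obtain C where C: "finite C" "S \<subseteq> fv.span C" using assms(2) unfolding findim_def by blast
  have "f ` S \<subseteq> fv.span (f ` C)" using C(2) fvp.linear_span_image[OF assms(1)] by blast
  then show ?thesis using C(1) unfolding findim_def by blast
qed

lemma rank_nullity:
  fixes f :: "('i \<Rightarrow> 'a::field) \<Rightarrow> 'j \<Rightarrow> 'a"
  assumes lin: "Vector_Spaces.linear scl scl f" and S: "fv.subspace S" "findim S"
  shows "fv.dim S = fv.dim (f ` S) + fv.dim {x \<in> S. f x = 0}"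
proof -
  let ?K = "{x \<in> S. f x = 0}"
  interpret l: Vector_Spaces.linear scl scl f by (rule lin)
  have subK: "fv.subspace ?K"
    using S(1) by (auto simp: fv.subspace_def l.add l.scale l.zero)
  obtain B where B: "B \<subseteq> ?K" "fv.independent B" "?K \<subseteq> fv.span B" "finite B" "card B = fv.dim ?K"
    using findim_basis[OF findim_subset[OF S(2)], of ?K] by blast
  obtain D where D: "B \<subseteq> D" "D \<subseteq> S" "fv.independent D" "S \<subseteq> fv.span D"
    using fv.maximal_independent_subset_extend[of B S] B(1,2) by blast
  have finD: "finite D" using findim_independent[OF S(2) D(3,2)] by blast
  have cD: "card D = fv.dim S" by (rule fv.basis_card_eq_dim) (use D in auto)
  have zero: "(\<forall>d\<in>D - B. x d = 0)" if "(\<Sum>d\<in>D - B. scl (x d) (f d)) = 0" for x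
  proof -
    let ?v = "\<Sum>d\<in>D - B. scl (x d) d"
    have "f ?v = 0" using that by (simp add: l.sum l.scale)
    moreover have "?v \<in> S" using D(2) S(1) by (intro fv.subspace_sum fv.subspace_scale) auto
    ultimately have "?v \<in> fv.span B" using B(3) by blast
    then obtain y where y: "?v = (\<Sum>b\<in>B. scl (y b) b)"
      using fv.span_finite[OF B(4)] by auto
    let ?z = "\<lambda>d. if d \<in> B then - y d else x d"
    have "(\<Sum>d\<in>D. scl (?z d) d) = (\<Sum>d\<in>D - B. scl (?z d) d) + (\<Sum>d\<in>B. scl (?z d) d)"
      by (rule sum.subset_diff) (use D(1) finD in auto)
    also have "(\<Sum>d\<in>D - B. scl (?z d) d) = ?v" by (rule sum.cong) auto
    also have "(\<Sum>d\<in>B. scl (?z d) d) = - (\<Sum>b\<in>B. scl (y b) b)"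
      by (simp add: sum_negf[symmetric] fv.scale_minus_left)
    also have "?v + - (\<Sum>b\<in>B. scl (y b) b) = 0" using y by simp
    finally have zs: "(\<Sum>d\<in>D. scl (?z d) d) = 0" .
    have "?z d = 0" if "d \<in> D" for d
      by (rule fv.independentD[OF D(3) finD order_refl zs that])
    then show ?thesis by (metis Diff_iff)
  qed
  have inj: "inj_on f (D - B)"
  proof (rule inj_onI, rule ccontr)
    fix a b assume ab: "a \<in> D - B" "b \<in> D - B" "f a = f b" "a \<noteq> b"
    let ?x = "\<lambda>d. if d = a then 1 else if d = b then - 1 else (0::'a)"
    have "(\<Sum>d\<in>D - B. scl (?x d) (f d)) = (\<Sum>d\<in>{a,b}. scl (?x d) (f d))"
      by (rule sum.mono_neutral_right) (use ab finD in auto)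
    also have "\<dots> = 0" using ab(3,4) by (auto simp: fun_eq_iff)
    finally have "\<forall>d\<in>D - B. ?x d = 0" by (rule zero)
    from bspec[OF this ab(1)] show False by simp
  qed
  have ind: "fv.independent (f ` (D - B))"
  proof (rule fv.independent_if_scalars_zero)
    show "finite (f ` (D - B))" using finD by simp
    fix h x assume h: "(\<Sum>x\<in>f ` (D - B). scl (h x) x) = 0" and x: "x \<in> f ` (D - B)"
    have "(\<Sum>d\<in>D - B. scl (h (f d)) (f d)) = 0" using h by (simp add: sum.reindex[OF inj])
    from zero[OF this] x show "h x = 0" by auto
  qed
  have sp: "f ` S \<subseteq> fv.span (f ` (D - B))"
  proof -
    have "f ` S \<subseteq> fv.span (f ` D)" using D(4) fvp.linear_span_image[OF lin] by blast
    also have "fv.span (f ` D) \<subseteq> fv.span (f ` (D - B))"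
    proof (rule fv.span_minimal[OF _ fv.subspace_span], rule subsetI)
      fix y assume "y \<in> f ` D"
      then obtain d where d: "d \<in> D" "y = f d" by blast
      show "y \<in> fv.span (f ` (D - B))"
      proof (cases "d \<in> B")
        case True
        then have "y = 0" using B(1) d by auto
        then show ?thesis by (simp add: fv.span_zero)
      next
        case False
        then show ?thesis using d by (auto intro: fv.span_base)
      qed
    qed
    finally show ?thesis .
  qed
  have "card (f ` (D - B)) = fv.dim (f ` S)"
    by (rule fv.basis_card_eq_dim) (use D(2) sp ind in auto)
  moreover have "card (f ` (D - B)) = card D - card B"
    using card_image[OF inj] card_Diff_subset[OF B(4) D(1)] by simp
  moreover have "card B \<le> card D" using card_mono[OF finD D(1)] .
  ultimately show ?thesis using cD B(5) by simp
qed

lemma dim_image_inj: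
  assumes "Vector_Spaces.linear scl scl f" "fv.subspace S" "findim S"
    and "\<And>x. x \<in> S \<Longrightarrow> f x = 0 \<Longrightarrow> x = 0"
  shows "fv.dim (f ` S) = fv.dim S"
proof -
  interpret l: Vector_Spaces.linear scl scl f by fact
  have "{x \<in> S. f x = 0} = {0}"
    using assms(2,4) by (auto simp: l.zero fv.subspace_0)
  then show ?thesis using rank_nullity[OF assms(1-3)] by simp
qed

text \<open>F^I as a subspace of one function type, so that a single type serves all sizes.\<close>

definition coords :: "'i set \<Rightarrow> ('i \<Rightarrow> 'a::field) set" where
  "coords I = {f. \<forall>i. i \<notin> I \<longrightarrow> f i = 0}"

lemma subspace_coords [simp]: "fv.subspace (coords I)"
  by (auto simp: fv.subspace_def coords_def)

definition unitf :: "'i \<Rightarrow> 'i \<Rightarrow> 'a::field" where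
  "unitf i = (\<lambda>j. if j = i then 1 else 0)"

lemma sum_fun_apply: "(\<Sum>x\<in>A. f x) i = (\<Sum>x\<in>A. f x i)"
  by (induction A rule: infinite_finite_induct) auto

lemma sum_unitf: "finite I \<Longrightarrow> (\<Sum>i\<in>I. scl (x i) (unitf i)) = (\<lambda>j. if j \<in> I then x j else 0)"
  by (auto simp: fun_eq_iff sum_fun_apply unitf_def if_distrib cong: if_cong)

lemma coords_sum: "finite I \<Longrightarrow> f \<in> coords I \<Longrightarrow> f = (\<Sum>i\<in>I. scl (f i) (unitf i))"
  by (auto simp: sum_unitf coords_def fun_eq_iff)

lemma coords_span: 
  assumes I: "finite I"
  shows "coords I = fv.span (unitf ` I)"
proof (rule subset_antisym)
  show "coords I \<subseteq> fv.span (unitf ` I)"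
  proof
    fix f assume f: "f \<in> coords I"
    have "(\<Sum>i\<in>I. scl (f i) (unitf i)) \<in> fv.span (unitf ` I)"
      by (intro fv.span_sum fv.span_scale fv.span_base imageI)
    then show "f \<in> fv.span (unitf ` I)" using coords_sum[OF I f] by simp
  qed
  show "fv.span (unitf ` I) \<subseteq> coords I"
    by (rule fv.span_minimal[OF _ subspace_coords]) (auto simp: coords_def unitf_def)
qed

lemma findim_coords [simp]: 
  assumes "finite I"
  shows "findim (coords I)"
  by (subst coords_span[OF assms]) (rule findim_span[OF finite_imageI[OF assms]])

lemma inj_unitf: "inj_on (unitf :: 'i \<Rightarrow> 'i \<Rightarrow> 'a::field) I"
  by (auto simp: inj_on_def unitf_def fun_eq_iff split: if_splits)

lemma dim_coords: 
  assumes "finite I"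
  shows "fv.dim (coords I :: ('i \<Rightarrow> 'a::field) set) = card I"
proof -
  have "fv.independent (unitf ` I :: ('i \<Rightarrow> 'a) set)"
  proof (rule fv.independent_if_scalars_zero)
    fix h :: "('i \<Rightarrow> 'a) \<Rightarrow> 'a" and x :: "'i \<Rightarrow> 'a"
    assume h: "(\<Sum>x\<in>unitf ` I. scl (h x) x) = 0" and x: "x \<in> unitf ` I"
    have "(\<Sum>i\<in>I. scl (h (unitf i)) (unitf i)) = 0" using h by (simp add: sum.reindex[OF inj_unitf])
    then show "h x = 0" using x assms by (auto simp: sum_unitf fun_eq_iff) metis
  qed (use assms in auto)
  then show ?thesis using assms 
    by (simp add: coords_span fv.dim_eq_card_independent card_image[OF inj_unitf])
qed

text \<open>The space F^P \<otimes> Y, seen as functions on \<open>P\<close> with values in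
  \<open>Y\<close>. The zeros outside \<open>P\<close> keep the dimension finite.\<close>

definition power_space :: "'k set \<Rightarrow> ('i \<Rightarrow> 'a::field) set \<Rightarrow> ('k \<times> 'i \<Rightarrow> 'a) set" where
  "power_space P Y = {z. (\<forall>k\<in>P. (\<lambda>i. z (k, i)) \<in> Y) \<and> (\<forall>k i. k \<notin> P \<longrightarrow> z (k, i) = 0)}"

lemma scl_fun: "scl c f = (\<lambda>i. c * f i)"
  by (simp add: fun_eq_iff)

lemma subspace_power_space [simp]: 
  assumes "fv.subspace Y"
  shows "fv.subspace (power_space P Y)"
  using fv.subspace_0[OF assms] fv.subspace_add[OF assms] fv.subspace_scale[OF assms]
  by (auto simp: power_space_def fv.subspace_def plus_fun_def zero_fun_def scl_fun)

lemma power_space_coords: "Y \<subseteq> coords I \<Longrightarrow> power_space P Y \<subseteq> coords (P \<times> I)"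
  by (auto simp: power_space_def coords_def)

lemma dim_power_space:
  fixes P :: "'k set" and Y :: "('i \<Rightarrow> 'a::field) set"
  assumes "finite P" "fv.subspace Y" "Y \<subseteq> coords I" "finite I"
  shows "fv.dim (power_space P Y) = card P * fv.dim Y"
  using assms(1)
proof (induction P)
  case empty
  have "(power_space {} Y :: ('k \<times> 'i \<Rightarrow> 'a) set) = {0}" by (auto simp: power_space_def fun_eq_iff)
  then show ?case by (simp only: dim_zero card.empty mult_0)
next
  case (insert k P)
  let ?f = "\<lambda>z i. z (k, i)"
  have lin: "Vector_Spaces.linear scl scl ?f"
    by unfold_locales (auto simp: fun_eq_iff)
  have fd: "findim (power_space (insert k P) Y)"
    by (rule findim_subset[OF findim_coords power_space_coords[OF assms(3)]])
      (use insert.hyps assms(4) in auto)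
  have "?f ` power_space (insert k P) Y = Y"
  proof (rule subset_antisym)
    show "Y \<subseteq> ?f ` power_space (insert k P) Y"
    proof
      fix y assume y: "y \<in> Y"
      let ?z = "\<lambda>(l, i). if l = k then y i else 0"
      have "(\<lambda>i. 0) \<in> Y" using fv.subspace_0[OF assms(2)] by (simp add: zero_fun_def)
      then have "(\<lambda>i. if l = k then y i else 0) \<in> Y" for l
        using y by (cases "l = k") auto
      then have "?z \<in> power_space (insert k P) Y" using y by (auto simp: power_space_def)
      then show "y \<in> ?f ` power_space (insert k P) Y" by (rule rev_image_eqI) auto
    qed
  qed (auto simp: power_space_def)
  moreover have "{z \<in> power_space (insert k P) Y. ?f z = 0} = power_space P Y"
    using insert.hyps(2) fv.subspace_0[OF assms(2)]
    by (auto simp: power_space_def fun_eq_iff zero_fun_def)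
  ultimately show ?case
    using rank_nullity[OF lin subspace_power_space[OF assms(2)] fd] insert by (simp del: scl_apply)
qed

text \<open>Independence of a family rather than of a set: a repeated column makes the family
  dependent, but would go unnoticed in the image set.\<close>

definition famind :: "'j set \<Rightarrow> ('j \<Rightarrow> 'i \<Rightarrow> 'a::field) \<Rightarrow> bool" where
  "famind J c \<longleftrightarrow> (\<forall>x. (\<Sum>j\<in>J. scl (x j) (c j)) = 0 \<longrightarrow> (\<forall>j\<in>J. x j = 0))"

lemma famindD: "famind J c \<Longrightarrow> (\<Sum>j\<in>J. scl (x j) (c j)) = 0 \<Longrightarrow> j \<in> J \<Longrightarrow> x j = 0"
  by (auto simp: famind_def)

lemma famind_inj:
  assumes "finite J" "famind J c"
  shows "inj_on c J"
proof (rule inj_onI, rule ccontr)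
  fix a b assume ab: "a \<in> J" "b \<in> J" "c a = c b" "a \<noteq> b"
  let ?x = "\<lambda>d. if d = a then 1 else if d = b then - 1 else 0"
  have "(\<Sum>d\<in>J. scl (?x d) (c d)) = (\<Sum>d\<in>{a,b}. scl (?x d) (c d))"
    by (rule sum.mono_neutral_right) (use ab assms in auto)
  also have "\<dots> = 0" using ab(3,4) by (auto simp: fun_eq_iff)
  finally show False using famindD[OF assms(2), of ?x a] ab(1) by auto
qed

lemma famind_independent:
  assumes "finite J" "famind J c"
  shows "fv.independent (c ` J)"
proof (rule fv.independent_if_scalars_zero)
  fix h x assume h: "(\<Sum>x\<in>c ` J. scl (h x) x) = 0" and x: "x \<in> c ` J"
  have "(\<Sum>j\<in>J. scl (h (c j)) (c j)) = 0"
    using h by (simp add: sum.reindex[OF famind_inj[OF assms]])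
  from famindD[OF assms(2) this] x show "h x = 0" by auto
qed (use assms in auto)

lemma famindI:
  assumes "finite J" "inj_on c J" "fv.independent (c ` J)"
  shows "famind J c"
  unfolding famind_def
proof safe
  fix x j assume x: "(\<Sum>j\<in>J. scl (x j) (c j)) = 0" and j: "j \<in> J"
  let ?u = "\<lambda>y. x (the_inv_into J c y)"
  have "(\<Sum>y\<in>c ` J. scl (?u y) y) = 0"
    using x by (simp add: sum.reindex[OF assms(2)] the_inv_into_f_f[OF assms(2)])
  from fv.independentD[OF assms(3) _ order_refl this, of "c j"] j assms(1)
  show "x j = 0" by (simp add: the_inv_into_f_f[OF assms(2)])
qed

lemma famind_card_le:
  assumes "finite J" "famind J c" "c ` J \<subseteq> S" "findim S"
  shows "card J \<le> fv.dim S"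
  using findim_independent(2)[OF assms(4) famind_independent[OF assms(1,2)] assms(3)]
    card_image[OF famind_inj[OF assms(1,2)]] by simp

text \<open>Lower bounds on ranks are certified by index sets of independent columns, because these
  persist under perturbation and under field extension.\<close>

lemma rank_witness:
  assumes "finite J"
  obtains J0 where "J0 \<subseteq> J" "famind J0 c" "card J0 = fv.dim (c ` J)" "c ` J \<subseteq> fv.span (c ` J0)"
proof -
  obtain B where B: "B \<subseteq> c ` J" "fv.independent B" "c ` J \<subseteq> fv.span B" "card B = fv.dim (c ` J)"
    using fv.basis_exists[of "c ` J"] by blast
  obtain J0 where J0: "J0 \<subseteq> J" "inj_on c J0" "B = c ` J0"
    using B(1) by (metis subset_image_inj)
  have "famind J0 c" using famindI[of J0 c] J0 B(2) assms finite_subset by blast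
  then show ?thesis using that[of J0] J0 B card_image by metis
qed

section \<open>Semicontinuity of the rank along lines\<close>

lemma finite_eigenvalues:
  assumes "(M :: 'a::field mat) \<in> carrier_mat k k"
  shows "finite {e. eigenvalue M e}"
proof -
  have "char_poly M \<noteq> 0" using degree_monic_char_poly[OF assms] by auto
  then show ?thesis using poly_roots_finite[of "char_poly M"]
    by (simp add: eigenvalue_root_char_poly[OF assms])
qed

text \<open>Let \<open>g\<close> send each \<open>c j\<close> to the unit vector at
  \<open>j\<close>. A relation \<open>x\<close> among the columns of \<open>c + t e\<close> then
  becomes \<open>x + t M x = 0\<close>, where \<open>M\<close> is the matrix of \<open>g\<close>
  after \<open>e\<close>, so -1/t is an eigenvalue of \<open>M\<close>. This leaves finitely many
  \<open>t\<close>.\<close>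

lemma famind_perturb:
  fixes c e :: "'j \<Rightarrow> 'i \<Rightarrow> 'a::field"
  assumes "finite J" "famind J c"
  shows "finite {t. \<not> famind J (\<lambda>j. c j + scl t (e j))}"
proof -
  obtain g :: "('i \<Rightarrow> 'a) \<Rightarrow> ('j \<Rightarrow> 'a)" where g: "Vector_Spaces.linear scl scl g"
      "\<And>x. x \<in> c ` J \<Longrightarrow> g x = unitf (the_inv_into J c x)"
    using fvp.linear_independent_extend[OF famind_independent[OF assms], of "\<lambda>x. unitf (the_inv_into J c x)"]
    by blast
  interpret g: Vector_Spaces.linear scl scl g by (rule g(1))
  have gc: "g (c j) = unitf j" if "j \<in> J" for j
    using g(2) that the_inv_into_f_f[OF famind_inj[OF assms]] by auto
  define k where "k = card J"
  obtain h where h: "bij_betw h {..<k} J"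
    using ex_bij_betw_nat_finite[OF assms(1)] unfolding k_def by (metis atLeast0LessThan)
  define M where "M = mat k k (\<lambda>(a, b). g (e (h b)) (h a))"
  have M: "M \<in> carrier_mat k k" by (simp add: M_def)
  have "{t. \<not> famind J (\<lambda>j. c j + scl t (e j))} \<subseteq> insert 0 ((\<lambda>e. - inverse e) ` {e. eigenvalue M e})"
  proof
    fix t assume "t \<in> {t. \<not> famind J (\<lambda>j. c j + scl t (e j))}"
    then obtain x j where x: "(\<Sum>j\<in>J. scl (x j) (c j + scl t (e j))) = 0" and j: "j \<in> J" "x j \<noteq> 0"
      unfolding famind_def by blast
    show "t \<in> insert 0 ((\<lambda>e. - inverse e) ` {e. eigenvalue M e})"
    proof (cases "t = 0")
      case False
      define v where "v = vec k (\<lambda>a. x (h a))"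
      have gx: "(\<Sum>j\<in>J. scl (x j) (unitf j + scl t (g (e j)))) = 0"
        using arg_cong[OF x, of g] gc by (simp add: g.sum g.scale g.add g.zero cong: sum.cong)
      have row: "x i + t * (\<Sum>j\<in>J. g (e j) i * x j) = 0" if "i \<in> J" for i
      proof -
        have "0 = (\<Sum>j\<in>J. x j * unitf j i + t * (g (e j) i * x j))"
          using fun_cong[OF gx, of i] by (simp add: sum_fun_apply algebra_simps)
        also have "\<dots> = (\<Sum>j\<in>J. if j = i then x j else 0) + t * (\<Sum>j\<in>J. g (e j) i * x j)"
          unfolding sum.distrib sum_distrib_left unitf_def
          by (intro arg_cong2[of _ _ _ _ "(+)"] sum.cong) auto
        also have "\<dots> = x i + t * (\<Sum>j\<in>J. g (e j) i * x j)" using that assms(1) by simp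
        finally show ?thesis by simp
      qed
      have ha: "h a \<in> J" if "a < k" for a using h that by (auto simp: bij_betw_def)
      have "M *\<^sub>v v = (- inverse t) \<cdot>\<^sub>v v"
      proof (rule eq_vecI)
        fix a assume "a < dim_vec ((- inverse t) \<cdot>\<^sub>v v)"
        then have a: "a < k" by (simp add: v_def)
        have "(M *\<^sub>v v) $ a = (\<Sum>b<k. g (e (h b)) (h a) * x (h b))"
          using a by (simp add: M_def v_def scalar_prod_def atLeast0LessThan)
        also have "\<dots> = (\<Sum>j\<in>J. g (e j) (h a) * x j)"
          by (rule sum.reindex_bij_betw[OF h])
        also have "\<dots> = - inverse t * x (h a)"
          using row[OF ha[OF a]] False by (simp add: field_simps add_eq_0_iff)
        finally show "(M *\<^sub>v v) $ a = ((- inverse t) \<cdot>\<^sub>v v) $ a" using a by (simp add: v_def)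
      qed (simp add: M_def v_def)
      moreover have "v \<noteq> 0\<^sub>v k"
      proof -
        obtain a where "a < k" "h a = j" using h j(1) by (auto simp: bij_betw_def)
        then have "v $ a \<noteq> 0\<^sub>v k $ a" using j(2) by (simp add: v_def)
        then show ?thesis by metis
      qed
      ultimately have "eigenvalue M (- inverse t)"
        unfolding eigenvalue_def eigenvector_def using M by (auto intro!: exI[of _ v] simp: v_def)
      then show ?thesis by (intro insertI2 rev_image_eqI[of "- inverse t"]) auto
    qed simp
  qed
  then show ?thesis using finite_eigenvalues[OF M] by (meson finite_imageI finite_insert finite_subset)
qed

text \<open>An independent subfamily that realises the rank at t = 0 stays independent for all but
  finitely many \<open>t\<close>.\<close>

lemma rank_perturb:
  fixes c e :: "'j \<Rightarrow> 'i \<Rightarrow> 'a::field"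
  assumes "finite J"
  shows "finite {t. fv.dim ((\<lambda>j. c j + scl t (e j)) ` J) < fv.dim (c ` J)}"
proof -
  obtain J0 where J0: "J0 \<subseteq> J" "famind J0 c" "card J0 = fv.dim (c ` J)"
    using rank_witness[OF assms] by metis
  have fin: "finite J0" using J0(1) assms finite_subset by blast
  have "fv.dim (c ` J) \<le> fv.dim ((\<lambda>j. c j + scl t (e j)) ` J)" if "famind J0 (\<lambda>j. c j + scl t (e j))" for t
  proof -
    have "card J0 \<le> fv.dim (fv.span ((\<lambda>j. c j + scl t (e j)) ` J))"
      by (rule famind_card_le[OF fin that]) (use J0(1) assms in \<open>auto intro: fv.span_base\<close>)
    then show ?thesis using J0(3) by simp
  qed
  then have "{t. fv.dim ((\<lambda>j. c j + scl t (e j)) ` J) < fv.dim (c ` J)} \<subseteq>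
      {t. \<not> famind J0 (\<lambda>j. c j + scl t (e j))}"
    by (auto simp: not_le[symmetric])
  then show ?thesis using famind_perturb[OF fin J0(2), of e] finite_subset by blast
qed

text \<open>Generic specialisation: coefficients are exchanged one at a time for elements of the
  infinite set \<open>S\<close>, each time avoiding the finitely many values at which the rank
  drops. Both directions of the passage between the ground field and the division algebra rest on
  this.\<close>

lemma rank_swap:
  fixes C :: "'l \<Rightarrow> 'j \<Rightarrow> 'i \<Rightarrow> 'a::field"
  assumes "finite L" "finite J" "infinite S"
  shows "\<exists>y. (\<forall>l\<in>L. y l \<in> S) \<and>
    fv.dim ((\<lambda>j. \<Sum>l\<in>L. scl (x l) (C l j)) ` J) \<le> fv.dim ((\<lambda>j. \<Sum>l\<in>L. scl (y l) (C l j)) ` J)"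
proof -
  \<comment> \<open>The summand \<open>c\<close> absorbs the coefficients that have already been
    exchanged.\<close>
  have "\<exists>y. (\<forall>l\<in>L. y l \<in> S) \<and>
    fv.dim ((\<lambda>j. c j + (\<Sum>l\<in>L. scl (x l) (C l j))) ` J) \<le> fv.dim ((\<lambda>j. c j + (\<Sum>l\<in>L. scl (y l) (C l j))) ` J)" for c
    using assms(1)
  proof (induction L arbitrary: c)
    case empty
    then show ?case by simp
  next
    case (insert l L)
    let ?c = "\<lambda>j. c j + (\<Sum>l\<in>insert l L. scl (x l) (C l j))"
    \<comment> \<open>Here \<open>t\<close> is the difference between the new coefficient and the
      old one.\<close>
    obtain t where t: "t + x l \<in> S" "fv.dim (?c ` J) \<le> fv.dim ((\<lambda>j. ?c j + scl t (C l j)) ` J)"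
    proof -
      have "infinite ((\<lambda>s. s - x l) ` S)" using assms(3) by (simp add: finite_image_iff inj_on_def)
      then obtain t where t: "t \<in> (\<lambda>s. s - x l) ` S" "t \<notin> {t. fv.dim ((\<lambda>j. ?c j + scl t (C l j)) ` J) < fv.dim (?c ` J)}"
        using rank_perturb[OF assms(2), of ?c "C l"] by (meson finite_subset subsetI)
      have "t + x l \<in> S" using t(1) by auto
      moreover have "fv.dim (?c ` J) \<le> fv.dim ((\<lambda>j. ?c j + scl t (C l j)) ` J)"
        using t(2) unfolding mem_Collect_eq not_less .
      ultimately show ?thesis by (rule that)
    qed
    have eq: "?c j + scl t (C l j) = (c j + scl (t + x l) (C l j)) + (\<Sum>l\<in>L. scl (x l) (C l j))" for j
      using insert.hyps by (simp add: algebra_simps fv.scale_left_distrib)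
    obtain y where y: "\<forall>l\<in>L. y l \<in> S"
      "fv.dim ((\<lambda>j. (c j + scl (t + x l) (C l j)) + (\<Sum>l\<in>L. scl (x l) (C l j))) ` J)
       \<le> fv.dim ((\<lambda>j. (c j + scl (t + x l) (C l j)) + (\<Sum>l\<in>L. scl (y l) (C l j))) ` J)"
      using insert.IH[of "\<lambda>j. c j + scl (t + x l) (C l j)"] by blast
    let ?y = "y(l := t + x l)"
    have eq2: "(c j + scl (t + x l) (C l j)) + (\<Sum>l\<in>L. scl (y l) (C l j)) = c j + (\<Sum>l\<in>insert l L. scl (?y l) (C l j))" for j
    proof -
      have "(\<Sum>k\<in>L. scl (?y k) (C k j)) = (\<Sum>k\<in>L. scl (y k) (C k j))"
        by (rule sum.cong) (use insert.hyps in auto)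
      then show ?thesis using insert.hyps by (simp add: add.assoc)
    qed
    have "fv.dim (?c ` J) \<le> fv.dim ((\<lambda>j. c j + (\<Sum>l\<in>insert l L. scl (?y l) (C l j))) ` J)"
      using t(2) y(2) unfolding eq eq2 by (rule order_trans)
    moreover have "\<forall>k\<in>insert l L. ?y k \<in> S" using t(1) y(1) by simp
    ultimately show "\<exists>y. (\<forall>l\<in>insert l L. y l \<in> S) \<and>
      fv.dim (?c ` J) \<le> fv.dim ((\<lambda>j. c j + (\<Sum>l\<in>insert l L. scl (y l) (C l j))) ` J)"
      by (intro exI[of _ ?y] conjI)
  qed
  from this[of "\<lambda>j. 0"] show ?thesis by simp
qed

lemma span_family:
  assumes "finite J"
  shows "fv.span (c ` J) = (\<lambda>x. \<Sum>j\<in>J. scl (x j) (c j)) ` coords J"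
proof (rule subset_antisym)
  let ?f = "\<lambda>x. \<Sum>j\<in>J. scl (x j) (c j)"
  have lin: "Vector_Spaces.linear scl scl ?f"
    by unfold_locales (auto simp: fun_eq_iff sum_fun_apply algebra_simps sum.distrib sum_distrib_left)
  show "fv.span (c ` J) \<subseteq> ?f ` coords J"
  proof (rule fv.span_minimal)
    show "fv.subspace (?f ` coords J)" by (rule fvp.linear_subspace_image[OF lin subspace_coords])
    show "c ` J \<subseteq> ?f ` coords J"
    proof
      fix y assume "y \<in> c ` J"
      then obtain k where k: "k \<in> J" "y = c k" by blast
      have "?f (unitf k) = (\<Sum>j\<in>{k}. scl (unitf k j) (c j))"
        by (rule sum.mono_neutral_right) (use k assms in \<open>auto simp: unitf_def fun_eq_iff\<close>)
      then have "y = ?f (unitf k)" using k by (auto simp: unitf_def fun_eq_iff)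
      moreover have "unitf k \<in> coords J" using k by (auto simp: unitf_def coords_def)
      ultimately show "y \<in> ?f ` coords J" by blast
    qed
  qed
  show "?f ` coords J \<subseteq> fv.span (c ` J)"
    by (intro image_subsetI fv.span_sum fv.span_scale fv.span_base imageI)
qed

lemma family_rank_nullity:
  fixes c :: "'j \<Rightarrow> 'i \<Rightarrow> 'a::field"
  assumes "finite J"
  shows "fv.dim (c ` J) + fv.dim {x \<in> coords J. (\<Sum>j\<in>J. scl (x j) (c j)) = 0} = card J"
proof -
  let ?f = "\<lambda>x. \<Sum>j\<in>J. scl (x j) (c j)"
  have lin: "Vector_Spaces.linear scl scl ?f"
    by unfold_locales (auto simp: fun_eq_iff sum_fun_apply algebra_simps sum.distrib sum_distrib_left)
  show ?thesis
    using rank_nullity[OF lin subspace_coords findim_coords[OF assms]] dim_coords[where 'a = 'a, OF assms]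
    unfolding span_family[OF assms, symmetric] fv.dim_span by simp
qed

section \<open>Rank under field extensions\<close>

lemma famind_hom:
  fixes c :: "'j \<Rightarrow> 'i \<Rightarrow> 'a::field" and h :: "'a \<Rightarrow> 'k::field"
  assumes "field_hom h" "finite I" "finite J" "\<And>j. j \<in> J \<Longrightarrow> c j \<in> coords I" "famind J c"
  shows "famind J (\<lambda>j i. h (c j i))"
proof -
  interpret h: field_hom h by (rule assms(1))
  obtain g :: "('i \<Rightarrow> 'a) \<Rightarrow> ('j \<Rightarrow> 'a)" where g: "Vector_Spaces.linear scl scl g"
      "\<And>x. x \<in> c ` J \<Longrightarrow> g x = unitf (the_inv_into J c x)"
    using fvp.linear_independent_extend[OF famind_independent[OF assms(3,5)], of "\<lambda>x. unitf (the_inv_into J c x)"]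
    by blast
  interpret g: Vector_Spaces.linear scl scl g by (rule g(1))
  \<comment> \<open>The values \<open>g (unitf i) l\<close> form a dual family to \<open>c\<close>.
    Their images under \<open>h\<close> are dual to the extended columns, and pairing a relation
    with them isolates each coefficient.\<close>
  have dual: "(\<Sum>i\<in>I. c j i * g (unitf i) l) = (if l = j then 1 else 0)" if "j \<in> J" for j l
  proof -
    have "g (c j) = unitf j" using g(2) that the_inv_into_f_f[OF famind_inj[OF assms(3,5)]] by auto
    moreover have "g (c j) = (\<Sum>i\<in>I. scl (c j i) (g (unitf i)))"
      by (subst coords_sum[OF assms(2) assms(4)[OF that]]) (simp only: g.sum g.scale)
    ultimately have "unitf j l = (\<Sum>i\<in>I. scl (c j i) (g (unitf i))) l" by simp
    then show ?thesis by (simp add: sum_fun_apply unitf_def)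
  qed
  show ?thesis
    unfolding famind_def
  proof (intro allI impI ballI)
    fix x l assume x: "(\<Sum>j\<in>J. scl (x j) (\<lambda>i. h (c j i))) = 0" and l: "l \<in> J"
    have "0 = (\<Sum>i\<in>I. (\<Sum>j\<in>J. x j * h (c j i)) * h (g (unitf i) l))"
      using fun_cong[OF x] by (simp add: sum_fun_apply)
    also have "\<dots> = (\<Sum>j\<in>J. x j * h (\<Sum>i\<in>I. c j i * g (unitf i) l))"
      unfolding h.hom_sum sum_distrib_left sum_distrib_right
      by (subst sum.swap) (simp add: h.hom_mult mult.assoc)
    also have "\<dots> = (\<Sum>j\<in>J. if l = j then x j else 0)"
      by (rule sum.cong) (auto simp: dual)
    also have "\<dots> = x l" using l assms(3) by simp
    finally show "x l = 0" by simp
  qed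
qed

lemma famind_hom_rev:
  fixes c :: "'j \<Rightarrow> 'i \<Rightarrow> 'a::field" and h :: "'a \<Rightarrow> 'k::field"
  assumes "field_hom h" "famind J (\<lambda>j i. h (c j i))"
  shows "famind J c"
  unfolding famind_def
proof (intro allI impI ballI)
  interpret h: field_hom h by (rule assms(1))
  fix x l assume x: "(\<Sum>j\<in>J. scl (x j) (c j)) = 0" and l: "l \<in> J"
  have "(\<Sum>j\<in>J. scl (h (x j)) (\<lambda>i. h (c j i))) = 0"
  proof
    fix i
    have "h (\<Sum>j\<in>J. x j * c j i) = 0" using fun_cong[OF x, of i] by (simp add: sum_fun_apply)
    then show "(\<Sum>j\<in>J. scl (h (x j)) (\<lambda>i. h (c j i))) i = 0 i"
      by (simp add: sum_fun_apply h.hom_sum h.hom_mult)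
  qed
  from famindD[OF assms(2) this l] show "x l = 0" by simp
qed

lemma dim_hom:
  fixes c :: "'j \<Rightarrow> 'i \<Rightarrow> 'a::field" and h :: "'a \<Rightarrow> 'k::field"
  assumes "field_hom h" "finite I" "finite J" "\<And>j. j \<in> J \<Longrightarrow> c j \<in> coords I"
  shows "fv.dim ((\<lambda>j i. h (c j i)) ` J) = fv.dim (c ` J)"
proof (rule antisym)
  obtain J0 where J0: "J0 \<subseteq> J" "famind J0 (\<lambda>j i. h (c j i))" "card J0 = fv.dim ((\<lambda>j i. h (c j i)) ` J)"
    using rank_witness[OF assms(3)] by metis
  have fin: "finite J0" using J0(1) assms(3) finite_subset by blast
  have "card J0 \<le> fv.dim (fv.span (c ` J))"
    by (rule famind_card_le[OF fin famind_hom_rev[OF assms(1) J0(2)]])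
      (use J0(1) assms(3) in \<open>auto intro: fv.span_base\<close>)
  then show "fv.dim ((\<lambda>j i. h (c j i)) ` J) \<le> fv.dim (c ` J)" using J0(3) by simp
next
  obtain J0 where J0: "J0 \<subseteq> J" "famind J0 c" "card J0 = fv.dim (c ` J)"
    using rank_witness[OF assms(3)] by metis
  have fin: "finite J0" using J0(1) assms(3) finite_subset by blast
  have "card J0 \<le> fv.dim (fv.span ((\<lambda>j i. h (c j i)) ` J))"
    by (rule famind_card_le[OF fin famind_hom[OF assms(1,2) fin _ J0(2)]])
      (use J0(1) assms(3,4) in \<open>auto intro: fv.span_base\<close>)
  then show "fv.dim (c ` J) \<le> fv.dim ((\<lambda>j i. h (c j i)) ` J)" using J0(3) by simp
qed

section \<open>Block elimination over division rings\<close>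

definition mat_act :: "nat \<Rightarrow> (nat \<Rightarrow> nat \<Rightarrow> 'k::field) \<Rightarrow> (nat \<Rightarrow> 'k) \<Rightarrow> nat \<Rightarrow> 'k" where
  "mat_act d M v = (\<lambda>i. if i < d then \<Sum>j<d. M i j * v j else 0)"

definition mat_comp :: "nat \<Rightarrow> (nat \<Rightarrow> nat \<Rightarrow> 'k::field) \<Rightarrow> (nat \<Rightarrow> nat \<Rightarrow> 'k) \<Rightarrow> nat \<Rightarrow> nat \<Rightarrow> 'k" where
  "mat_comp d M N = (\<lambda>i k. \<Sum>j<d. M i j * N j k)"

lemma linear_mat_act: "Vector_Spaces.linear scl scl (mat_act d M)"
  by unfold_locales (auto simp: mat_act_def fun_eq_iff algebra_simps sum.distrib sum_distrib_left)

lemma mat_act_coords [simp]: "mat_act d M v \<in> coords {..<d}"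
  by (auto simp: mat_act_def coords_def)

lemma mat_act_comp: "mat_act d (mat_comp d M N) v = mat_act d M (mat_act d N v)"
proof
  fix i
  have "(\<Sum>j<d. (\<Sum>k<d. M i k * N k j) * v j) = (\<Sum>k<d. M i k * (\<Sum>j<d. N k j * v j))"
    unfolding sum_distrib_left sum_distrib_right by (subst sum.swap) (simp add: mult.assoc)
  then show "mat_act d (mat_comp d M N) v i = mat_act d M (mat_act d N v) i"
    by (simp add: mat_act_def mat_comp_def)
qed

lemma mat_act_unitf: "j < d \<Longrightarrow> i < d \<Longrightarrow> mat_act d M (unitf j) i = M i j"
  by (simp add: mat_act_def unitf_def if_distrib cong: if_cong)

text \<open>Only entries with indices below \<open>d\<close> are compared: matrices are functions on
  all of nat, and \<open>mat_act\<close> ignores values outside this window.\<close>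

definition left_inv :: "nat \<Rightarrow> (nat \<Rightarrow> nat \<Rightarrow> 'k::field) \<Rightarrow> (nat \<Rightarrow> nat \<Rightarrow> 'k) \<Rightarrow> bool" where
  "left_inv d N M \<longleftrightarrow> (\<forall>i<d. \<forall>k<d. mat_comp d N M i k = (if i = k then 1 else 0))"

lemma left_inv_act:
  assumes "left_inv d N M" "v \<in> coords {..<d}"
  shows "mat_act d N (mat_act d M v) = v"
proof -
  have "mat_act d (mat_comp d N M) v i = v i" for i
  proof (cases "i < d")
    case True
    then have "mat_act d (mat_comp d N M) v i = (\<Sum>j<d. if i = j then v j else 0)"
      using assms(1) True unfolding mat_act_def left_inv_def
      by (simp only: if_True lessThan_iff) (intro sum.cong, auto)
    then show ?thesis using True by simp
  qed (use assms(2) in \<open>auto simp: mat_act_def coords_def\<close>)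
  then show ?thesis by (auto simp: mat_act_comp)
qed

lemma mat_act_zero [simp]: "mat_act d M 0 = 0"
  by (auto simp: mat_act_def)

lemma mat_act_surj:
  fixes M :: "nat \<Rightarrow> nat \<Rightarrow> 'k::field"
  assumes "\<And>v. v \<in> coords {..<d} \<Longrightarrow> mat_act d M v = 0 \<Longrightarrow> v = 0"
  shows "mat_act d M ` coords {..<d} = coords {..<d}"
proof (rule subspace_eqI[OF findim_coords])
  show "fv.dim (coords {..<d} :: (nat \<Rightarrow> 'k) set) \<le> fv.dim (mat_act d M ` coords {..<d})"
    by (subst dim_image_inj[OF linear_mat_act subspace_coords findim_coords]) (use assms in auto)
qed (auto simp: fvp.linear_subspace_image[OF linear_mat_act])

text \<open>A matrix with a left inverse acts injectively, hence onto, so its left inverses act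
  alike. Symmetries of a matrix thereby pass to its inverse, see
  \<open>cyc_left_inv\<close>.\<close>

lemma left_inv_unique:
  assumes "left_inv d N M" "left_inv d N' M" "i < d" "j < d"
  shows "N i j = N' i j"
proof -
  have "mat_act d M ` coords {..<d} = coords {..<d}"
    by (rule mat_act_surj) (metis left_inv_act[OF assms(1)] mat_act_zero)
  moreover have "unitf j \<in> coords {..<d}" using assms(4) by (auto simp: unitf_def coords_def)
  ultimately obtain u where u: "u \<in> coords {..<d}" "unitf j = mat_act d M u" by blast
  have "mat_act d N (unitf j) = mat_act d N' (unitf j)"
    unfolding u(2) using left_inv_act u(1) assms(1,2) by metis
  then show ?thesis using mat_act_unitf assms(3,4) by metis
qed

lemma left_inv_exists:
  assumes "\<And>v. v \<in> coords {..<d} \<Longrightarrow> mat_act d M v = 0 \<Longrightarrow> v = 0"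
  shows "\<exists>N. left_inv d N M"
proof -
  have "inj_on (mat_act d M) (coords {..<d})"
  proof (rule inj_onI)
    fix x y assume xy: "x \<in> coords {..<d}" "y \<in> coords {..<d}" "mat_act d M x = mat_act d M y"
    have "mat_act d M (x - y) = 0"
      using xy(3) by (simp add: fvp.linear_diff[OF linear_mat_act])
    moreover have "x - y \<in> coords {..<d}" using xy(1,2) fv.subspace_diff[OF subspace_coords] by blast
    ultimately show "x = y" using assms by (metis eq_iff_diff_eq_0)
  qed
  then obtain g where g: "Vector_Spaces.linear scl scl g" "\<And>v. v \<in> coords {..<d} \<Longrightarrow> g (mat_act d M v) = v"
    using fvp.linear_exists_left_inverse_on[OF linear_mat_act subspace_coords] by metis
  interpret g: Vector_Spaces.linear scl scl g by (rule g(1))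
  define N where "N = (\<lambda>i j. g (unitf j) i)"
  have "mat_comp d N M i k = (if i = k then 1 else 0)" if "i < d" "k < d" for i k
  proof -
    have u: "unitf k \<in> coords {..<d}" using that(2) by (auto simp: unitf_def coords_def)
    have "mat_act d M (unitf k) = (\<Sum>j<d. scl (mat_act d M (unitf k) j) (unitf j))"
      by (rule coords_sum) auto
    also have "\<dots> = (\<Sum>j<d. scl (M j k) (unitf j))"
      by (rule sum.cong) (use that mat_act_unitf in auto)
    finally have "unitf k = g (\<Sum>j<d. scl (M j k) (unitf j))" using g(2)[OF u] by simp
    also have "\<dots> = (\<Sum>j<d. scl (M j k) (g (unitf j)))" by (simp add: g.sum g.scale)
    finally have "unitf k i = (\<Sum>j<d. M j k * g (unitf j) i)" by (simp add: sum_fun_apply)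
    then show ?thesis by (simp add: mat_comp_def N_def unitf_def mult.commute)
  qed
  then show ?thesis unfolding left_inv_def by blast
qed

text \<open>A division ring of matrices, reduced to what elimination uses: nonzero blocks can serve
  as pivots, and closure under differences and products keeps Schur complements inside
  \<open>D\<close>.\<close>

definition division_set :: "nat \<Rightarrow> (nat \<Rightarrow> nat \<Rightarrow> 'k::field) set \<Rightarrow> bool" where
  "division_set d D \<longleftrightarrow>
     (\<forall>M\<in>D. \<forall>N\<in>D. (\<lambda>i j. M i j - N i j) \<in> D \<and> mat_comp d M N \<in> D) \<and>
     (\<forall>M\<in>D. (\<forall>i<d. \<forall>j<d. M i j = 0) \<or> (\<exists>N\<in>D. left_inv d N M))"

definition block_kernel :: "nat \<Rightarrow> 'b set \<Rightarrow> 'r set \<Rightarrow> ('r \<Rightarrow> 'b \<Rightarrow> nat \<Rightarrow> nat \<Rightarrow> 'k::field) \<Rightarrow> ('b \<times> nat \<Rightarrow> 'k) set" where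
  "block_kernel d B R a = {x \<in> coords (B \<times> {..<d}).
     \<forall>\<rho>\<in>R. (\<Sum>\<beta>\<in>B. mat_act d (a \<rho> \<beta>) (\<lambda>j. x (\<beta>, j))) = 0}"

lemma mat_act_diff_left: "mat_act d (\<lambda>i j. M i j - N i j) v = mat_act d M v - mat_act d N v"
  by (auto simp: mat_act_def fun_eq_iff algebra_simps sum_subtractf)

text \<open>Block Gaussian elimination; \<open>F\<close> is the set of free block variables.\<close>

lemma block_kernel_free:
  fixes a :: "'r \<Rightarrow> 'b \<Rightarrow> nat \<Rightarrow> nat \<Rightarrow> 'k::field"
  assumes "division_set d D" "finite B" "\<And>\<rho> \<beta>. \<rho> \<in> R \<Longrightarrow> \<beta> \<in> B \<Longrightarrow> a \<rho> \<beta> \<in> D"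
  shows "\<exists>F\<subseteq>B. \<forall>y\<in>coords (F \<times> {..<d}). \<exists>!x. x \<in> block_kernel d B R a \<and> (\<forall>f\<in>F. \<forall>j. x (f, j) = y (f, j))"
  using assms(2,3)
proof (induction "card B" arbitrary: B a rule: less_induct)
  case less
  show ?case
  proof (cases "\<forall>\<rho>\<in>R. \<forall>\<beta>\<in>B. \<forall>i<d. \<forall>j<d. a \<rho> \<beta> i j = 0")
    case True
    have "block_kernel d B R a = coords (B \<times> {..<d})"
    proof -
      have "(\<Sum>\<beta>\<in>B. mat_act d (a \<rho> \<beta>) (\<lambda>j. x (\<beta>, j))) = 0" if "\<rho> \<in> R" for \<rho> x
        by (rule sum.neutral) (use True that in \<open>auto simp: mat_act_def\<close>)
      then show ?thesis by (auto simp: block_kernel_def)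
    qed
    moreover have "\<forall>y\<in>coords (B \<times> {..<d}). \<exists>!x. x \<in> coords (B \<times> {..<d}) \<and> (\<forall>f\<in>B. \<forall>j. x (f, j) = (y (f, j :: nat) :: 'k))"
    proof (intro ballI ex1I conjI)
      fix y z :: "'b \<times> nat \<Rightarrow> 'k"
      assume "y \<in> coords (B \<times> {..<d})" "z \<in> coords (B \<times> {..<d}) \<and> (\<forall>f\<in>B. \<forall>j. z (f, j) = y (f, j))"
      then have "z (f, j) = y (f, j)" for f j by (cases "f \<in> B") (auto simp: coords_def)
      then show "z = y" by auto
    qed auto
    ultimately have "\<forall>y\<in>coords (B \<times> {..<d}). \<exists>!x. x \<in> block_kernel d B R a \<and> (\<forall>f\<in>B. \<forall>j. x (f, j) = y (f, j))"
      by (simp only:)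
    then show ?thesis by (intro exI[of _ B] conjI order_refl)
  next
    case False
    then obtain \<rho>0 \<beta>0 where p: "\<rho>0 \<in> R" "\<beta>0 \<in> B" "\<not> (\<forall>i<d. \<forall>j<d. a \<rho>0 \<beta>0 i j = 0)" by blast
    then obtain q where q: "q \<in> D" "left_inv d q (a \<rho>0 \<beta>0)"
      using assms(1) less.prems(2) unfolding division_set_def by meson
    define B' where "B' = B - {\<beta>0}"
    \<comment> \<open>The Schur complement of the pivot. The pivot row stays among the rows, so a
      left inverse \<open>q\<close> suffices: its reduced equation states that the pivot undoes
      \<open>q\<close> on \<open>s \<rho>0 x\<close>.\<close>
    define a' where "a' \<rho> \<beta> = (\<lambda>i j. a \<rho> \<beta> i j - mat_comp d (a \<rho> \<beta>0) (mat_comp d q (a \<rho>0 \<beta>)) i j)" for \<rho> \<beta>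
    have "card B' < card B" unfolding B'_def using less.prems(1) p(2) by (rule card_Diff1_less)
    then have B: "finite B'" "\<beta>0 \<notin> B'" "B = insert \<beta>0 B'" "card B' < card B"
      using p(2) less.prems(1) by (auto simp: B'_def)
    have "a' \<rho> \<beta> \<in> D" if "\<rho> \<in> R" "\<beta> \<in> B'" for \<rho> \<beta>
      using assms(1) q(1) less.prems(2) that p B(3) unfolding division_set_def a'_def by (metis insertCI)
    from less.hyps[OF B(4) B(1) this] obtain F where "F \<subseteq> B' \<and> (\<forall>y\<in>coords (F \<times> {..<d}).
      \<exists>!x. x \<in> block_kernel d B' R a' \<and> (\<forall>f\<in>F. \<forall>j. x (f, j) = y (f, j)))"
      by (rule exE)
    note F = conjunct1[OF this] bspec[OF conjunct2[OF this]]
    define s where "s \<rho> x = (\<Sum>\<beta>\<in>B'. mat_act d (a \<rho> \<beta>) (\<lambda>j. x (\<beta>, j)))" for \<rho> and x :: "'b \<times> nat \<Rightarrow> 'k"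
    have act_sum: "mat_act d M (\<Sum>\<beta>\<in>B'. v \<beta>) = (\<Sum>\<beta>\<in>B'. mat_act d M (v \<beta>))" for M :: "nat \<Rightarrow> nat \<Rightarrow> 'k" and v
      by (rule fvp.linear_sum[OF linear_mat_act])
    have s': "(\<Sum>\<beta>\<in>B'. mat_act d (a' \<rho> \<beta>) (\<lambda>j. x (\<beta>, j))) = s \<rho> x - mat_act d (a \<rho> \<beta>0) (mat_act d q (s \<rho>0 x))" for \<rho> x
      by (simp add: a'_def s_def mat_act_diff_left sum_subtractf mat_act_comp act_sum)
    have row: "(\<Sum>\<beta>\<in>B. mat_act d (a \<rho> \<beta>) (\<lambda>j. x (\<beta>, j))) = s \<rho> x + mat_act d (a \<rho> \<beta>0) (\<lambda>j. x (\<beta>0, j))" for \<rho> x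
      using B by (simp add: s_def add.commute)
    have neg: "mat_act d M (- v) = - mat_act d M v" for M :: "nat \<Rightarrow> nat \<Rightarrow> 'k" and v
      by (rule fvp.linear_neg[OF linear_mat_act])
    have s_cong: "s \<rho> x = s \<rho> x'" if "\<And>\<beta> j. \<beta> \<in> B' \<Longrightarrow> x (\<beta>, j) = x' (\<beta>, j)" for \<rho> x x'
      unfolding s_def using that by simp
    \<comment> \<open>A kernel vector is a kernel vector of the reduced system together with the
      value that the pivot row forces at \<open>\<beta>0\<close>.\<close>
    have iff: "x \<in> block_kernel d B R a \<longleftrightarrow> x \<in> coords (B \<times> {..<d}) \<and>
        (\<lambda>j. x (\<beta>0, j)) = - mat_act d q (s \<rho>0 x) \<and>
        (\<forall>\<rho>\<in>R. s \<rho> x - mat_act d (a \<rho> \<beta>0) (mat_act d q (s \<rho>0 x)) = 0)" (is "?L \<longleftrightarrow> ?C \<and> ?E \<and> ?R") for x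
    proof
      assume L: ?L
      then have C: ?C and rows: "\<And>\<rho>. \<rho> \<in> R \<Longrightarrow> s \<rho> x + mat_act d (a \<rho> \<beta>0) (\<lambda>j. x (\<beta>0, j)) = 0"
        by (auto simp: block_kernel_def row)
      have "(\<lambda>j. x (\<beta>0, j)) \<in> coords {..<d}" using C by (auto simp: coords_def)
      then have "(\<lambda>j. x (\<beta>0, j)) = mat_act d q (mat_act d (a \<rho>0 \<beta>0) (\<lambda>j. x (\<beta>0, j)))"
        using left_inv_act[OF q(2)] by simp
      also have "mat_act d (a \<rho>0 \<beta>0) (\<lambda>j. x (\<beta>0, j)) = - s \<rho>0 x"
        using rows[OF p(1)] by (simp add: eq_neg_iff_add_eq_0 add.commute)
      finally have E: ?E unfolding neg .
      have ?R using rows unfolding E neg by simp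
      then show "?C \<and> ?E \<and> ?R" using C E by blast
    next
      assume A: "?C \<and> ?E \<and> ?R"
      then have E: ?E by blast
      have "\<forall>\<rho>\<in>R. s \<rho> x + mat_act d (a \<rho> \<beta>0) (\<lambda>j. x (\<beta>0, j)) = 0"
        unfolding E neg using A by simp
      then show ?L using A by (simp add: block_kernel_def row)
    qed
    have "\<exists>!x. x \<in> block_kernel d B R a \<and> (\<forall>f\<in>F. \<forall>j. x (f, j) = y (f, j))"
      if y: "y \<in> coords (F \<times> {..<d})" for y
    proof -
      obtain x' where x': "x' \<in> block_kernel d B' R a'" "\<forall>f\<in>F. \<forall>j. x' (f, j) = y (f, j)"
        and uniq: "\<And>z. z \<in> block_kernel d B' R a' \<Longrightarrow> \<forall>f\<in>F. \<forall>j. z (f, j) = y (f, j) \<Longrightarrow> z = x'"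
        using F(2)[OF y] by (metis (no_types, lifting))
      define x where "x = (\<lambda>(\<beta>, j). if \<beta> = \<beta>0 then - mat_act d q (s \<rho>0 x') j else x' (\<beta>, j))"
      have sx: "s \<rho> x = s \<rho> x'" for \<rho>
        by (rule s_cong) (use B(2) in \<open>auto simp: x_def\<close>)
      have xN: "x \<in> block_kernel d B R a"
        unfolding iff sx
      proof (intro conjI ballI)
        show "x \<in> coords (B \<times> {..<d})"
          using x'(1) by (auto simp: block_kernel_def coords_def x_def B(3) mat_act_def)
        show "(\<lambda>j. x (\<beta>0, j)) = - mat_act d q (s \<rho>0 x')" by (auto simp: x_def)
        fix \<rho> assume "\<rho> \<in> R"
        then show "s \<rho> x' - mat_act d (a \<rho> \<beta>0) (mat_act d q (s \<rho>0 x')) = 0"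
          using x'(1) unfolding block_kernel_def s' by blast
      qed
      have xF: "\<forall>f\<in>F. \<forall>j. x (f, j) = y (f, j)"
        using x'(2) F(1) B(2) by (auto simp: x_def)
      have xu: "z = x" if z: "z \<in> block_kernel d B R a" "\<forall>f\<in>F. \<forall>j. z (f, j) = y (f, j)" for z
      proof -
        define z' where "z' = (\<lambda>(\<beta>, j). if \<beta> = \<beta>0 then 0 else z (\<beta>, j))"
        have sz: "s \<rho> z' = s \<rho> z" for \<rho>
          by (rule s_cong) (use B(2) in \<open>auto simp: z'_def\<close>)
        have "z' \<in> block_kernel d B' R a'"
          using z(1) unfolding iff block_kernel_def[of d B'] s' mem_Collect_eq sz
          by (auto simp: coords_def z'_def B(3))
        moreover have "\<forall>f\<in>F. \<forall>j. z' (f, j) = y (f, j)"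
          using z(2) F(1) B(2) by (auto simp: z'_def)
        ultimately have "z' = x'" by (rule uniq)
        have "z (\<beta>, j) = x (\<beta>, j)" for \<beta> j
        proof (cases "\<beta> = \<beta>0")
          case True
          have "(\<lambda>j. z (\<beta>0, j)) = - mat_act d q (s \<rho>0 x')"
            using z(1) unfolding iff \<open>z' = x'\<close>[symmetric] sz by blast
          then show ?thesis using True by (auto simp: x_def fun_eq_iff)
        next
          case False
          then show ?thesis using fun_cong[OF \<open>z' = x'\<close>, of "(\<beta>, j)"] by (simp add: x_def z'_def)
        qed
        then show ?thesis by auto
      qed
      show ?thesis
      proof (rule ex1I)
        show "x \<in> block_kernel d B R a \<and> (\<forall>f\<in>F. \<forall>j. x (f, j) = y (f, j))"
          using xN xF by (rule conjI)
        fix z assume "z \<in> block_kernel d B R a \<and> (\<forall>f\<in>F. \<forall>j. z (f, j) = y (f, j))"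
        then show "z = x" by (elim conjE) (rule xu)
      qed
    qed
    moreover have "F \<subseteq> B" using F(1) B(3) by blast
    ultimately show ?thesis by (intro exI[of _ F] conjI ballI)
  qed
qed

lemma linear_block_row:
  fixes M :: "'b \<Rightarrow> nat \<Rightarrow> nat \<Rightarrow> 'k::field"
  shows
  "Vector_Spaces.linear scl scl (\<lambda>x. \<Sum>\<beta>\<in>B. mat_act d (M \<beta>) (\<lambda>j. x (\<beta>, j)))"
proof (rule fvp.linear_compose_sum, intro ballI)
  fix \<beta>
  have "Vector_Spaces.linear scl scl (\<lambda>(x :: 'b \<times> nat \<Rightarrow> 'k) j. x (\<beta>, j))"
    by unfold_locales (auto simp: fun_eq_iff)
  from Vector_Spaces.linear_compose[OF this linear_mat_act]
  show "Vector_Spaces.linear scl scl (\<lambda>x. mat_act d (M \<beta>) (\<lambda>j. x (\<beta>, j)))" by (simp add: o_def)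
qed

lemma subspace_block_kernel: "fv.subspace (block_kernel d B R a)"
proof -
  have "block_kernel d B R a =
    (\<Inter>\<rho>\<in>R. {x. (\<Sum>\<beta>\<in>B. mat_act d (a \<rho> \<beta>) (\<lambda>j. x (\<beta>, j))) = 0}) \<inter> coords (B \<times> {..<d})"
    by (auto simp: block_kernel_def)
  moreover have "fv.subspace {x. (\<Sum>\<beta>\<in>B. mat_act d (M \<beta>) (\<lambda>j. x (\<beta>, j))) = 0}" for M
    by (rule fvp.linear_subspace_kernel[OF linear_block_row])
  ultimately show ?thesis
    by (simp only:) (intro fv.subspace_inter fv.subspace_Int subspace_coords)
qed

text \<open>Restriction to the free block variables is an isomorphism from the kernel onto
  \<open>card F\<close> copies of the \<open>d\<close>-dimensional coordinate space.\<close>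

lemma dvd_dim_block_kernel:
  fixes a :: "'r \<Rightarrow> 'b \<Rightarrow> nat \<Rightarrow> nat \<Rightarrow> 'k::field"
  assumes "division_set d D" "finite B" "\<And>\<rho> \<beta>. \<rho> \<in> R \<Longrightarrow> \<beta> \<in> B \<Longrightarrow> a \<rho> \<beta> \<in> D"
  shows "d dvd fv.dim (block_kernel d B R a)"
proof -
  from block_kernel_free[OF assms] obtain F where "F \<subseteq> B \<and> (\<forall>y\<in>coords (F \<times> {..<d}).
      \<exists>!x. x \<in> block_kernel d B R a \<and> (\<forall>f\<in>F. \<forall>j. x (f, j) = y (f, j)))"
    by (rule exE)
  note F = conjunct1[OF this] bspec[OF conjunct2[OF this]]
  have finF: "finite F" using F(1) assms(2) finite_subset by blast
  let ?N = "block_kernel d B R a"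
  let ?r = "\<lambda>(x :: 'b \<times> nat \<Rightarrow> 'k) (f, j). if f \<in> F then x (f, j) else 0"
  have lin: "Vector_Spaces.linear scl scl ?r"
    by unfold_locales (auto simp: fun_eq_iff)
  have sub: "?N \<subseteq> coords (B \<times> {..<d})" by (auto simp: block_kernel_def)
  have fd: "findim ?N" by (rule findim_subset[OF findim_coords sub]) (use assms(2) in simp)
  have z: "0 \<in> ?N" using subspace_block_kernel fv.subspace_0 by blast
  have inj: "x = 0" if "x \<in> ?N" "?r x = 0" for x
  proof -
    have "\<forall>f\<in>F. \<forall>j. x (f, j) = 0" using that(2) by (auto simp: fun_eq_iff split: if_splits)
    then have "\<forall>f\<in>F. \<forall>j. x (f, j) = (0 :: 'b \<times> nat \<Rightarrow> 'k) (f, j)" by simp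
    moreover have "(0 :: 'b \<times> nat \<Rightarrow> 'k) \<in> coords (F \<times> {..<d})" by (rule fv.subspace_0) simp
    ultimately show ?thesis using F(2) that(1) z by (metis (no_types, lifting))
  qed
  have "?r ` ?N = coords (F \<times> {..<d})"
  proof (rule subset_antisym)
    show "?r ` ?N \<subseteq> coords (F \<times> {..<d})" using sub by (auto simp: coords_def)
    show "coords (F \<times> {..<d}) \<subseteq> ?r ` ?N"
    proof
      fix y :: "'b \<times> nat \<Rightarrow> 'k" assume y: "y \<in> coords (F \<times> {..<d})"
      from ex1_implies_ex[OF F(2)[OF this]]
      obtain x where x: "x \<in> ?N" "\<forall>f\<in>F. \<forall>j. x (f, j) = y (f, j)" by (elim exE conjE)
      have "y = ?r x" using x(2) y by (auto simp: coords_def fun_eq_iff)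
      then show "y \<in> ?r ` ?N" using x(1) by blast
    qed
  qed
  then have "fv.dim ?N = card (F \<times> {..<d})"
    using dim_image_inj[OF lin subspace_block_kernel fd inj] dim_coords[where 'a='k, of "F \<times> {..<d}"] finF by simp
  then show ?thesis by (simp add: card_cartesian_product)
qed

section \<open>A division algebra of degree d\<close>

notation fls_nth (infixl "\<diamondop>" 75)

lemma fls_const_eq_iff: "fls_const x = fls_const y \<longleftrightarrow> x = y"
  by (metis fls_const_nth)

text \<open>The twist exponent in \<open>cyc\<close> is j - i modulo d, written
  \<open>j + (d - i)\<close> to stay within the naturals. The identity is (j - i) + (k - j) = k - i,
  which makes the twist compatible with matrix products.\<close>

lemma exponent_mod: "j < d \<Longrightarrow> ((j + (d - i)) + (k + (d - j))) mod d = (k + (d - i)) mod (d :: nat)"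
proof -
  assume "j < d"
  then have "(j + (d - i)) + (k + (d - j)) = (k + (d - i)) + d" by simp
  then show ?thesis by (simp only: mod_add_self2)
qed

text \<open>The substitution of \<open>c\<close> times the variable for the variable, combined with
  \<open>h\<close> on the coefficients.\<close>

definition fls_twist :: "('a::field \<Rightarrow> 'a) \<Rightarrow> 'a \<Rightarrow> 'a fls \<Rightarrow> 'a fls" where
  "fls_twist h c f = Abs_fls (\<lambda>k. c powi k * h (f \<diamondop> k))"

lemma fls_twist_nth:
  assumes "field_hom h"
  shows "fls_twist h c f \<diamondop> k = c powi k * h (f \<diamondop> k)"
proof -
  interpret h: field_hom h by (rule assms)
  show ?thesis
    unfolding fls_twist_def by (rule nth_Abs_fls_lower_bound[of "fls_subdegree f"]) simp
qed

text \<open>The twist preserves subdegrees, so both products are convolutions over the same range,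
  and the power of \<open>c\<close> splits along each summand.\<close>

lemma field_hom_fls_twist:
  assumes "field_hom h" "c \<noteq> 0"
  shows "field_hom (fls_twist h c)"
proof -
  interpret h: field_hom h by (rule assms(1))
  note nth = fls_twist_nth[OF assms(1)]
  have sub: "fls_subdegree (fls_twist h c f) = fls_subdegree f" for f
  proof (cases "f = 0")
    case True
    then have "fls_twist h c f = 0" by (intro fls_eqI) (simp add: nth)
    then show ?thesis using True by simp
  next
    case False
    then show ?thesis by (intro fls_subdegree_eqI) (auto simp: nth assms(2))
  qed
  have mult: "fls_twist h c (f * g) = fls_twist h c f * fls_twist h c g" for f g
  proof (rule fls_eqI)
    fix n
    have "c powi n * h (\<Sum>i=fls_subdegree f..n - fls_subdegree g. f \<diamondop> i * g \<diamondop> (n - i))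
      = (\<Sum>i=fls_subdegree f..n - fls_subdegree g. (c powi i * h (f \<diamondop> i)) * (c powi (n - i) * h (g \<diamondop> (n - i))))"
      unfolding h.hom_sum sum_distrib_left
    proof (rule sum.cong[OF refl])
      fix i
      have "c powi n = c powi i * c powi (n - i)"
        using power_int_add[of c i "n - i"] assms(2) by simp
      then show "c powi n * h (f \<diamondop> i * g \<diamondop> (n - i)) = c powi i * h (f \<diamondop> i) * (c powi (n - i) * h (g \<diamondop> (n - i)))"
        by (simp add: h.hom_mult mult_ac)
    qed
    then show "fls_twist h c (f * g) \<diamondop> n = (fls_twist h c f * fls_twist h c g) \<diamondop> n"
      by (simp add: nth fls_times_nth(2) sub)
  qed
  show ?thesis
    by unfold_locales (auto simp: mult fls_eq_iff nth h.hom_add algebra_simps)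
qed

text \<open>The field C((s))((t)): \<open>fls_nth\<close> yields the coefficients in the outer
  variable t, which are series in s.\<close>

type_synonym laurent2 = "complex fls fls"

definition cst :: "complex \<Rightarrow> laurent2" where
  "cst x = fls_const (fls_const x)"

definition prim_root :: "nat \<Rightarrow> complex" where
  "prim_root d = cis (2 * pi / real d)"

text \<open>With \<omega> = \<open>prim_root d\<close>, this automorphism sends s to \<omega> s and
  fixes t, while \<open>tauK\<close> sends t to \<omega> t and fixes s.\<close>

definition sigK :: "nat \<Rightarrow> laurent2 \<Rightarrow> laurent2" where
  "sigK d = fls_twist (fls_twist (\<lambda>x. x) (prim_root d)) 1"

definition tauK :: "nat \<Rightarrow> laurent2 \<Rightarrow> laurent2" where
  "tauK d = fls_twist (\<lambda>x. x) (fls_const (prim_root d))"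

lemma prim_root_nonzero [simp]: "prim_root d \<noteq> 0"
  by (simp add: prim_root_def)

lemma prim_root_pow_eq:
  assumes "d > 0"
  shows "prim_root d ^ a = prim_root d ^ b \<longleftrightarrow> a mod d = b mod d"
proof -
  have mod: "prim_root d ^ a = cis (2 * pi * real (a mod d) / real d)" for a
  proof -
    have "prim_root d ^ d = 1" using assms by (simp add: prim_root_def DeMoivre)
    then have "prim_root d ^ a = prim_root d ^ (a mod d)"
      by (metis mult_div_mod_eq power_add power_mult power_one mult_1)
    then show ?thesis by (simp add: prim_root_def DeMoivre mult_ac)
  qed
  have "inj_on (\<lambda>k. cis (2 * pi * real k / real d)) {..<d}"
    using bij_betw_roots_unity[OF assms] by (simp add: bij_betw_def)
  then show ?thesis unfolding mod using assms by (auto simp: inj_on_def)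
qed

lemma prim_root_pow_self: "d > 0 \<Longrightarrow> prim_root d ^ d = 1"
  using prim_root_pow_eq[of d d 0] by simp

lemma field_hom_id: "field_hom (\<lambda>x :: 'a::field. x)"
  by unfold_locales auto

lemma field_hom_sigK: "field_hom (sigK d)"
  unfolding sigK_def by (intro field_hom_fls_twist field_hom_id) auto

lemma field_hom_tauK: "field_hom (tauK d)"
  unfolding tauK_def by (intro field_hom_fls_twist field_hom_id) auto

lemma field_hom_cst: "field_hom cst"
  by unfold_locales (auto simp: cst_def fls_plus_const)

lemma sigK_nth: "sigK d f \<diamondop> k = fls_twist (\<lambda>x. x) (prim_root d) (f \<diamondop> k)"
  unfolding sigK_def by (subst fls_twist_nth) (auto intro!: field_hom_fls_twist field_hom_id)

lemma tauK_nth: "tauK d f \<diamondop> k = fls_const (prim_root d) powi k * f \<diamondop> k"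
  unfolding tauK_def by (subst fls_twist_nth) (auto intro!: field_hom_id)

lemma sigK_cst: "sigK d (cst x) = cst x"
  by (auto simp: fls_eq_iff sigK_nth cst_def fls_twist_nth[OF field_hom_id])

lemma tauK_cst: "tauK d (cst x) = cst x"
  by (auto simp: fls_eq_iff tauK_nth cst_def)

definition s_var :: laurent2 where "s_var = fls_const fls_X"
definition t_var :: laurent2 where "t_var = fls_X"

lemma sigK_s: "sigK d s_var = cst (prim_root d) * s_var"
  by (auto simp: fls_eq_iff sigK_nth s_var_def cst_def fls_twist_nth[OF field_hom_id])

lemma tauK_s: "tauK d s_var = s_var"
  by (auto simp: fls_eq_iff tauK_nth s_var_def)

lemma sigK_t: "sigK d t_var = t_var"
  by (auto simp: fls_eq_iff sigK_nth t_var_def fls_twist_nth[OF field_hom_id])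

lemma tauK_t: "tauK d t_var = cst (prim_root d) * t_var"
  by (auto simp: fls_eq_iff tauK_nth t_var_def cst_def)

lemma s_t_nonzero: "s_var \<noteq> 0" "t_var \<noteq> 0"
  by (auto simp: s_var_def t_var_def)

text \<open>The fixed matrices of two commuting twisted automorphisms. This is the cyclic division algebra generated
  by $s Z$ and $t X$, where $Z$ and $X$ are the clock and shift matrices.\<close>

definition cyc :: "nat \<Rightarrow> (nat \<Rightarrow> nat \<Rightarrow> laurent2) set" where
  "cyc d = {M. \<forall>i<d. \<forall>j<d. tauK d (M i j) = cst (prim_root d) ^ (j + (d - i)) * M i j \<and>
     sigK d (M i j) = M (Suc i mod d) (Suc j mod d)}"

lemma bij_Suc_mod: "d > 0 \<Longrightarrow> bij_betw (\<lambda>j. Suc j mod d) {..<d} {..<d}"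
proof (rule bij_betw_imageI)
  assume d: "d > 0"
  show inj: "inj_on (\<lambda>j. Suc j mod d) {..<d}"
    by (auto simp: inj_on_def mod_Suc)
  show "(\<lambda>j. Suc j mod d) ` {..<d} = {..<d}"
    by (rule card_subset_eq) (use d card_image[OF inj] in auto)
qed

lemma Suc_mod_eq_iff: "i < d \<Longrightarrow> j < d \<Longrightarrow> Suc i mod d = Suc j mod d \<longleftrightarrow> i = j"
  by (auto simp: mod_Suc split: if_splits)

lemma cst_root_pow_self: "d > 0 \<Longrightarrow> cst (prim_root d) ^ d = 1"
proof -
  assume d: "d > 0"
  interpret c: field_hom cst by (rule field_hom_cst)
  show ?thesis using prim_root_pow_self[OF d] by (simp flip: c.hom_power)
qed

lemma cst_root_pow_eq: "d > 0 \<Longrightarrow> cst (prim_root d) ^ a = cst (prim_root d) ^ b \<longleftrightarrow> a mod d = b mod d"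
proof -
  assume d: "d > 0"
  interpret c: field_hom cst by (rule field_hom_cst)
  have "cst (prim_root d ^ a) = cst (prim_root d ^ b) \<longleftrightarrow> prim_root d ^ a = prim_root d ^ b"
    by (simp add: cst_def fls_const_eq_iff)
  then show ?thesis using prim_root_pow_eq[OF d] by (simp add: c.hom_power)
qed

lemma cyc_diff: "M \<in> cyc d \<Longrightarrow> N \<in> cyc d \<Longrightarrow> (\<lambda>i j. M i j - N i j) \<in> cyc d"
proof -
  interpret s: field_hom "sigK d" by (rule field_hom_sigK)
  interpret t: field_hom "tauK d" by (rule field_hom_tauK)
  show "M \<in> cyc d \<Longrightarrow> N \<in> cyc d \<Longrightarrow> (\<lambda>i j. M i j - N i j) \<in> cyc d"
    by (auto simp: cyc_def s.hom_minus t.hom_minus right_diff_distrib)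
qed

text \<open>Scalars have to be fixed by both automorphisms, as constants are. Hence coefficients
  must first be moved into the image of the ground field before a combination is known to lie in
  \<open>cyc d\<close>.\<close>

lemma cyc_sum:
  assumes "\<And>l. l \<in> L \<Longrightarrow> M l \<in> cyc d"
  shows "(\<lambda>i j. \<Sum>l\<in>L. cst (z l) * M l i j) \<in> cyc d"
proof -
  interpret s: field_hom "sigK d" by (rule field_hom_sigK)
  interpret t: field_hom "tauK d" by (rule field_hom_tauK)
  show ?thesis
    using assms
    by (auto simp: cyc_def s.hom_sum t.hom_sum s.hom_mult t.hom_mult sigK_cst tauK_cst sum_distrib_left mult_ac intro!: sum.cong)
qed

lemma cyc_comp:
  assumes "M \<in> cyc d" "N \<in> cyc d"
  shows "mat_comp d M N \<in> cyc d"
proof (cases "d = 0")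
  case False
  then have d: "d > 0" by simp
  interpret s: field_hom "sigK d" by (rule field_hom_sigK)
  interpret t: field_hom "tauK d" by (rule field_hom_tauK)
  let ?w = "cst (prim_root d)"
  have "tauK d (mat_comp d M N i k) = ?w ^ (k + (d - i)) * mat_comp d M N i k"
    if "i < d" "k < d" for i k
  proof -
    have "tauK d (M i j * N j k) = ?w ^ (k + (d - i)) * (M i j * N j k)" if j: "j < d" for j
    proof -
      have "tauK d (M i j * N j k) = (?w ^ (j + (d - i)) * ?w ^ (k + (d - j))) * (M i j * N j k)"
        using assms j \<open>i < d\<close> \<open>k < d\<close> by (simp add: cyc_def t.hom_mult mult_ac)
      also have "?w ^ (j + (d - i)) * ?w ^ (k + (d - j)) = ?w ^ (k + (d - i))"
        unfolding power_add[symmetric] cst_root_pow_eq[OF d] by (rule exponent_mod[OF j])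
      finally show ?thesis .
    qed
    then show ?thesis by (simp add: mat_comp_def t.hom_sum sum_distrib_left)
  qed
  moreover have "sigK d (mat_comp d M N i k) = mat_comp d M N (Suc i mod d) (Suc k mod d)"
    if "i < d" "k < d" for i k
  proof -
    have "sigK d (mat_comp d M N i k) = (\<Sum>j<d. M (Suc i mod d) (Suc j mod d) * N (Suc j mod d) (Suc k mod d))"
      unfolding mat_comp_def s.hom_sum by (rule sum.cong) (use assms that in \<open>auto simp: cyc_def s.hom_mult\<close>)
    also have "\<dots> = (\<Sum>j<d. M (Suc i mod d) j * N j (Suc k mod d))"
      by (rule sum.reindex_bij_betw[OF bij_Suc_mod[OF d]])
    finally show ?thesis by (simp add: mat_comp_def)
  qed
  ultimately show ?thesis by (simp add: cyc_def)
qed (simp add: cyc_def)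

text \<open>Applying either automorphism to N M = 1 gives a left inverse of the image of
  \<open>M\<close>. The twisted or shifted form of \<open>N\<close> is a left inverse of the same
  matrix, so uniqueness yields the defining equations for \<open>N\<close>.\<close>

lemma cyc_left_inv:
  assumes M: "M \<in> cyc d" and N: "left_inv d N M"
  shows "N \<in> cyc d"
proof (cases "d = 0")
  case False
  then have d: "d > 0" by simp
  interpret s: field_hom "sigK d" by (rule field_hom_sigK)
  interpret t: field_hom "tauK d" by (rule field_hom_tauK)
  let ?w = "cst (prim_root d)"
  have NM: "(\<Sum>j<d. N i j * M j k) = (if i = k then 1 else 0)" if "i < d" "k < d" for i k
    using N that by (simp add: left_inv_def mat_comp_def)
  have t1: "left_inv d (\<lambda>i j. tauK d (N i j)) (\<lambda>i j. tauK d (M i j))"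
    unfolding left_inv_def mat_comp_def t.hom_mult[symmetric] t.hom_sum[symmetric] using NM by simp
  have t2: "left_inv d (\<lambda>i j. ?w ^ (j + (d - i)) * N i j) (\<lambda>i j. tauK d (M i j))"
    unfolding left_inv_def mat_comp_def
  proof (intro allI impI)
    fix i k assume ik: "i < d" "k < d"
    have "(\<Sum>j<d. ?w ^ (j + (d - i)) * N i j * tauK d (M j k)) = (\<Sum>j<d. ?w ^ (k + (d - i)) * (N i j * M j k))"
    proof (rule sum.cong[OF refl])
      fix j assume "j \<in> {..<d}"
      then have j: "j < d" by simp
      have "?w ^ (j + (d - i)) * ?w ^ (k + (d - j)) = ?w ^ (k + (d - i))"
        unfolding power_add[symmetric] cst_root_pow_eq[OF d] by (rule exponent_mod[OF j])
      then show "?w ^ (j + (d - i)) * N i j * tauK d (M j k) = ?w ^ (k + (d - i)) * (N i j * M j k)"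
        using M j ik by (simp add: cyc_def mult_ac)
    qed
    also have "\<dots> = ?w ^ (k + (d - i)) * (if i = k then 1 else 0)"
      by (simp only: sum_distrib_left[symmetric] NM[OF ik])
    also have "\<dots> = (if i = k then 1 else 0)" using ik d by (simp add: cst_root_pow_self)
    finally show "(\<Sum>j<d. ?w ^ (j + (d - i)) * N i j * tauK d (M j k)) = (if i = k then 1 else 0)" .
  qed
  have s1: "left_inv d (\<lambda>i j. sigK d (N i j)) (\<lambda>i j. sigK d (M i j))"
    unfolding left_inv_def mat_comp_def s.hom_mult[symmetric] s.hom_sum[symmetric] using NM by simp
  have s2: "left_inv d (\<lambda>i j. N (Suc i mod d) (Suc j mod d)) (\<lambda>i j. sigK d (M i j))"
    unfolding left_inv_def mat_comp_def
  proof (intro allI impI)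
    fix i k assume ik: "i < d" "k < d"
    have "(\<Sum>j<d. N (Suc i mod d) (Suc j mod d) * sigK d (M j k)) =
      (\<Sum>j<d. N (Suc i mod d) (Suc j mod d) * M (Suc j mod d) (Suc k mod d))"
      by (rule sum.cong) (use M ik in \<open>auto simp: cyc_def\<close>)
    also have "\<dots> = (\<Sum>j<d. N (Suc i mod d) j * M j (Suc k mod d))"
      by (rule sum.reindex_bij_betw[OF bij_Suc_mod[OF d]])
    also have "\<dots> = (if i = k then 1 else 0)" using NM d Suc_mod_eq_iff[OF ik] by simp
    finally show "(\<Sum>j<d. N (Suc i mod d) (Suc j mod d) * sigK d (M j k)) = (if i = k then 1 else 0)" .
  qed
  show ?thesis
    using left_inv_unique[OF t1 t2] left_inv_unique[OF s1 s2] by (simp add: cyc_def)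
qed (simp add: cyc_def)

text \<open>The bounds \<open>a\<close> and \<open>b\<close> need not be attained; if one is not,
  both sides vanish. A common bound can thus be used for all entries of a row.\<close>

lemma fls_mult_nth_lowest:
  fixes f g :: "'a::field fls"
  assumes "\<And>k. k < a \<Longrightarrow> f \<diamondop> k = 0" "\<And>k. k < b \<Longrightarrow> g \<diamondop> k = 0"
  shows "(f * g) \<diamondop> (a + b) = f \<diamondop> a * g \<diamondop> b"
proof (cases "f = 0 \<or> g = 0")
  case False
  then have le: "a \<le> fls_subdegree f" "b \<le> fls_subdegree g"
    using assms by (auto intro!: fls_subdegree_geI)
  show ?thesis
  proof (cases "a = fls_subdegree f \<and> b = fls_subdegree g")
    case True
    then show ?thesis by (simp add: fls_times_nth(2))
  next
    case F: False
    then have "a < fls_subdegree f \<or> b < fls_subdegree g" using le by auto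
    then have "f \<diamondop> a = 0 \<or> g \<diamondop> b = 0" by auto
    moreover have "a + b < fls_subdegree f + fls_subdegree g" using F le by auto
    ultimately show ?thesis by (auto simp: fls_times_nth_eq0)
  qed
qed auto

text \<open>Compare lowest $t$-orders: in each row of a matrix of \<open>cyc d\<close> at most one entry attains the minimal order.\<close>

lemma cyc_injective:
  assumes M: "M \<in> cyc d" and nz: "\<not> (\<forall>i<d. \<forall>j<d. M i j = 0)"
    and v: "v \<in> coords {..<d}" "mat_act d M v = 0"
  shows "v = 0"
proof (rule ccontr)
  assume "v \<noteq> 0"
  let ?w = "cst (prim_root d)"
  have d: "d > 0" using nz by auto
  define KS where "KS = {fls_subdegree (M i j) |i j. i < d \<and> j < d \<and> M i j \<noteq> 0}"
  have "KS \<subseteq> (\<lambda>(i, j). fls_subdegree (M i j)) ` ({..<d} \<times> {..<d})" by (auto simp: KS_def)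
  then have finKS: "finite KS" using finite_subset by fastforce
  have neKS: "KS \<noteq> {}" using nz by (auto simp: KS_def)
  define k0 where "k0 = Min KS"
  obtain i0 j0 where ij0: "i0 < d" "j0 < d" "M i0 j0 \<diamondop> k0 \<noteq> 0"
    using Min_in[OF finKS neKS] unfolding k0_def[symmetric] by (auto simp: KS_def)
  have low: "M i j \<diamondop> k = 0" if "i < d" "j < d" "k < k0" for i j k
  proof (cases "M i j = 0")
    case False
    then have "k0 \<le> fls_subdegree (M i j)"
      unfolding k0_def using finKS that by (intro Min_le) (auto simp: KS_def)
    then show ?thesis using that by simp
  qed simp
  define ES where "ES = {fls_subdegree (v j) |j. j < d \<and> v j \<noteq> 0}"
  have finES: "finite ES" by (auto simp: ES_def)
  have neES: "ES \<noteq> {}"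
  proof -
    obtain j where "v j \<noteq> 0" using \<open>v \<noteq> 0\<close> by (auto simp: fun_eq_iff)
    moreover have "j < d" using v(1) calculation by (auto simp: coords_def)
    ultimately show ?thesis by (auto simp: ES_def)
  qed
  define e where "e = Min ES"
  obtain j1 where j1: "j1 < d" "v j1 \<diamondop> e \<noteq> 0"
    using Min_in[OF finES neES] unfolding e_def[symmetric] by (auto simp: ES_def)
  have lowv: "v j \<diamondop> k = 0" if "j < d" "k < e" for j k
  proof (cases "v j = 0")
    case False
    then have "e \<le> fls_subdegree (v j)"
      unfolding e_def using finES that by (intro Min_le) (auto simp: ES_def)
    then show ?thesis using that by simp
  qed simp
  \<comment> \<open>\<open>sigK\<close> moves an entry one step along its cyclic diagonal and
    preserves which coefficients in t vanish, so the minimal order occurs along the whole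
    diagonal.\<close>
  have shift: "M ((i0 + m) mod d) ((j0 + m) mod d) \<diamondop> k0 \<noteq> 0" for m
  proof (induction m)
    case 0
    then show ?case using ij0 by simp
  next
    case (Suc m)
    interpret s: field_hom "fls_twist (\<lambda>x :: complex. x) (prim_root d)"
      by (intro field_hom_fls_twist field_hom_id) auto
    have "M (Suc ((i0 + m) mod d) mod d) (Suc ((j0 + m) mod d) mod d) = sigK d (M ((i0 + m) mod d) ((j0 + m) mod d))"
      using M d by (simp add: cyc_def)
    then show ?case using Suc by (simp add: sigK_nth mod_Suc_eq)
  qed
  \<comment> \<open>The row in which the cyclic diagonal through \<open>(i0, j0)\<close> meets the
    column \<open>j1\<close>.\<close>
  define i1 where "i1 = (i0 + (j1 + (d - j0))) mod d"
  have "(j0 + (j1 + (d - j0))) mod d = j1" using ij0(2) j1(1) by simp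
  then have i1: "i1 < d" "M i1 j1 \<diamondop> k0 \<noteq> 0" using shift[of "j1 + (d - j0)"] d by (auto simp: i1_def)
  \<comment> \<open>Comparing the coefficients at \<open>k0\<close> in the \<open>tauK\<close>
    condition gives \<omega>^k0 = \<omega>^(j - i1), so within row \<open>i1\<close> the column
    \<open>j\<close> is determined.\<close>
  have cls: "fls_const (prim_root d) powi k0 = fls_const (prim_root d) ^ (j + (d - i1))"
    if "j < d" "M i1 j \<diamondop> k0 \<noteq> 0" for j
  proof -
    have "tauK d (M i1 j) \<diamondop> k0 = (?w ^ (j + (d - i1)) * M i1 j) \<diamondop> k0"
      using M that i1 by (simp add: cyc_def)
    moreover have "?w ^ (j + (d - i1)) = fls_const (fls_const (prim_root d) ^ (j + (d - i1)))"
      by (simp add: cst_def fls_const_power)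
    ultimately show ?thesis using that(2) by (simp add: tauK_nth)
  qed
  have only: "M i1 j \<diamondop> k0 = 0" if "j < d" "j \<noteq> j1" for j
  proof (rule ccontr)
    assume "M i1 j \<diamondop> k0 \<noteq> 0"
    then have "fls_const (prim_root d) ^ (j + (d - i1)) = fls_const (prim_root d) ^ (j1 + (d - i1))"
      using cls[OF that(1)] cls[OF j1(1) i1(2)] by simp
    then have "prim_root d ^ (j + (d - i1)) = prim_root d ^ (j1 + (d - i1))"
      by (simp add: fls_const_power[symmetric] fls_const_eq_iff)
    then have "(j + (d - i1)) mod d = (j1 + (d - i1)) mod d" using prim_root_pow_eq[OF d] by simp
    then have "(j + (d - i1) + i1) mod d = (j1 + (d - i1) + i1) mod d" by (metis mod_add_cong)
    then show False using that j1(1) i1(1) by simp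
  qed
  \<comment> \<open>The coefficient at \<open>k0 + e\<close> of row \<open>i1\<close> collapses to
    the single product of the lowest terms in column \<open>j1\<close>, which is nonzero.\<close>
  have "0 = (\<Sum>j<d. M i1 j * v j) \<diamondop> (k0 + e)"
    using fun_cong[OF v(2), of i1] i1(1) by (simp add: mat_act_def)
  also have "\<dots> = (\<Sum>j<d. M i1 j \<diamondop> k0 * v j \<diamondop> e)"
    unfolding fls_nth_sum by (rule sum.cong) (use low lowv i1(1) in \<open>auto intro!: fls_mult_nth_lowest\<close>)
  also have "\<dots> = (\<Sum>j\<in>{j1}. M i1 j \<diamondop> k0 * v j \<diamondop> e)"
    by (rule sum.mono_neutral_right) (use only j1 in auto)
  finally show False using i1(2) j1(2) by simp
qed

lemma division_set_cyc: "division_set d (cyc d)"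
  unfolding division_set_def
proof (intro conjI ballI)
  fix M assume M: "M \<in> cyc d"
  show "(\<forall>i<d. \<forall>j<d. M i j = 0) \<or> (\<exists>N\<in>cyc d. left_inv d N M)"
  proof (rule disjCI)
    assume "\<not> (\<exists>N\<in>cyc d. left_inv d N M)"
    then have "\<not> (\<exists>N. left_inv d N M)" using cyc_left_inv[OF M] by blast
    then show "\<forall>i<d. \<forall>j<d. M i j = 0"
      using left_inv_exists[of d M] cyc_injective[OF M] by blast
  qed
qed (intro cyc_diff cyc_comp; assumption)+

text \<open>Over the Laurent field \<open>cyc d\<close> spans all matrices, so writing matrix units
  through its elements makes arbitrary blocks accessible to \<open>rank_swap\<close>. Elements on
  one cyclic diagonal differ by characters of the row index, and a discrete Fourier transform
  isolates one row.\<close>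

lemma cyc_spans:
  assumes "i0 < d" "j0 < d"
  shows "\<exists>c Dm. (\<forall>m<d. Dm m \<in> cyc d) \<and>
    (\<forall>i<d. \<forall>j<d. (\<Sum>m<d. c m * Dm m i j) = (if i = i0 \<and> j = j0 then 1 else 0))"
proof -
  have d: "d > 0" using assms by simp
  interpret s: field_hom "sigK d" by (rule field_hom_sigK)
  interpret t: field_hom "tauK d" by (rule field_hom_tauK)
  let ?w = "cst (prim_root d)"
  \<comment> \<open>The cyclic diagonal through \<open>(i0, j0)\<close>. Up to convention,
    \<open>Dm m\<close> is the product of the m-th power of s Z and the k-th power of t X, and
    \<open>c\<close> inverts the Fourier transform in the variable \<open>m\<close>.\<close>
  define k where "k = (j0 + (d - i0)) mod d"
  define Dm where "Dm m = (\<lambda>i j. if j = (i + k) mod d then ?w ^ (i * m) * s_var ^ m * t_var ^ k else 0)" for m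
  define c where "c m = inverse (of_nat d) * inverse (?w ^ (i0 * m)) * inverse (s_var ^ m * t_var ^ k)" for m :: nat
  have w0: "?w \<noteq> 0" by (simp add: cst_def)
  have "Dm m \<in> cyc d" for m
  proof -
    have "tauK d (Dm m i j) = ?w ^ (j + (d - i)) * Dm m i j" if "i < d" "j < d" for i j
    proof (cases "j = (i + k) mod d")
      case True
      have "?w ^ k = ?w ^ (j + (d - i))"
        unfolding cst_root_pow_eq[OF d] True mod_add_left_eq using \<open>i < d\<close>
        by simp
      then show ?thesis using True
        by (simp add: Dm_def t.hom_mult t.hom_power tauK_cst tauK_s tauK_t power_mult_distrib mult_ac)
    qed (simp add: Dm_def)
    moreover have "sigK d (Dm m i j) = Dm m (Suc i mod d) (Suc j mod d)" if "i < d" "j < d" for i j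
    proof -
      have "Suc j mod d = (Suc i mod d + k) mod d \<longleftrightarrow> j = (i + k) mod d"
        using Suc_mod_eq_iff[of j d "(i + k) mod d"] that d by (simp add: mod_Suc_eq mod_add_left_eq)
      moreover have "?w ^ (Suc i mod d * m) = ?w ^ (Suc i * m)"
        unfolding cst_root_pow_eq[OF d] by (simp add: mod_mult_left_eq)
      ultimately show ?thesis
        by (auto simp: Dm_def s.hom_mult s.hom_power sigK_cst sigK_s sigK_t power_mult_distrib power_add power_mult mult_ac)
    qed
    ultimately show ?thesis by (simp add: cyc_def)
  qed
  moreover have "(\<Sum>m<d. c m * Dm m i j) = (if i = i0 \<and> j = j0 then 1 else 0)" if ij: "i < d" "j < d" for i j
  proof (cases "j = (i + k) mod d")
    case False
    moreover have "j0 = (i0 + k) mod d" using assms by (simp add: k_def mod_add_right_eq)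
    ultimately show ?thesis by (auto simp: Dm_def)
  next
    case True
    have jj: "j = j0" if "i = i0"
      unfolding True that using assms by (simp add: k_def mod_add_right_eq)
    let ?q = "?w ^ i / ?w ^ i0"
    have "c m * Dm m i j = inverse (of_nat d) * ?q ^ m" for m
      using True s_t_nonzero w0
      by (simp add: c_def Dm_def power_divide power_mult field_simps)
    then have sum: "(\<Sum>m<d. c m * Dm m i j) = inverse (of_nat d) * (\<Sum>m<d. ?q ^ m)"
      by (simp add: sum_distrib_left)
    show ?thesis
    proof (cases "i = i0")
      case True
      then show ?thesis using sum d jj w0 by (simp add: power_not_zero)
    next
      case False
      \<comment> \<open>For another row on the diagonal the sum is geometric, with a nontrivial d-th
        root of unity as its ratio, and vanishes.\<close>
      have "?q \<noteq> 1" using cst_root_pow_eq[OF d, of i i0] False assms ij w0 by (simp add: divide_eq_1_iff)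
      moreover have "(?w ^ l) ^ d = 1" for l
        by (metis cst_root_pow_self[OF d] mult.commute power_mult power_one)
      then have "?q ^ d = 1" by (simp add: power_divide)
      ultimately show ?thesis using False sum by (simp add: geometric_sum)
    qed
  qed
  ultimately show ?thesis by blast
qed

section \<open>Rank of block matrices\<close>

text \<open>The blocks \<open>A \<alpha> \<beta>\<close> are \<open>n \<times> n\<close>, there are \<open>p\<close> block rows, and \<open>(\<beta>, j)\<close> stands for column \<open>j\<close> of block
  column \<open>\<beta>\<close>.\<close>

definition bcol :: "nat \<Rightarrow> nat \<Rightarrow> (nat \<Rightarrow> nat \<Rightarrow> nat \<times> nat \<Rightarrow> 'a::field) \<Rightarrow> nat \<times> nat \<Rightarrow> nat \<times> nat \<Rightarrow> 'a" where
  "bcol p n A = (\<lambda>(\<beta>, j) (\<alpha>, i). if \<alpha> < p \<and> i < n then A \<alpha> \<beta> (i, j) else 0)"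

definition brank :: "nat \<Rightarrow> nat \<Rightarrow> (nat \<Rightarrow> nat \<Rightarrow> nat \<times> nat \<Rightarrow> 'a::field) \<Rightarrow> nat set \<Rightarrow> nat" where
  "brank p n A Q = fv.dim (bcol p n A ` (Q \<times> {..<n}))"

lemma bcol_coords [simp]: "bcol p n A b \<in> coords ({..<p} \<times> {..<n})"
  by (cases b) (auto simp: bcol_def coords_def)

text \<open>The tensor factors are swapped: the matrix is read as an \<open>n x n\<close> array of
  \<open>d x d\<close> blocks from the division algebra. Its kernel then has dimension divisible by
  \<open>d\<close>, and so has its rank, since there are \<open>d n\<close> columns.\<close>

lemma dvd_rank_cyc:
  fixes n d :: nat
  assumes "\<And>i j. i < n \<Longrightarrow> j < n \<Longrightarrow> blk i j \<in> cyc d"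
  shows "d dvd fv.dim ((\<lambda>(\<beta>, j) (\<alpha>, i). if \<alpha> < d \<and> i < n then blk i j \<alpha> \<beta> else 0) ` ({..<d} \<times> {..<n}))"
    (is "_ dvd fv.dim (?c ` _)")
proof -
  let ?J = "{..<n} \<times> {..<d}" and ?c' = "\<lambda>(j, \<beta>). ?c (\<beta>, j)"
  have img: "?c ` ({..<d} \<times> {..<n}) = ?c' ` ?J" by force
  have "{x \<in> coords ?J. (\<Sum>b\<in>?J. scl (x b) (?c' b)) = 0} = block_kernel d {..<n} {..<n} blk"
  proof -
    have ev: "(\<Sum>b\<in>?J. scl (x b) (?c' b)) (\<alpha>, i) =
       (if \<alpha> < d \<and> i < n then (\<Sum>j\<in>{..<n}. mat_act d (blk i j) (\<lambda>\<beta>. x (j, \<beta>))) \<alpha> else 0)" for x \<alpha> i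
      by (auto simp: sum_fun_apply sum.cartesian_product' mat_act_def mult.commute)
    have "(\<Sum>b\<in>?J. scl (x b) (?c' b)) = 0 \<longleftrightarrow>
        (\<forall>i\<in>{..<n}. (\<Sum>j\<in>{..<n}. mat_act d (blk i j) (\<lambda>\<beta>. x (j, \<beta>))) = 0)" for x
    proof
      assume L: "(\<Sum>b\<in>?J. scl (x b) (?c' b)) = 0"
      show "\<forall>i\<in>{..<n}. (\<Sum>j\<in>{..<n}. mat_act d (blk i j) (\<lambda>\<beta>. x (j, \<beta>))) = 0"
      proof (intro ballI ext)
        fix i \<alpha> assume i: "i \<in> {..<n}"
        show "(\<Sum>j\<in>{..<n}. mat_act d (blk i j) (\<lambda>\<beta>. x (j, \<beta>))) \<alpha> = 0 \<alpha>"
        proof (cases "\<alpha> < d")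
          case True
          then show ?thesis using ev[of x \<alpha> i] i L by simp
        next
          case False
          then show ?thesis by (simp add: sum_fun_apply mat_act_def)
        qed
      qed
    next
      assume R: "\<forall>i\<in>{..<n}. (\<Sum>j\<in>{..<n}. mat_act d (blk i j) (\<lambda>\<beta>. x (j, \<beta>))) = 0"
      show "(\<Sum>b\<in>?J. scl (x b) (?c' b)) = 0"
      proof
        fix k
        show "(\<Sum>b\<in>?J. scl (x b) (?c' b)) k = 0 k" using ev[of x "fst k" "snd k"] R by (cases k) auto
      qed
    qed
    then show ?thesis by (auto simp: block_kernel_def)
  qed
  moreover have "d dvd fv.dim (block_kernel d {..<n} {..<n} blk)"
    by (rule dvd_dim_block_kernel[OF division_set_cyc]) (use assms in auto)
  moreover have "d dvd card ?J" by (simp add: card_cartesian_product)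
  moreover have "finite ?J" by simp
  note family_rank_nullity[OF this, of ?c']
  ultimately show ?thesis unfolding img by (metis (lifting) dvd_add_left_iff)
qed

lemma sum_triple: "(\<Sum>l\<in>A \<times> B \<times> C. f l) = (\<Sum>a\<in>A. \<Sum>b\<in>B. \<Sum>c\<in>C. f (a, b, c))"
  by (simp add: sum.cartesian_product')

lemma sum_quadruple: "(\<Sum>l\<in>A \<times> B \<times> C \<times> D. f l) = (\<Sum>a\<in>A. \<Sum>b\<in>B. \<Sum>c\<in>C. \<Sum>d\<in>D. f (a, b, c, d))"
  by (simp add: sum.cartesian_product')

text \<open>Move the coefficients first into a division algebra of degree \<open>d\<close>, where all ranks are multiples of \<open>d\<close>, and then
  back.\<close>

lemma rank_round_up:
  fixes V :: "(nat \<times> nat \<Rightarrow> 'a::field_char_0) set" and h :: "'a \<Rightarrow> complex"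
  assumes h: "field_hom h" and V: "fv.subspace V" and A: "\<And>\<alpha> \<beta>. A \<alpha> \<beta> \<in> V"
  shows "\<exists>A' k. (\<forall>\<alpha> \<beta>. A' \<alpha> \<beta> \<in> V) \<and> brank d n A {..<d} \<le> k * d \<and> k * d \<le> brank d n A' {..<d}"
proof -
  interpret h: field_hom h by (rule h)
  interpret c: field_hom cst by (rule field_hom_cst)
  define H where "H x = cst (h x)" for x
  interpret H: field_hom H by unfold_locales (auto simp: H_def c.hom_add h.hom_add c.hom_mult h.hom_mult)
  have infH: "infinite (range H)"
    by (metis H.injectivity finite_imageD infinite_UNIV_char_0 inj_on_def)
  let ?J = "{..<d} \<times> {..<n}"
  have finJ: "finite ?J" by simp
  have "\<forall>\<alpha>0 \<beta>0. \<exists>c Dm. \<alpha>0 < d \<longrightarrow> \<beta>0 < d \<longrightarrow> (\<forall>m<d. Dm m \<in> cyc d) \<and>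
    (\<forall>i<d. \<forall>j<d. (\<Sum>m<d. c m * Dm m i j) = (if i = \<alpha>0 \<and> j = \<beta>0 then 1 else 0))"
  proof (intro allI)
    fix \<alpha>0 \<beta>0
    show "\<exists>c Dm. \<alpha>0 < d \<longrightarrow> \<beta>0 < d \<longrightarrow> (\<forall>m<d. Dm m \<in> cyc d) \<and>
      (\<forall>i<d. \<forall>j<d. (\<Sum>m<d. c m * Dm m i j) = (if i = \<alpha>0 \<and> j = \<beta>0 then 1 else 0))"
    proof (cases "\<alpha>0 < d \<and> \<beta>0 < d")
      case True
      with cyc_spans[of \<alpha>0 d \<beta>0] show ?thesis by (elim conjE) (drule (1) meta_mp, drule (1) meta_mp, elim exE, intro exI impI)
    qed auto
  qed
  then have "\<exists>cc DD. \<forall>\<alpha>0 \<beta>0. \<alpha>0 < d \<longrightarrow> \<beta>0 < d \<longrightarrow> (\<forall>m<d. DD \<alpha>0 \<beta>0 m \<in> cyc d) \<and>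
    (\<forall>i<d. \<forall>j<d. (\<Sum>m<d. cc \<alpha>0 \<beta>0 m * DD \<alpha>0 \<beta>0 m i j) = (if i = \<alpha>0 \<and> j = \<beta>0 then 1 else 0))"
    by (simp only: choice_iff)
  then obtain cc DD where D0: "\<forall>\<alpha>0 \<beta>0. \<alpha>0 < d \<longrightarrow> \<beta>0 < d \<longrightarrow> (\<forall>m<d. DD \<alpha>0 \<beta>0 m \<in> cyc d) \<and>
    (\<forall>i<d. \<forall>j<d. (\<Sum>m<d. cc \<alpha>0 \<beta>0 m * DD \<alpha>0 \<beta>0 m i j) = (if i = \<alpha>0 \<and> j = \<beta>0 then 1 else 0))"
    by (elim exE)
  have D: "\<And>\<alpha>0 \<beta>0 m. \<alpha>0 < d \<Longrightarrow> \<beta>0 < d \<Longrightarrow> m < d \<Longrightarrow> DD \<alpha>0 \<beta>0 m \<in> cyc d"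
    "\<And>\<alpha>0 \<beta>0 i j. \<alpha>0 < d \<Longrightarrow> \<beta>0 < d \<Longrightarrow> i < d \<Longrightarrow> j < d \<Longrightarrow>
      (\<Sum>m<d. cc \<alpha>0 \<beta>0 m * DD \<alpha>0 \<beta>0 m i j) = (if i = \<alpha>0 \<and> j = \<beta>0 then 1 else 0)"
    using D0 by blast+
  \<comment> \<open>The coefficient \<open>cc \<alpha>0 \<beta>0 m\<close> belongs to the block
    \<open>A \<alpha>0 \<beta>0\<close> tensored with \<open>DD \<alpha>0 \<beta>0 m\<close>. With
    these coefficients the sum is the given matrix; with coefficients from the range of
    \<open>H\<close> it lies over the division algebra.\<close>
  define C1 where "C1 = (\<lambda>(\<alpha>0, \<beta>0, m) (\<beta>, j) (\<alpha>, i).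
    if \<alpha> < d \<and> i < n then DD \<alpha>0 \<beta>0 m \<alpha> \<beta> * H (A \<alpha>0 \<beta>0 (i, j)) else 0)"
  let ?L1 = "{..<d} \<times> {..<d} \<times> {..<d}"
  have s1: "(\<Sum>l\<in>?L1. scl (x l) (C1 l (\<beta>, j))) (\<alpha>, i) = (if \<alpha> < d \<and> i < n then
      (\<Sum>\<alpha>0<d. \<Sum>\<beta>0<d. H (A \<alpha>0 \<beta>0 (i, j)) * (\<Sum>m<d. x (\<alpha>0, \<beta>0, m) * DD \<alpha>0 \<beta>0 m \<alpha> \<beta>)) else 0)" for x \<alpha> \<beta> i j
  proof (cases "\<alpha> < d \<and> i < n")
    case True
    then show ?thesis by (simp add: sum_fun_apply sum_triple C1_def sum_distrib_left mult_ac)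
  next
    case False
    then have "C1 l (\<beta>, j) (\<alpha>, i) = 0" for l by (cases l) (simp only: C1_def case_prod_conv if_False)
    then show ?thesis by (simp only: False if_False sum_fun_apply scl_apply mult_zero_right sum.neutral_const)
  qed
  have col1: "(\<Sum>l\<in>?L1. scl ((\<lambda>(\<alpha>0, \<beta>0, m). cc \<alpha>0 \<beta>0 m) l) (C1 l b)) = (\<lambda>i. H (bcol d n A b i))" if "b \<in> ?J" for b
  proof
    fix k :: "nat \<times> nat"
    obtain \<alpha> i where k: "k = (\<alpha>, i)" by (cases k)
    obtain \<beta> j where b: "b = (\<beta>, j)" by (cases b)
    show "(\<Sum>l\<in>?L1. scl ((\<lambda>(\<alpha>0, \<beta>0, m). cc \<alpha>0 \<beta>0 m) l) (C1 l b)) k = H (bcol d n A b k)"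
    proof (cases "\<alpha> < d \<and> i < n")
      case True
      have "(\<Sum>\<alpha>0<d. \<Sum>\<beta>0<d. H (A \<alpha>0 \<beta>0 (i, j)) * (\<Sum>m<d. cc \<alpha>0 \<beta>0 m * DD \<alpha>0 \<beta>0 m \<alpha> \<beta>))
        = (\<Sum>\<alpha>0<d. \<Sum>\<beta>0<d. if \<beta>0 = \<beta> then if \<alpha>0 = \<alpha> then H (A \<alpha>0 \<beta>0 (i, j)) else 0 else 0)"
        by (intro sum.cong refl) (use True that b in \<open>auto simp: D(2)\<close>)
      also have "\<dots> = H (A \<alpha> \<beta> (i, j))" using True that b by simp
      finally show ?thesis using True unfolding k b s1 by (simp add: bcol_def)
    qed (auto simp: k b s1 bcol_def)
  qed
  have "finite ?L1" by simp
  from rank_swap[OF this finJ infH, where C = C1 and x = "\<lambda>(\<alpha>0, \<beta>0, m). cc \<alpha>0 \<beta>0 m"]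
  obtain y where "(\<forall>l\<in>?L1. y l \<in> range H) \<and>
    fv.dim ((\<lambda>b. \<Sum>l\<in>?L1. scl ((\<lambda>(\<alpha>0, \<beta>0, m). cc \<alpha>0 \<beta>0 m) l) (C1 l b)) ` ?J) \<le> fv.dim ((\<lambda>b. \<Sum>l\<in>?L1. scl (y l) (C1 l b)) ` ?J)"
    by (rule exE)
  note y = bspec[OF conjunct1[OF this]] conjunct2[OF this]
  define y' where "y' l = inv_into UNIV H (y l)" for l
  have y': "cst (h (y' l)) = y l" if "l \<in> ?L1" for l
    using f_inv_into_f[OF y(1)[OF that]] by (simp add: y'_def H_def)
  define M where "M \<alpha>0 \<beta>0 = (\<lambda>\<alpha> \<beta>. \<Sum>m<d. y (\<alpha>0, \<beta>0, m) * DD \<alpha>0 \<beta>0 m \<alpha> \<beta>)" for \<alpha>0 \<beta>0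
  have M: "M \<alpha>0 \<beta>0 \<in> cyc d" if "\<alpha>0 < d" "\<beta>0 < d" for \<alpha>0 \<beta>0
  proof -
    have "M \<alpha>0 \<beta>0 = (\<lambda>\<alpha> \<beta>. \<Sum>m<d. cst (h (y' (\<alpha>0, \<beta>0, m))) * DD \<alpha>0 \<beta>0 m \<alpha> \<beta>)"
      unfolding M_def using that y' by (intro ext sum.cong) auto
    then show ?thesis using cyc_sum[of "{..<d}" "DD \<alpha>0 \<beta>0" d] D(1) that by simp
  qed
  \<comment> \<open>After regrouping by the inner index, each block is a combination of elements of
    \<open>cyc d\<close> with coefficients from the image of the ground field.\<close>
  define blk where "blk i j = (\<lambda>\<alpha> \<beta>. \<Sum>l\<in>{..<d} \<times> {..<d}. cst (h (A (fst l) (snd l) (i, j))) * M (fst l) (snd l) \<alpha> \<beta>)" for i j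
  have blk: "blk i j \<in> cyc d" for i j
    unfolding blk_def by (rule cyc_sum) (use M in auto)
  let ?a = "\<lambda>(\<beta>, j) (\<alpha>, i). if \<alpha> < d \<and> i < n then blk i j \<alpha> \<beta> else 0"
  have col2: "(\<lambda>b. \<Sum>l\<in>?L1. scl (y l) (C1 l b)) = ?a"
  proof (intro ext)
    fix b k :: "nat \<times> nat"
    show "(\<Sum>l\<in>?L1. scl (y l) (C1 l b)) k = ?a b k"
      by (cases b; cases k; simp only: s1) (simp add: blk_def M_def H_def sum.cartesian_product')
  qed
  obtain k where k: "fv.dim (?a ` ?J) = k * d"
  proof -
    have "d dvd fv.dim (?a ` ?J)" by (rule dvd_rank_cyc) (rule blk)
    then obtain k where "fv.dim (?a ` ?J) = d * k" by (rule dvdE)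
    then show ?thesis by (intro that[of k]) (simp only: mult.commute)
  qed
  \<comment> \<open>The same matrix expanded over matrix units: the coefficients are now the Laurent
    entries of the \<open>M \<alpha>0 \<beta>0\<close>, and exchanging them for values of
    \<open>H\<close> leads back to blocks in \<open>V\<close>.\<close>
  define C2 where "C2 = (\<lambda>(\<alpha>0, \<beta>0, \<gamma>, \<epsilon>) (\<beta> :: nat, j) (\<alpha> :: nat, i).
    if \<alpha> < d \<and> i < n then if \<gamma> = \<alpha> then if \<epsilon> = \<beta> then H (A \<alpha>0 \<beta>0 (i, j)) else 0 else 0 else 0)"
  let ?L2 = "{..<d} \<times> {..<d} \<times> {..<d} \<times> {..<d}"
  have s2: "(\<Sum>l\<in>?L2. scl (x l) (C2 l (\<beta>, j))) (\<alpha>, i) = (if \<alpha> < d \<and> i < n then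
      (\<Sum>\<alpha>0<d. \<Sum>\<beta>0<d. H (A \<alpha>0 \<beta>0 (i, j)) * x (\<alpha>0, \<beta>0, \<alpha>, \<beta>)) else 0)" if "\<beta> < d" for x \<alpha> \<beta> i j
  proof (cases "\<alpha> < d \<and> i < n")
    case True
    have "(\<Sum>\<gamma><d. \<Sum>\<epsilon><d. x (\<alpha>0, \<beta>0, \<gamma>, \<epsilon>) * C2 (\<alpha>0, \<beta>0, \<gamma>, \<epsilon>) (\<beta>, j) (\<alpha>, i)) =
      (\<Sum>\<gamma><d. \<Sum>\<epsilon><d. if \<epsilon> = \<beta> then if \<gamma> = \<alpha> then H (A \<alpha>0 \<beta>0 (i, j)) * x (\<alpha>0, \<beta>0, \<gamma>, \<epsilon>) else 0 else 0)" for \<alpha>0 \<beta>0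
      by (intro sum.cong refl) (use True in \<open>simp add: C2_def\<close>)
    then have "(\<Sum>\<gamma><d. \<Sum>\<epsilon><d. x (\<alpha>0, \<beta>0, \<gamma>, \<epsilon>) * C2 (\<alpha>0, \<beta>0, \<gamma>, \<epsilon>) (\<beta>, j) (\<alpha>, i)) =
      H (A \<alpha>0 \<beta>0 (i, j)) * x (\<alpha>0, \<beta>0, \<alpha>, \<beta>)" for \<alpha>0 \<beta>0
      using that True by simp
    then show ?thesis using True by (simp add: sum_fun_apply sum_quadruple)
  next
    case False
    then have "C2 l (\<beta>, j) (\<alpha>, i) = 0" for l by (cases l) (simp only: C2_def case_prod_conv if_False)
    then show ?thesis by (simp only: False if_False sum_fun_apply scl_apply mult_zero_right sum.neutral_const)
  qed
  have col3: "(\<Sum>l\<in>?L2. scl ((\<lambda>(\<alpha>0, \<beta>0, \<gamma>, \<epsilon>). M \<alpha>0 \<beta>0 \<gamma> \<epsilon>) l) (C2 l b)) = ?a b" if "b \<in> ?J" for b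
  proof
    fix k :: "nat \<times> nat"
    show "(\<Sum>l\<in>?L2. scl ((\<lambda>(\<alpha>0, \<beta>0, \<gamma>, \<epsilon>). M \<alpha>0 \<beta>0 \<gamma> \<epsilon>) l) (C2 l b)) k = ?a b k"
    proof -
      obtain \<alpha> i where k: "k = (\<alpha>, i)" by (cases k)
      obtain \<beta> j where b: "b = (\<beta>, j)" by (cases b)
      have "\<beta> < d" using that b by simp
      show ?thesis unfolding k b s2[OF \<open>\<beta> < d\<close>] by (simp add: blk_def H_def sum.cartesian_product')
    qed
  qed
  have "finite ?L2" by simp
  from rank_swap[OF this finJ infH, where C = C2 and x = "\<lambda>(\<alpha>0, \<beta>0, \<gamma>, \<epsilon>). M \<alpha>0 \<beta>0 \<gamma> \<epsilon>"]
  obtain z where "(\<forall>l\<in>?L2. z l \<in> range H) \<and>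
    fv.dim ((\<lambda>b. \<Sum>l\<in>?L2. scl ((\<lambda>(\<alpha>0, \<beta>0, \<gamma>, \<epsilon>). M \<alpha>0 \<beta>0 \<gamma> \<epsilon>) l) (C2 l b)) ` ?J) \<le> fv.dim ((\<lambda>b. \<Sum>l\<in>?L2. scl (z l) (C2 l b)) ` ?J)"
    by (rule exE)
  note z = bspec[OF conjunct1[OF this]] conjunct2[OF this]
  define z' where "z' l = inv_into UNIV H (z l)" for l
  have z': "H (z' l) = z l" if "l \<in> ?L2" for l
    using f_inv_into_f[OF z(1)[OF that]] by (simp add: z'_def)
  define A' where "A' \<gamma> \<epsilon> = (\<Sum>\<alpha>0<d. \<Sum>\<beta>0<d. scl (z' (\<alpha>0, \<beta>0, \<gamma>, \<epsilon>)) (A \<alpha>0 \<beta>0))" for \<gamma> \<epsilon>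
  have A': "A' \<gamma> \<epsilon> \<in> V" for \<gamma> \<epsilon>
    unfolding A'_def by (intro fv.subspace_sum[OF V] fv.subspace_scale[OF V] A)
  have col4: "(\<Sum>l\<in>?L2. scl (z l) (C2 l b)) = (\<lambda>i. H (bcol d n A' b i))" if "b \<in> ?J" for b
  proof
    fix k :: "nat \<times> nat"
    obtain \<alpha> i where k: "k = (\<alpha>, i)" by (cases k)
    obtain \<beta> j where b: "b = (\<beta>, j)" by (cases b)
    have "\<beta> < d" using that b by simp
    then show "(\<Sum>l\<in>?L2. scl (z l) (C2 l b)) k = H (bcol d n A' b k)"
      unfolding b k s2[OF \<open>\<beta> < d\<close>]
      by (auto simp: bcol_def A'_def sum_fun_apply H.hom_sum H.hom_mult z' mult.commute intro!: sum.cong)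
  qed
  have "brank d n A {..<d} = fv.dim ((\<lambda>b i. H (bcol d n A b i)) ` ?J)"
    unfolding brank_def by (rule dim_hom[OF H.field_hom_axioms _ finJ bcol_coords, symmetric]) simp
  also have "\<dots> = fv.dim ((\<lambda>b. \<Sum>l\<in>?L1. scl ((\<lambda>(\<alpha>0, \<beta>0, m). cc \<alpha>0 \<beta>0 m) l) (C1 l b)) ` ?J)"
    by (intro arg_cong[where f = fv.dim] image_cong refl col1[symmetric])
  also have "\<dots> \<le> k * d" using y(2) unfolding col2 k .
  finally have 1: "brank d n A {..<d} \<le> k * d" .
  have "k * d = fv.dim ((\<lambda>b. \<Sum>l\<in>?L2. scl ((\<lambda>(\<alpha>0, \<beta>0, \<gamma>, \<epsilon>). M \<alpha>0 \<beta>0 \<gamma> \<epsilon>) l) (C2 l b)) ` ?J)"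
    unfolding k[symmetric] by (intro arg_cong[where f = fv.dim] image_cong refl col3[symmetric])
  also have "\<dots> \<le> fv.dim ((\<lambda>b. \<Sum>l\<in>?L2. scl (z l) (C2 l b)) ` ?J)" by (rule z(2))
  also have "\<dots> = fv.dim ((\<lambda>b i. H (bcol d n A' b i)) ` ?J)"
    by (intro arg_cong[where f = fv.dim] image_cong refl col4)
  also have "\<dots> = brank d n A' {..<d}"
    unfolding brank_def by (rule dim_hom[OF H.field_hom_axioms _ finJ bcol_coords]) simp
  finally have 2: "k * d \<le> brank d n A' {..<d}" .
  show ?thesis using 1 2 A' by blast
qed

text \<open>With \<open>g\<close> a projection onto \<open>I\<close>, the map \<open>x - g x\<close>
  plays the quotient by \<open>I\<close> inside the same function type.\<close>

lemma quotient_map: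
  assumes "fv.subspace I"
  obtains q :: "('i \<Rightarrow> 'a::field) \<Rightarrow> 'i \<Rightarrow> 'a" where "Vector_Spaces.linear scl scl q" "\<forall>x. q x = 0 \<longleftrightarrow> x \<in> I"
proof -
  obtain g where g: "range g \<subseteq> I" "Vector_Spaces.linear scl scl g" "\<forall>v\<in>I. g (id v) = v"
    using fvp.linear_exists_left_inverse_on[of id I] fv.linear_id assms by (metis inj_on_id)
  have "Vector_Spaces.linear scl scl (\<lambda>x. x - g x)"
    using fvp.linear_compose_sub[OF fv.linear_id g(2)] by simp
  moreover have "x - g x = 0 \<longleftrightarrow> x \<in> I" for x
    using g(1,3) by (auto simp: image_subset_iff) (metis rangeI)
  ultimately show ?thesis using that by blast
qed

text \<open>Rank-nullity for \<open>f\<close> followed by the quotient map modulo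
  \<open>I\<close>.\<close>

lemma dim_span_union_image:
  fixes f :: "('i \<Rightarrow> 'a::field) \<Rightarrow> 'j \<Rightarrow> 'a"
  assumes f: "Vector_Spaces.linear scl scl f" and I: "fv.subspace I" "findim I"
    and E: "fv.subspace E" "findim E"
  shows "fv.dim (I \<union> f ` E) + fv.dim {u \<in> E. f u \<in> I} = fv.dim I + fv.dim E"
proof -
  obtain q :: "('j \<Rightarrow> 'a) \<Rightarrow> 'j \<Rightarrow> 'a" where q0: "Vector_Spaces.linear scl scl q" "\<forall>x. q x = 0 \<longleftrightarrow> x \<in> I"
    using quotient_map[OF I(1)] .
  note q = q0(1) spec[OF q0(2)]
  let ?W = "fv.span (I \<union> f ` E)"
  have fd: "findim ?W"
  proof -
    obtain B C where "finite B" "I \<subseteq> fv.span B" "finite C" "f ` E \<subseteq> fv.span C"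
      using I(2) findim_image[OF f E(2)] unfolding findim_def by blast
    then have "finite (B \<union> C)" "I \<union> f ` E \<subseteq> fv.span (B \<union> C)"
      using fv.span_mono[of B "B \<union> C"] fv.span_mono[of C "B \<union> C"] by auto
    then show ?thesis unfolding findim_def using fv.span_minimal[OF _ fv.subspace_span] by blast
  qed
  have img: "q ` ?W = q ` f ` E"
  proof -
    have "q ` ?W = fv.span (q ` (I \<union> f ` E))" by (simp add: fvp.linear_span_image[OF q(1)])
    also have "q ` (I \<union> f ` E) = q ` f ` E"
    proof -
      have "q x = q (f 0)" if "x \<in> I" for x
      proof -
        have "q x = 0" using that q(2) by blast
        then show ?thesis by (simp only: fvp.linear_0[OF f] fvp.linear_0[OF q(1)])
      qed
      then show ?thesis using fv.subspace_0[OF E(1)] by (auto simp: image_Un image_iff)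
    qed
    also have "fv.span (q ` f ` E) = q ` f ` E"
      by (intro fv.span_eq_iff[THEN iffD2] fvp.linear_subspace_image q f E)
    finally show ?thesis .
  qed
  have ker: "{x \<in> ?W. q x = 0} = I" using q(2) by (auto intro: fv.span_base)
  have 1: "fv.dim ?W = fv.dim (q ` f ` E) + fv.dim I"
    using rank_nullity[OF q(1) fv.subspace_span fd] unfolding img ker .
  have "Vector_Spaces.linear scl scl (q \<circ> f)"
    by (rule Vector_Spaces.linear_compose[OF f q(1)])
  from rank_nullity[OF this E]
  have "fv.dim E = fv.dim (q ` f ` E) + fv.dim {u \<in> E. f u \<in> I}"
    by (simp add: image_comp q(2))
  then show ?thesis using 1 by simp
qed

text \<open>Since \<open>f u\<close> is in \<open>I\<close>, for t \<noteq> 0 the vector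
  \<open>g u\<close> already belongs to the span of \<open>I\<close> and the image of
  \<open>f + t g\<close>, so adjoining it does not raise the dimension above the maximum. If
  \<open>g u\<close> were outside the span at t = 0, adjoining it there would exceed the maximum,
  and by semicontinuity so it would for almost all \<open>t\<close>.\<close>

lemma first_order:
  fixes f g :: "(nat \<Rightarrow> 'a::field_char_0) \<Rightarrow> 'i \<Rightarrow> 'a"
  assumes f: "Vector_Spaces.linear scl scl f" and g: "Vector_Spaces.linear scl scl g"
    and I: "fv.subspace I" "findim I"
    and max: "\<And>t. fv.dim (I \<union> (\<lambda>u. f u + scl t (g u)) ` coords {..<n}) \<le> fv.dim (I \<union> f ` coords {..<n})"
    and u: "u \<in> coords {..<n}" "f u \<in> I"
  shows "g u \<in> fv.span (I \<union> f ` coords {..<n})"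
proof (rule ccontr)
  let ?E = "coords {..<n} :: (nat \<Rightarrow> 'a) set"
  assume nin: "g u \<notin> fv.span (I \<union> f ` ?E)"
  obtain B where B: "B \<subseteq> I" "I \<subseteq> fv.span B" "finite B" using findim_basis[OF I(2)] by metis
  have spB: "fv.span B = I" using B I(1) fv.span_minimal by blast
  \<comment> \<open>The family consists of a basis of \<open>I\<close> and \<open>g u\<close>, which
    stay fixed, and of the columns of \<open>f\<close>, which move along \<open>g\<close>.\<close>
  define c where "c b = (case b of Inl x \<Rightarrow> x | Inr j \<Rightarrow> f (unitf j))" for b :: "('i \<Rightarrow> 'a) + nat"
  define e where "e b = (case b of Inl x \<Rightarrow> 0 | Inr j \<Rightarrow> g (unitf j))" for b :: "('i \<Rightarrow> 'a) + nat"
  let ?J = "insert (g u) B <+> {..<n}"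
  have finJ: "finite ?J" using B(3) by simp
  have lin: "Vector_Spaces.linear scl scl (\<lambda>u. f u + scl t (g u))" for t
    by (intro fvp.linear_compose_add fvp.linear_compose_scale_right f g)
  have fE: "fv.span (\<phi> ` ?E) = fv.span (\<phi> ` unitf ` {..<n})" if "Vector_Spaces.linear scl scl \<phi>" for \<phi> :: "(nat \<Rightarrow> 'a) \<Rightarrow> 'i \<Rightarrow> 'a"
    unfolding coords_span[OF finite_lessThan] fvp.linear_span_image[OF that, symmetric]
    by (simp add: fvp.linear_span_image[OF that] fv.span_span)
  have span_un: "fv.span (X \<union> Y) = fv.span (X' \<union> Y')" if "fv.span X = fv.span X'" "fv.span Y = fv.span Y'" for X Y X' Y' :: "('i \<Rightarrow> 'a) set"
    using that by (simp add: fv.span_Un)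
  have spt: "fv.span ((\<lambda>j. c j + scl t (e j)) ` ?J) = fv.span (insert (g u) I \<union> (\<lambda>u. f u + scl t (g u)) ` ?E)" for t
  proof -
    have "(\<lambda>j. c j + scl t (e j)) ` ?J = insert (g u) B \<union> (\<lambda>u. f u + scl t (g u)) ` unitf ` {..<n}"
      by (auto simp: c_def e_def Plus_def image_Un image_image)
    moreover have "fv.span B = fv.span I" using spB fv.span_span by metis
    from span_un[OF refl this, of "{g u}"] have "fv.span (insert (g u) B) = fv.span (insert (g u) I)" by simp
    from span_un[OF this fE[OF lin, of t, symmetric]]
    have "fv.span (insert (g u) B \<union> (\<lambda>u. f u + scl t (g u)) ` unitf ` {..<n}) =
      fv.span (insert (g u) I \<union> (\<lambda>u. f u + scl t (g u)) ` ?E)" .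
    ultimately show ?thesis by (simp only:)
  qed
  have "finite {t. fv.dim ((\<lambda>j. c j + scl t (e j)) ` ?J) < fv.dim (c ` ?J)}"
    by (rule rank_perturb[OF finJ])
  then have "finite (insert 0 {t. fv.dim ((\<lambda>j. c j + scl t (e j)) ` ?J) < fv.dim (c ` ?J)})" by simp
  then obtain t where t: "t \<noteq> 0" "fv.dim (c ` ?J) \<le> fv.dim ((\<lambda>j. c j + scl t (e j)) ` ?J)"
    using ex_new_if_finite[OF infinite_UNIV_char_0] by (metis (no_types, lifting) insertCI mem_Collect_eq not_le)
  have "g u \<in> fv.span (I \<union> (\<lambda>u. f u + scl t (g u)) ` ?E)" (is "_ \<in> ?S")
  proof -
    have "f u + scl t (g u) \<in> ?S" using u(1) by (intro fv.span_base) blast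
    moreover have "f u \<in> ?S" using u(2) by (intro fv.span_base) blast
    ultimately have "scl (inverse t) (f u + scl t (g u) - f u) \<in> ?S"
      by (intro fv.span_scale fv.span_diff)
    then show ?thesis using t(1) by (simp add: fv.scale_scale del: scl_apply)
  qed
  then have "fv.span ((\<lambda>j. c j + scl t (e j)) ` ?J) = ?S"
    unfolding spt by (simp add: fv.span_redundant)
  from arg_cong[OF this, of fv.dim]
  have "fv.dim ((\<lambda>j. c j + scl t (e j)) ` ?J) = fv.dim (I \<union> (\<lambda>u. f u + scl t (g u)) ` ?E)"
    by (simp only: fv.dim_span)
  then have le: "fv.dim (c ` ?J) \<le> fv.dim (I \<union> f ` ?E)"
    using t(2) max[of t] by linarith
  have c0: "fv.span (c ` ?J) = fv.span (insert (g u) (I \<union> f ` ?E))"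
    using spt[of 0] by (simp add: fv.scale_zero_left del: scl_apply)
  have fd: "findim (fv.span (c ` ?J))" using finJ by simp
  have "fv.span (I \<union> f ` ?E) = fv.span (c ` ?J)"
  proof (rule subspace_eqI[OF fd])
    show "fv.span (I \<union> f ` ?E) \<subseteq> fv.span (c ` ?J)" unfolding c0 by (rule fv.span_mono) blast
    show "fv.dim (fv.span (c ` ?J)) \<le> fv.dim (fv.span (I \<union> f ` ?E))" using le by simp
  qed simp
  then show False using nin c0 fv.span_base[of "g u" "insert (g u) (I \<union> f ` ?E)"] by simp
qed

section \<open>Block columns and the increments of the rank\<close>

definition mv :: "nat \<Rightarrow> (nat \<times> nat \<Rightarrow> 'a::field) \<Rightarrow> (nat \<Rightarrow> 'a) \<Rightarrow> nat \<Rightarrow> 'a" where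
  "mv n X = mat_act n (\<lambda>i j. X (i, j))"

definition vspan :: "nat \<Rightarrow> (nat \<times> nat \<Rightarrow> 'a::field) set \<Rightarrow> (nat \<Rightarrow> 'a) set \<Rightarrow> (nat \<Rightarrow> 'a) set" where
  "vspan n V U = fv.span {mv n X u |X u. X \<in> V \<and> u \<in> U}"

definition cmap :: "nat \<Rightarrow> nat \<Rightarrow> (nat \<Rightarrow> nat \<times> nat \<Rightarrow> 'a::field) \<Rightarrow> (nat \<Rightarrow> 'a) \<Rightarrow> nat \<times> nat \<Rightarrow> 'a" where
  "cmap p n b u = (\<lambda>(\<alpha>, i). if \<alpha> < p then mv n (b \<alpha>) u i else 0)"

lemma vspan_coords: "vspan n V U \<subseteq> coords {..<n}"
  unfolding vspan_def by (rule fv.span_minimal[OF _ subspace_coords]) (auto simp: mv_def)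

lemma subspace_vspan [simp]: "fv.subspace (vspan n V U)"
  by (simp add: vspan_def)

lemma linear_cmap: "Vector_Spaces.linear scl scl (cmap p n b)"
  by unfold_locales (auto simp: cmap_def mv_def mat_act_def fun_eq_iff algebra_simps sum.distrib sum_distrib_left)

lemma cmap_add_scale: "cmap p n (\<lambda>\<alpha>. b \<alpha> + scl t (c \<alpha>)) u = cmap p n b u + scl t (cmap p n c u)"
  by (auto simp: cmap_def mv_def mat_act_def fun_eq_iff algebra_simps sum.distrib sum_distrib_left)

lemma cmap_bcol:
  "cmap p n (\<lambda>\<alpha>. A \<alpha> \<beta>) u = (\<Sum>j<n. scl (u j) (bcol p n A (\<beta>, j)))"
  by (auto simp: cmap_def mv_def mat_act_def bcol_def fun_eq_iff sum_fun_apply mult.commute)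

definition bspan :: "nat \<Rightarrow> nat \<Rightarrow> (nat \<Rightarrow> nat \<Rightarrow> nat \<times> nat \<Rightarrow> 'a::field) \<Rightarrow> nat set \<Rightarrow> (nat \<times> nat \<Rightarrow> 'a) set" where
  "bspan p n A S = fv.span (bcol p n A ` (S \<times> {..<n}))"

lemma subspace_bspan [simp]: "fv.subspace (bspan p n A S)"
  by (simp add: bspan_def)

lemma findim_bspan [simp]: "findim (bspan p n A S)"
proof -
  have "bspan p n A S \<subseteq> coords ({..<p} \<times> {..<n})"
    unfolding bspan_def by (rule fv.span_minimal) auto
  then show ?thesis by (rule findim_subset[rotated]) simp
qed

lemma dim_bspan: "fv.dim (bspan p n A S) = brank p n A S"
  by (simp add: bspan_def brank_def)

lemma bspan_mono: "S \<subseteq> S' \<Longrightarrow> bspan p n A S \<subseteq> bspan p n A S'"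
  unfolding bspan_def by (rule fv.span_mono) auto

lemma brank_mono: "S \<subseteq> S' \<Longrightarrow> brank p n A S \<le> brank p n A S'"
  unfolding dim_bspan[symmetric] by (rule dim_mono[OF findim_bspan bspan_mono])

lemma cmap_image: "cmap p n (\<lambda>\<alpha>. A \<alpha> \<beta>) ` coords {..<n} = fv.span (bcol p n A ` ({\<beta>} \<times> {..<n}))"
proof -
  have "bcol p n A ` ({\<beta>} \<times> {..<n}) = (\<lambda>j. bcol p n A (\<beta>, j)) ` {..<n}" by auto
  moreover have "(\<lambda>x. \<Sum>j<n. scl (x j) (bcol p n A (\<beta>, j))) ` coords {..<n} = cmap p n (\<lambda>\<alpha>. A \<alpha> \<beta>) ` coords {..<n}"
    by (rule image_cong) (simp_all add: cmap_bcol)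
  ultimately show ?thesis using span_family[of "{..<n}" "\<lambda>j. bcol p n A (\<beta>, j)"] by simp
qed

lemma bspan_insert:
  "bspan p n A (insert \<beta> S) = fv.span (bspan p n A S \<union> cmap p n (\<lambda>\<alpha>. A \<alpha> \<beta>) ` coords {..<n})"
proof -
  have "bcol p n A ` (insert \<beta> S \<times> {..<n}) = bcol p n A ` (S \<times> {..<n}) \<union> bcol p n A ` ({\<beta>} \<times> {..<n})" by blast
  then show ?thesis unfolding bspan_def cmap_image by (simp add: fv.span_Un fv.span_span)
qed

lemma cmap_in_bspan:
  assumes "u \<in> coords {..<n}" "\<beta> \<in> S"
  shows "cmap p n (\<lambda>\<alpha>. A \<alpha> \<beta>) u \<in> bspan p n A S"
proof -
  have "cmap p n (\<lambda>\<alpha>. A \<alpha> \<beta>) u \<in> fv.span (bcol p n A ` ({\<beta>} \<times> {..<n}))" using assms(1) unfolding cmap_image[symmetric] by blast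
  also have "\<dots> \<subseteq> bspan p n A S" unfolding bspan_def using assms(2) by (intro fv.span_mono) auto
  finally show ?thesis .
qed

text \<open>The vectors that block column \<open>\<beta>\<close> maps into the span of the block
  columns in \<open>S\<close>. By \<open>brank_insert\<close> the codimension of this space is the
  increment of the rank when \<open>\<beta>\<close> is added.\<close>

definition bker :: "nat \<Rightarrow> nat \<Rightarrow> (nat \<Rightarrow> nat \<Rightarrow> nat \<times> nat \<Rightarrow> 'a::field) \<Rightarrow> nat \<Rightarrow> nat set \<Rightarrow> (nat \<Rightarrow> 'a) set" where
  "bker p n A \<beta> S = {u \<in> coords {..<n}. cmap p n (\<lambda>\<alpha>. A \<alpha> \<beta>) u \<in> bspan p n A S}"

lemma bker_coords: "bker p n A \<beta> S \<subseteq> coords {..<n}"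
  by (auto simp: bker_def)

lemma findim_bker [simp]: "findim (bker p n A \<beta> S)"
  by (rule findim_subset[OF findim_coords bker_coords]) simp

lemma subspace_bker [simp]: "fv.subspace (bker p n A \<beta> S)"
proof -
  have "bker p n A \<beta> S = coords {..<n} \<inter> {u. cmap p n (\<lambda>\<alpha>. A \<alpha> \<beta>) u \<in> bspan p n A S}"
    by (auto simp: bker_def)
  then show ?thesis
    using fv.subspace_inter[OF subspace_coords fvp.linear_subspace_vimage[OF linear_cmap subspace_bspan]]
    by (simp add: vimage_def)
qed

lemma bker_mono: "S \<subseteq> S' \<Longrightarrow> bker p n A \<beta> S \<subseteq> bker p n A \<beta> S'"
  unfolding bker_def using bspan_mono[of S S' p n A] by (intro Collect_mono impI) (elim conjE, intro conjI, auto)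

lemma brank_insert: "brank p n A (insert \<beta> S) + fv.dim (bker p n A \<beta> S) = brank p n A S + n"
  using dim_span_union_image[OF linear_cmap[of p n "\<lambda>\<alpha>. A \<alpha> \<beta>"] subspace_bspan findim_bspan subspace_coords
      findim_coords[OF finite_lessThan[of n]], of p n A S]
  unfolding dim_bspan[symmetric] bspan_insert bker_def by (simp add: dim_coords)


lemma bcol_column_update:
  "\<beta> \<notin> S \<Longrightarrow> bspan p n (\<lambda>\<alpha> \<beta>'. if \<beta>' = \<beta> then b \<alpha> else A \<alpha> \<beta>') S = bspan p n A S"
  unfolding bspan_def by (intro arg_cong[where f = fv.span] image_cong) (auto simp: bcol_def)

text \<open>Varying only column \<open>\<beta>\<close> in the direction \<open>b\<close> leaves the
  span of the columns in \<open>S\<close> unchanged, and maximality of the rank on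
  \<open>insert \<beta> S\<close> supplies the hypothesis of \<open>first_order\<close>.\<close>

lemma block_first_order:
  fixes V :: "(nat \<times> nat \<Rightarrow> 'a::field_char_0) set"
  assumes V: "fv.subspace V" and A: "\<And>\<alpha> \<beta>. A \<alpha> \<beta> \<in> V"
    and maxi: "\<And>B. (\<And>\<alpha> \<beta>. B \<alpha> \<beta> \<in> V) \<Longrightarrow> brank p n B (insert \<beta> S) \<le> brank p n A (insert \<beta> S)"
    and \<beta>: "\<beta> \<notin> S" and u: "u \<in> bker p n A \<beta> S" and b: "\<And>\<alpha>. b \<alpha> \<in> V"
  shows "cmap p n b u \<in> bspan p n A (insert \<beta> S)"
  unfolding bspan_insert
proof (rule first_order[OF linear_cmap linear_cmap subspace_bspan findim_bspan])
  show "u \<in> coords {..<n}" "cmap p n (\<lambda>\<alpha>. A \<alpha> \<beta>) u \<in> bspan p n A S" using u by (auto simp: bker_def)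
  fix t
  define B where "B = (\<lambda>\<alpha> \<beta>'. if \<beta>' = \<beta> then A \<alpha> \<beta> + scl t (b \<alpha>) else A \<alpha> \<beta>')"
  have "brank p n B (insert \<beta> S) \<le> brank p n A (insert \<beta> S)"
    by (rule maxi) (auto simp: B_def intro!: A b fv.subspace_add[OF V] fv.subspace_scale[OF V] simp del: scl_apply)
  moreover have "bspan p n B (insert \<beta> S) =
      fv.span (bspan p n A S \<union> (\<lambda>u. cmap p n (\<lambda>\<alpha>. A \<alpha> \<beta>) u + scl t (cmap p n b u)) ` coords {..<n})"
    unfolding bspan_insert using bcol_column_update[OF \<beta>, of p n "\<lambda>\<alpha>. A \<alpha> \<beta> + scl t (b \<alpha>)" A]
    by (simp add: B_def cmap_add_scale del: scl_apply)
  ultimately show "fv.dim (bspan p n A S \<union> (\<lambda>u. cmap p n (\<lambda>\<alpha>. A \<alpha> \<beta>) u + scl t (cmap p n b u)) ` coords {..<n})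
      \<le> fv.dim (bspan p n A S \<union> cmap p n (\<lambda>\<alpha>. A \<alpha> \<beta>) ` coords {..<n})"
    unfolding dim_bspan[symmetric] bspan_insert[of p n A] by (simp add: fv.dim_span)
qed

lemma linear_row_embed: "Vector_Spaces.linear scl scl (\<lambda>y (\<alpha>', i). if \<alpha>' = \<alpha> then y i else 0)"
  by unfold_locales (auto simp: fun_eq_iff)

text \<open>Columns \<open>b\<close> with a single nonzero block produce the copy of V[U] in each
  block row separately.\<close>

lemma power_space_vspan:
  fixes V :: "(nat \<times> nat \<Rightarrow> 'a::field) set"
  assumes V: "fv.subspace V" and I: "fv.subspace I"
    and sub: "\<And>b u. (\<And>\<alpha>. b \<alpha> \<in> V) \<Longrightarrow> u \<in> U \<Longrightarrow> cmap p n b u \<in> I"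
  shows "power_space {..<p} (vspan n V U) \<subseteq> I"
proof
  fix z assume z: "z \<in> power_space {..<p} (vspan n V U)"
  let ?e = "\<lambda>\<alpha> (y :: nat \<Rightarrow> 'a) (\<alpha>', i). if \<alpha>' = \<alpha> then y i else 0"
  have "vspan n V U \<subseteq> {y. ?e \<alpha> y \<in> I}" if "\<alpha> < p" for \<alpha>
    unfolding vspan_def
  proof (rule fv.span_minimal)
    show "fv.subspace {y. ?e \<alpha> y \<in> I}"
      using fvp.linear_subspace_vimage[OF linear_row_embed I] by (simp add: vimage_def)
    show "{mv n X u |X u. X \<in> V \<and> u \<in> U} \<subseteq> {y. ?e \<alpha> y \<in> I}"
    proof safe
      fix X u assume "X \<in> V" "u \<in> U"
      moreover have "?e \<alpha> (mv n X u) = cmap p n (\<lambda>\<alpha>'. if \<alpha>' = \<alpha> then X else 0) u"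
        using that by (auto simp: cmap_def fun_eq_iff mv_def mat_act_def)
      ultimately show "?e \<alpha> (mv n X u) \<in> I"
        using sub[of "\<lambda>\<alpha>'. if \<alpha>' = \<alpha> then X else 0" u] fv.subspace_0[OF V] by simp
    qed
  qed
  then have "?e \<alpha> (\<lambda>i. z (\<alpha>, i)) \<in> I" if "\<alpha> < p" for \<alpha>
    using z that by (fastforce simp: power_space_def)
  then have "(\<Sum>\<alpha><p. ?e \<alpha> (\<lambda>i. z (\<alpha>, i))) \<in> I" by (intro fv.subspace_sum[OF I]) auto
  moreover have "(\<Sum>\<alpha><p. ?e \<alpha> (\<lambda>i. z (\<alpha>, i))) = z"
  proof
    fix k :: "nat \<times> nat"
    obtain \<alpha> i where k: "k = (\<alpha>, i)" by (cases k)
    show "(\<Sum>\<alpha><p. ?e \<alpha> (\<lambda>i. z (\<alpha>, i))) k = z k"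
      using z by (cases "\<alpha> < p") (auto simp: k sum_fun_apply power_space_def)
  qed
  ultimately show "z \<in> I" by simp
qed

text \<open>As the increment \<open>\<delta>\<close> does not drop, each block column has the same kernel \<open>U\<close> modulo the others,
  and by the first-order condition the span of any \<open>card T - 1\<close> of them contains all values on \<open>U\<close>.\<close>

lemma plateau:
  fixes V :: "(nat \<times> nat \<Rightarrow> 'a::field_char_0) set"
  assumes V: "fv.subspace V" and A: "\<And>\<alpha> \<beta>. A \<alpha> \<beta> \<in> V"
    and maxi: "\<And>S B. S \<subseteq> insert e T \<Longrightarrow> (\<And>\<alpha> \<beta>. B \<alpha> \<beta> \<in> V) \<Longrightarrow> brank p n B S \<le> brank p n A S"
    and T: "finite T" "T \<noteq> {}" "e \<notin> T"
    and \<delta>: "brank p n A (insert e T) = brank p n A T + \<delta>"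
      "\<And>s. s \<in> T \<Longrightarrow> brank p n A T = brank p n A (T - {s}) + \<delta>"
      "\<And>s. s \<in> T \<Longrightarrow> brank p n A (insert e (T - {s})) = brank p n A (T - {s}) + \<delta>"
  shows "\<exists>U. fv.subspace U \<and> U \<subseteq> coords {..<n} \<and> fv.dim U + \<delta> = n \<and>
    p * fv.dim (vspan n V U) + card T * \<delta> \<le> brank p n A T"
proof -
  define U where "U = bker p n A e T"
  have dimU: "fv.dim U + \<delta> = n"
    using brank_insert[of p n A e T] \<delta>(1) by (simp add: U_def)
  \<comment> \<open>Varying column \<open>s\<close> in the direction of column \<open>e\<close>
    gives one inclusion, and the equality of the increments gives equal dimensions.\<close>
  have Us: "bker p n A s (T - {s}) = U" if s: "s \<in> T" for s
  proof (rule subspace_eqI)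
    have ins: "insert s (T - {s}) = T" using s by blast
    have "u \<in> U" if u: "u \<in> bker p n A s (T - {s})" for u
    proof -
      have "cmap p n (\<lambda>\<alpha>. A \<alpha> e) u \<in> bspan p n A (insert s (T - {s}))"
        by (rule block_first_order[OF V A _ _ u A]) (unfold ins, rule maxi, auto)
      then show ?thesis using u unfolding ins by (simp add: U_def bker_def)
    qed
    then show "bker p n A s (T - {s}) \<subseteq> U" by blast
    show "fv.dim U \<le> fv.dim (bker p n A s (T - {s}))"
      using brank_insert[of p n A s "T - {s}", unfolded ins] \<delta>(2)[OF s] dimU by linarith
  qed (auto simp: U_def)
  have Ue: "bker p n A e (T - {s}) = U" if s: "s \<in> T" for s
  proof (rule subspace_eqI)
    show "bker p n A e (T - {s}) \<subseteq> U" unfolding U_def by (rule bker_mono) blast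
    show "fv.dim U \<le> fv.dim (bker p n A e (T - {s}))"
      using brank_insert[of p n A e "T - {s}"] \<delta>(3)[OF s] dimU by simp
  qed (auto simp: U_def)
  have all: "cmap p n b u \<in> bspan p n A (T - {s})" if s: "s \<in> T" and b: "\<And>\<alpha>. b \<alpha> \<in> V" and u: "u \<in> U" for s b u
  proof -
    have ins: "insert s (T - {s}) = T" using s by blast
    have 1: "cmap p n b u \<in> bspan p n A T"
      by (rule block_first_order[OF V A _ _ _ b, where p = p and n = n and \<beta> = s and S = "T - {s}" and u = u, unfolded ins])
        (use maxi[of T] u Us[OF s] in auto)
    have 2: "cmap p n b u \<in> bspan p n A (insert e (T - {s}))"
    proof (rule block_first_order[OF V A _ _ _ b])
      show "brank p n B (insert e (T - {s})) \<le> brank p n A (insert e (T - {s}))" if "\<And>\<alpha> \<beta>. B \<alpha> \<beta> \<in> V" for B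
        by (rule maxi[OF _ that]) auto
    qed (use T u Ue[OF s] in auto)
    then obtain z x where zx: "z \<in> bspan p n A (T - {s})" "x \<in> coords {..<n}"
      "cmap p n b u = z + cmap p n (\<lambda>\<alpha>. A \<alpha> e) x"
    proof -
      have f1: "fv.span (bspan p n A (T - {s})) = bspan p n A (T - {s})"
        by (simp add: fv.span_eq_iff)
      have f2: "fv.span (cmap p n (\<lambda>\<alpha>. A \<alpha> e) ` coords {..<n}) = cmap p n (\<lambda>\<alpha>. A \<alpha> e) ` coords {..<n}"
        unfolding fv.span_eq_iff by (rule fvp.linear_subspace_image[OF linear_cmap subspace_coords])
      show ?thesis using 2 that unfolding bspan_insert fv.span_Un f1 f2 by blast
    qed
    have "z \<in> bspan p n A T" using zx(1) bspan_mono[of "T - {s}" T p n A] by blast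
    then have "cmap p n b u - z \<in> bspan p n A T" using 1 by (intro fv.subspace_diff) auto
    then have "x \<in> U" using zx(2,3) by (simp add: U_def bker_def)
    then have "cmap p n (\<lambda>\<alpha>. A \<alpha> e) x \<in> bspan p n A (T - {s})" using Ue[OF s] by (auto simp: bker_def)
    then show ?thesis unfolding zx(3) using zx(1) by (intro fv.subspace_add) auto
  qed
  let ?Y = "power_space {..<p} (vspan n V U)"
  have Ysub: "?Y \<subseteq> bspan p n A (T - {s})" if "s \<in> T" for s
    by (rule power_space_vspan[OF V subspace_bspan]) (use all that in auto)
  have dimY: "fv.dim ?Y = p * fv.dim (vspan n V U)"
    using dim_power_space[OF finite_lessThan subspace_vspan vspan_coords finite_lessThan, of p n V U] by simp
  let ?J = "T \<times> {..<n}"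
  have finJ: "finite ?J" using T by simp
  let ?f = "\<lambda>x. \<Sum>b\<in>?J. scl (x b) (bcol p n A b)"
  have lin: "Vector_Spaces.linear scl scl ?f"
    by unfold_locales (auto simp: fun_eq_iff sum_fun_apply algebra_simps sum.distrib sum_distrib_left)
  \<comment> \<open>The preimage of V[U]^p under the block matrix. It contains the whole kernel,
    maps onto V[U]^p and lies in U^T, so comparing dimensions bounds the nullity from above and the
    rank from below.\<close>
  let ?X = "{x \<in> coords ?J. ?f x \<in> ?Y}"
  have subY: "fv.subspace ?Y" by simp
  have subX: "fv.subspace ?X"
    using fv.subspace_inter[OF subspace_coords fvp.linear_subspace_vimage[OF lin subY], of ?J]
    by (simp add: vimage_def Int_def)
  have fdX: "findim ?X" by (rule findim_subset[OF findim_coords[OF finJ]]) blast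
  have imX: "?f ` ?X = ?Y"
  proof -
    obtain s where "s \<in> T" using T(2) by blast
    then have "?Y \<subseteq> bspan p n A T" using Ysub bspan_mono[of "T - {s}" T p n A] by blast
    then have "?Y \<subseteq> ?f ` coords ?J" unfolding bspan_def span_family[OF finJ] .
    then show ?thesis by blast
  qed
  have kerX: "{x \<in> ?X. ?f x = 0} = {x \<in> coords ?J. ?f x = 0}"
    using fv.subspace_0[OF subY] by auto
  \<comment> \<open>As V[U]^p is in the span of \<open>T - {s}\<close>, so is the contribution of
    column \<open>s\<close> to any value in V[U]^p; this puts the component at \<open>s\<close> into
    \<open>U\<close>.\<close>
  have Xsub: "?X \<subseteq> power_space T U"
  proof
    fix x assume x: "x \<in> ?X"
    define xs where "xs s = (\<lambda>i. x (s, i))" for s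
    have xs: "xs s \<in> coords {..<n}" for s using x by (auto simp: xs_def coords_def)
    have fx: "?f x = (\<Sum>s\<in>T. cmap p n (\<lambda>\<alpha>. A \<alpha> s) (xs s))"
      by (simp add: sum.cartesian_product' cmap_bcol) (simp add: xs_def)
    have "xs s \<in> U" if s: "s \<in> T" for s
    proof -
      have "?f x = cmap p n (\<lambda>\<alpha>. A \<alpha> s) (xs s) + (\<Sum>s'\<in>T - {s}. cmap p n (\<lambda>\<alpha>. A \<alpha> s') (xs s'))"
        unfolding fx using s T(1) by (rule sum.remove[rotated])
      then have "cmap p n (\<lambda>\<alpha>. A \<alpha> s) (xs s) = ?f x - (\<Sum>s'\<in>T - {s}. cmap p n (\<lambda>\<alpha>. A \<alpha> s') (xs s'))"
        by simp
      also have "\<dots> \<in> bspan p n A (T - {s})"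
      proof (rule fv.subspace_diff[OF subspace_bspan])
        show "?f x \<in> bspan p n A (T - {s})" using x Ysub[OF s] by blast
        show "(\<Sum>s'\<in>T - {s}. cmap p n (\<lambda>\<alpha>. A \<alpha> s') (xs s')) \<in> bspan p n A (T - {s})"
          by (intro fv.subspace_sum[OF subspace_bspan] cmap_in_bspan xs)
      qed
      finally have "xs s \<in> bker p n A s (T - {s})" using xs by (simp add: bker_def)
      then show ?thesis using Us[OF s] by simp
    qed
    then show "x \<in> power_space T U"
      using x by (auto simp: power_space_def xs_def coords_def)
  qed
  have "fv.dim ?X \<le> card T * fv.dim U"
  proof -
    have "U \<subseteq> coords {..<n}" "fv.subspace U" using bker_coords by (simp_all add: U_def)
    then have "fv.dim (power_space T U) = card T * fv.dim U" "power_space T U \<subseteq> coords (T \<times> {..<n})"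
      using dim_power_space[OF T(1) _ _ finite_lessThan] power_space_coords by blast+
    moreover have "findim (power_space T U)"
      using findim_subset[OF findim_coords[OF finJ] calculation(2)] .
    ultimately show ?thesis using dim_mono[OF _ Xsub] by simp
  qed
  moreover have "fv.dim ?X = p * fv.dim (vspan n V U) + fv.dim {x \<in> coords ?J. ?f x = 0}"
    using rank_nullity[OF lin subX fdX] unfolding imX kerX dimY .
  moreover have "brank p n A T + fv.dim {x \<in> coords ?J. ?f x = 0} = card T * n"
    using family_rank_nullity[OF finJ, of "bcol p n A"] by (simp add: brank_def card_cartesian_product)
  moreover have "card T * n = card T * fv.dim U + card T * \<delta>"
    unfolding dimU[symmetric] by (rule distrib_left)
  ultimately have "p * fv.dim (vspan n V U) + card T * \<delta> \<le> brank p n A T" by linarith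
  moreover have "fv.subspace U" "U \<subseteq> coords {..<n}" using bker_coords by (simp_all add: U_def)
  ultimately show ?thesis using dimU by blast
qed

section \<open>Generic block matrices\<close>

lemma brank_le: "finite S \<Longrightarrow> brank p n A S \<le> card S * n"
proof -
  assume "finite S"
  then have "fv.dim (bcol p n A ` (S \<times> {..<n})) \<le> card (S \<times> {..<n})"
    using family_rank_nullity[of "S \<times> {..<n}" "bcol p n A"] by simp
  then show ?thesis by (simp add: brank_def card_cartesian_product)
qed

lemma bcol_line: "bcol p n (\<lambda>\<alpha> \<beta>. A \<alpha> \<beta> + scl t (B \<alpha> \<beta>)) b = bcol p n A b + scl t (bcol p n B b)"
  by (cases b) (auto simp: bcol_def fun_eq_iff)

lemma finite_rank_drop:
  assumes "finite S"
  shows "finite {t. brank p n (\<lambda>\<alpha> \<beta>. A \<alpha> \<beta> + scl t (B \<alpha> \<beta>)) S < brank p n A S}"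
  unfolding brank_def bcol_line by (rule rank_perturb) (use assms in simp)

text \<open>The sets of columns are treated one after another: on the line joining a matrix good for
  the earlier sets to one that is best for the new set, all but finitely many points are good for
  all of them.\<close>

lemma generic_exists:
  fixes V :: "(nat \<times> nat \<Rightarrow> 'a::field_char_0) set"
  assumes V: "fv.subspace V" and SS: "finite SS" "\<And>S. S \<in> SS \<Longrightarrow> finite S"
  shows "\<exists>A. (\<forall>\<alpha> \<beta>. A \<alpha> \<beta> \<in> V) \<and>
    (\<forall>S\<in>SS. \<forall>B. (\<forall>\<alpha> \<beta>. B \<alpha> \<beta> \<in> V) \<longrightarrow> brank p n B S \<le> brank p n A S)"
  using SS
proof (induction SS)
  case empty
  show ?case using fv.subspace_0[OF V] by (intro exI[of _ "\<lambda>\<alpha> \<beta>. 0"]) (simp only: ball_empty simp_thms)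
next
  case (insert S0 SS)
  obtain A where A: "\<forall>\<alpha> \<beta>. A \<alpha> \<beta> \<in> V"
    "\<forall>S\<in>SS. \<forall>B. (\<forall>\<alpha> \<beta>. B \<alpha> \<beta> \<in> V) \<longrightarrow> brank p n B S \<le> brank p n A S"
    using insert.IH insert.prems by auto
  have S0: "finite S0" using insert.prems by simp
  obtain B where B: "\<forall>\<alpha> \<beta>. B \<alpha> \<beta> \<in> V" "\<forall>C. (\<forall>\<alpha> \<beta>. C \<alpha> \<beta> \<in> V) \<longrightarrow> brank p n C S0 \<le> brank p n B S0"
    using ex_has_greatest_nat[of "\<lambda>B. \<forall>\<alpha> \<beta>. B \<alpha> \<beta> \<in> V" A "\<lambda>B. brank p n B S0" "Suc (card S0 * n)"]
      A(1) brank_le[OF S0, THEN le_imp_less_Suc] by blast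
  define C where "C t = (\<lambda>\<alpha> \<beta>. A \<alpha> \<beta> + scl t (B \<alpha> \<beta> - A \<alpha> \<beta>))" for t
  \<comment> \<open>The same line based at \<open>B\<close>, so that semicontinuity applies at both
    \<open>A\<close> and \<open>B\<close>.\<close>
  define C' where "C' s = (\<lambda>\<alpha> \<beta>. B \<alpha> \<beta> + scl s (B \<alpha> \<beta> - A \<alpha> \<beta>))" for s
  have CV: "C t \<alpha> \<beta> \<in> V" for t \<alpha> \<beta>
    unfolding C_def using A(1) B(1) by (intro fv.subspace_add[OF V] fv.subspace_scale[OF V] fv.subspace_diff[OF V]) auto
  have CC: "C t = C' (t - 1)" for t
    by (auto simp: C_def C'_def fun_eq_iff algebra_simps)
  have "finite ((\<Union>S\<in>SS. {t. brank p n (C t) S < brank p n A S}) \<union> (\<lambda>s. s + 1) ` {s. brank p n (C' s) S0 < brank p n B S0})"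
    unfolding C_def C'_def using insert.hyps(1) insert.prems
    by (intro finite_UnI finite_UN_I finite_imageI finite_rank_drop) auto
  then obtain t where t: "t \<notin> (\<Union>S\<in>SS. {t. brank p n (C t) S < brank p n A S}) \<union> (\<lambda>s. s + 1) ` {s. brank p n (C' s) S0 < brank p n B S0}"
    using ex_new_if_finite[OF infinite_UNIV_char_0] by blast
  have 1: "brank p n A S \<le> brank p n (C t) S" if "S \<in> SS" for S using t that by (auto simp: not_less)
  have "t - 1 \<notin> {s. brank p n (C' s) S0 < brank p n B S0}"
  proof
    assume "t - 1 \<in> {s. brank p n (C' s) S0 < brank p n B S0}"
    then have "t - 1 + 1 \<in> (\<lambda>s. s + 1) ` {s. brank p n (C' s) S0 < brank p n B S0}" by (rule imageI)
    then show False using t by simp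
  qed
  then have 2: "brank p n B S0 \<le> brank p n (C t) S0" unfolding CC by (simp add: not_less)
  have "\<forall>S\<in>insert S0 SS. \<forall>B. (\<forall>\<alpha> \<beta>. B \<alpha> \<beta> \<in> V) \<longrightarrow> brank p n B S \<le> brank p n (C t) S"
  proof (intro ballI allI impI)
    fix S and D :: "nat \<Rightarrow> nat \<Rightarrow> nat \<times> nat \<Rightarrow> 'a" assume S: "S \<in> insert S0 SS" and D: "\<forall>\<alpha> \<beta>. D \<alpha> \<beta> \<in> V"
    show "brank p n D S \<le> brank p n (C t) S"
    proof (cases "S = S0")
      case True
      then show ?thesis using B(2) D 2 by (meson order_trans)
    next
      case False
      then have "S \<in> SS" using S by simp
      then show ?thesis using A(2) D 1 by (meson order_trans)
    qed
  qed
  then show ?case using CV by (intro exI[of _ "C t"]) blast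
qed

text \<open>Relabelling the block columns of a matrix over \<open>V\<close> gives another admissible
  matrix, so maximality makes the rank depend on the number of columns only.\<close>

lemma generic_card:
  assumes A: "\<And>\<alpha> \<beta>. A \<alpha> \<beta> \<in> V"
    and maxi: "\<And>S B. S \<subseteq> {..<m} \<Longrightarrow> (\<And>\<alpha> \<beta>. B \<alpha> \<beta> \<in> V) \<Longrightarrow> brank p n B S \<le> brank p n A S"
    and S: "S \<subseteq> {..<m}" "S' \<subseteq> {..<m}" "card S = card S'"
  shows "brank p n A S = brank p n A S'"
proof -
  have le: "brank p n A S2 \<le> brank p n A S1" if prem: "S1 \<subseteq> {..<m}" "S2 \<subseteq> {..<m}" "card S1 = card S2" for S1 S2
  proof -
    have "finite S1" "finite S2" using prem(1,2) finite_subset by blast+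
    then obtain f where f: "bij_betw f S1 S2"
      using finite_same_card_bij[OF _ _ prem(3)] by blast
    have "bcol p n (\<lambda>\<alpha> \<beta>. A \<alpha> (f \<beta>)) ` (S1 \<times> {..<n}) = bcol p n A ` (S2 \<times> {..<n})"
    proof -
      have "bcol p n (\<lambda>\<alpha> \<beta>. A \<alpha> (f \<beta>)) (\<beta>, j) = bcol p n A (f \<beta>, j)" for \<beta> j
        by (auto simp: bcol_def)
      then have "bcol p n (\<lambda>\<alpha> \<beta>. A \<alpha> (f \<beta>)) ` (S1 \<times> {..<n}) = bcol p n A ` ((\<lambda>(\<beta>, j). (f \<beta>, j)) ` (S1 \<times> {..<n}))"
        unfolding image_image by (intro image_cong) auto
      also have "(\<lambda>(\<beta>, j). (f \<beta>, j)) ` (S1 \<times> {..<n}) = S2 \<times> {..<n}"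
        using f by (auto simp: bij_betw_def)
      finally show ?thesis .
    qed
    then have "brank p n A S2 = brank p n (\<lambda>\<alpha> \<beta>. A \<alpha> (f \<beta>)) S1" by (simp add: brank_def)
    also have "\<dots> \<le> brank p n A S1" by (rule maxi[OF prem(1)]) (rule A)
    finally show ?thesis .
  qed
  show ?thesis using le[OF S] le[OF S(2,1) S(3)[symmetric]] by simp
qed

text \<open>Without a plateau among the last n + 2 values, the sequence would drop n + 1 times from
  a value of at most n.\<close>

lemma nonincreasing_plateau:
  fixes \<delta> :: "nat \<Rightarrow> nat"
  assumes "\<And>j. Suc j < m \<Longrightarrow> \<delta> (Suc j) \<le> \<delta> j" "\<And>j. j < m \<Longrightarrow> \<delta> j \<le> n" "n + 2 \<le> m"
  shows "\<exists>j. m \<le> j + n + 2 \<and> Suc j < m \<and> \<delta> (Suc j) = \<delta> j"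
proof (rule ccontr)
  assume no: "\<not> ?thesis"
  have "\<delta> (m - (n + 2) + i) + i \<le> n" if "i < n + 2" for i
    using that
  proof (induction i)
    case 0
    then show ?case using assms(2)[of "m - (n + 2)"] assms(3) by simp
  next
    case (Suc i)
    let ?j = "m - (n + 2) + i"
    have "Suc ?j < m" using Suc.prems assms(3) by simp
    moreover have "m \<le> ?j + n + 2" by simp
    ultimately have "\<delta> (Suc ?j) < \<delta> ?j" using no assms(1) by (metis le_neq_implies_less)
    then show ?case using Suc by simp
  qed
  from this[of "n + 1"] show False by simp
qed

text \<open>For large \<open>m\<close> a plateau occurs among the last \<open>n + 2\<close> block columns. The resulting rank bound is off by less
  than \<open>m\<close>, so rounding up to a multiple of \<open>m\<close> makes it exact.\<close>

lemma large_rank: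
  fixes V :: "(nat \<times> nat \<Rightarrow> 'a::field_char_0) set" and h :: "'a \<Rightarrow> complex"
  assumes h: "field_hom h" and V: "fv.subspace V"
    and shrink: "\<And>U. fv.subspace U \<Longrightarrow> U \<subseteq> coords {..<n} \<Longrightarrow> fv.dim U + \<rho> \<le> fv.dim (vspan n V U) + n"
    and m: "m > n * (n + 2) + 2"
  shows "\<exists>A. (\<forall>\<alpha> \<beta>. A \<alpha> \<beta> \<in> V) \<and> m * \<rho> \<le> brank m n A {..<m}"
proof -
  obtain A where A: "\<And>\<alpha> \<beta>. A \<alpha> \<beta> \<in> V"
    and maxi: "\<And>S B. S \<subseteq> {..<m} \<Longrightarrow> (\<And>\<alpha> \<beta>. B \<alpha> \<beta> \<in> V) \<Longrightarrow> brank m n B S \<le> brank m n A S"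
    using generic_exists[OF V, of "Pow {..<m}" m n] finite_subset[OF _ finite_lessThan] by (metis PowD PowI finite_Pow_iff finite_lessThan)
  note gc = generic_card[OF A maxi]
  define g where "g j = brank m n A {..<j}" for j
  have gS: "brank m n A S = g (card S)" if "S \<subseteq> {..<m}" for S
  proof -
    have "card S \<le> m" using card_mono[OF finite_lessThan that] by simp
    then show ?thesis unfolding g_def using that by (intro gc) auto
  qed
  define \<delta> where "\<delta> j = g (Suc j) - g j" for j
  have gmono: "g j \<le> g k" if "j \<le> k" for j k unfolding g_def using that by (intro brank_mono) auto
  have ker: "g (Suc j) + fv.dim (bker m n A k {..<j}) = g j + n" if "j \<le> k" "k < m" for j k
    using brank_insert[of m n A k "{..<j}"] gS[of "insert k {..<j}"] that by (auto simp: g_def)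
  have \<delta>g: "g (Suc j) = g j + \<delta> j" for j using gmono[of j "Suc j"] by (simp add: \<delta>_def)
  have "\<exists>j. m \<le> j + n + 2 \<and> Suc j < m \<and> \<delta> (Suc j) = \<delta> j"
  proof (rule nonincreasing_plateau)
    fix j assume j: "Suc j < m"
    \<comment> \<open>Adding the common new column \<open>Suc j\<close> makes the two kernels
      comparable: it grows with the set of columns, so the increment shrinks.\<close>
    have "fv.dim (bker m n A (Suc j) {..<j}) \<le> fv.dim (bker m n A (Suc j) {..<Suc j})"
      by (intro dim_mono findim_bker bker_mono) auto
    then show "\<delta> (Suc j) \<le> \<delta> j" using ker[of j "Suc j"] ker[of "Suc j" "Suc j"] j \<delta>g[of j] \<delta>g[of "Suc j"] by simp
  next
    fix j assume "j < m"
    then show "\<delta> j \<le> n" using ker[of j j] \<delta>g[of j] by simp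
  qed (use m in simp)
  then obtain j where j: "m \<le> j + n + 2" "Suc j < m" "\<delta> (Suc j) = \<delta> j" by blast
  have "\<exists>U. fv.subspace U \<and> U \<subseteq> coords {..<n} \<and> fv.dim U + \<delta> j = n \<and>
    m * fv.dim (vspan n V U) + card {..<Suc j} * \<delta> j \<le> brank m n A {..<Suc j}"
  proof (rule plateau[OF V A])
    show "brank m n B S \<le> brank m n A S" if "S \<subseteq> insert (Suc j) {..<Suc j}" "\<And>\<alpha> \<beta>. B \<alpha> \<beta> \<in> V" for S B
      by (rule maxi) (use that j in auto)
    show "brank m n A (insert (Suc j) {..<Suc j}) = brank m n A {..<Suc j} + \<delta> j"
      using gS[of "insert (Suc j) {..<Suc j}"] gS[of "{..<Suc j}"] j \<delta>g[of "Suc j"] by auto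
    fix s assume s: "s \<in> {..<Suc j}"
    have sub: "{..<Suc j} - {s} \<subseteq> {..<m}" "insert (Suc j) ({..<Suc j} - {s}) \<subseteq> {..<m}" using j by auto
    from s show "brank m n A {..<Suc j} = brank m n A ({..<Suc j} - {s}) + \<delta> j"
      using gS[OF sub(1)] gS[of "{..<Suc j}"] j \<delta>g[of j] by auto
    have "card (insert (Suc j) ({..<Suc j} - {s})) = Suc j" using s by simp
    then show "brank m n A (insert (Suc j) ({..<Suc j} - {s})) = brank m n A ({..<Suc j} - {s}) + \<delta> j"
      using s gS[OF sub(1)] gS[OF sub(2)] j \<delta>g[of j] by auto
  qed auto
  then obtain U where U: "fv.subspace U" "U \<subseteq> coords {..<n}" "fv.dim U + \<delta> j = n"
    "m * fv.dim (vspan n V U) + Suc j * \<delta> j \<le> g (Suc j)" by (auto simp: g_def)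
  \<comment> \<open>The plateau accounts for m dim V[U] + (j + 1) \<delta> of the rank. What is
    missing to m \<rho> is at most (m - j - 1) \<delta> \<le> (n + 1) n, which is less than
    \<open>m\<close> by the choice of the threshold.\<close>
  have "\<rho> \<le> fv.dim (vspan n V U) + \<delta> j" using shrink[OF U(1,2)] U(3) by linarith
  then have "m * \<rho> \<le> m * fv.dim (vspan n V U) + m * \<delta> j" by (metis distrib_left mult_le_mono2)
  also have "m * \<delta> j \<le> (Suc j + n + 1) * \<delta> j" using j(1) by (intro mult_le_mono1) simp
  also have "(Suc j + n + 1) * \<delta> j = Suc j * \<delta> j + (n + 1) * \<delta> j" by (simp add: algebra_simps)
  also have "(n + 1) * \<delta> j \<le> (n + 1) * n" using U(3) by (intro mult_le_mono2) simp
  finally have "m * \<rho> \<le> g m + (n + 1) * n"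
    using U(4) gmono[of "Suc j" m] j(2) by linarith
  moreover have "(n + 1) * n < m" using m by (simp add: algebra_simps)
  ultimately have less: "m * \<rho> < g m + m" by linarith
  obtain A' k where A': "\<forall>\<alpha> \<beta>. A' \<alpha> \<beta> \<in> V" "g m \<le> k * m" "k * m \<le> brank m n A' {..<m}"
    using rank_round_up[where A = A and d = m and n = n, OF h V A] by (auto simp: g_def)
  have "m * \<rho> < (k + 1) * m" using less A'(2) by (simp add: algebra_simps)
  then have "\<rho> < k + 1" by (metis mult.commute mult_less_cancel2)
  then have "m * \<rho> \<le> k * m" by (metis Suc_eq_plus1 less_Suc_eq_le mult.commute mult_le_mono2)
  then show ?thesis using A' by (meson order_trans)
qed

section \<open>Deleting a block column and a block row\<close>

lemma delete_column:
  assumes "m > 0"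
  shows "\<exists>s<m. (m - 1) * brank p n A {..<m} \<le> m * brank p n A ({..<m} - {s})"
proof -
  let ?J = "{..<m} \<times> {..<n}"
  obtain J0 where J0: "J0 \<subseteq> ?J" "famind J0 (bcol p n A)" "card J0 = brank p n A {..<m}"
    using rank_witness[of ?J "bcol p n A"] unfolding brank_def by (metis finite_SigmaI finite_lessThan)
  have fin: "finite J0" using J0(1) finite_subset by fastforce
  define cs where "cs s = card (J0 \<inter> ({s} \<times> {..<n}))" for s
  have "(\<Sum>s<m. cs s) = card (\<Union>s\<in>{..<m}. J0 \<inter> ({s} \<times> {..<n}))"
    unfolding cs_def by (rule card_UN_disjoint[symmetric]) (use fin in auto)
  also have "(\<Union>s\<in>{..<m}. J0 \<inter> ({s} \<times> {..<n})) = J0" using J0(1) by auto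
  finally have sum: "(\<Sum>s<m. cs s) = card J0" .
  \<comment> \<open>The \<open>m\<close> block columns share the columns of a basis, so some block
    column holds at most the m-th part of them.\<close>
  have "\<exists>s<m. m * cs s \<le> card J0"
  proof (rule ccontr)
    assume "\<not> ?thesis"
    then have "(\<Sum>s<m. card J0) < (\<Sum>s<m. m * cs s)" using assms by (intro sum_strict_mono) (auto simp: not_le)
    then show False using sum by (simp add: sum_distrib_left[symmetric])
  qed
  then obtain s where s: "s < m" "m * cs s \<le> card J0" by blast
  have "card (J0 - {s} \<times> {..<n}) \<le> brank p n A ({..<m} - {s})"
  proof -
    have "famind (J0 - {s} \<times> {..<n}) (bcol p n A)"
    proof (rule famindI)
      show "inj_on (bcol p n A) (J0 - {s} \<times> {..<n})"
        using famind_inj[OF fin J0(2)] by (rule inj_on_subset) blast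
      show "fv.independent (bcol p n A ` (J0 - {s} \<times> {..<n}))"
        using famind_independent[OF fin J0(2)] by (rule fv.independent_mono) blast
    qed (use fin in simp)
    then have "card (J0 - {s} \<times> {..<n}) \<le> fv.dim (bspan p n A ({..<m} - {s}))"
      by (rule famind_card_le[rotated]) (use fin J0(1) in \<open>auto simp: bspan_def intro!: fv.span_base\<close>)
    then show ?thesis by (simp add: dim_bspan)
  qed
  moreover have "card (J0 - {s} \<times> {..<n}) = card J0 - cs s"
    unfolding cs_def using card_Diff_subset_Int[of J0 "{s} \<times> {..<n}"] fin by simp
  ultimately have "card J0 \<le> brank p n A ({..<m} - {s}) + cs s" by linarith
  then have "m * card J0 \<le> m * brank p n A ({..<m} - {s}) + m * cs s" by (metis distrib_left mult_le_mono2)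
  then have "m * card J0 \<le> m * brank p n A ({..<m} - {s}) + card J0" using s(2) by linarith
  then have "(m - 1) * card J0 \<le> m * brank p n A ({..<m} - {s})" by (simp add: diff_mult_distrib)
  then show ?thesis using s(1) J0(3) by auto
qed

text \<open>Subspaces supported in different block rows are independent; rank-nullity for the
  projection to one row splits it off.\<close>

lemma sum_row_intersections:
  fixes I :: "(nat \<times> nat \<Rightarrow> 'a::field) set"
  assumes I: "fv.subspace I" and R: "finite R"
  shows "(\<Sum>\<alpha>\<in>R. fv.dim (I \<inter> coords ({\<alpha>} \<times> {..<n}))) \<le> fv.dim (I \<inter> coords (R \<times> {..<n}))"
  using R
proof (induction R)
  case empty
  then show ?case by simp
next
  case (insert \<alpha> R)
  let ?W = "I \<inter> coords (insert \<alpha> R \<times> {..<n})"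
  let ?f = "\<lambda>(z :: nat \<times> nat \<Rightarrow> 'a) (\<alpha>', i). if \<alpha>' = \<alpha> then z (\<alpha>', i) else 0"
  have lin: "Vector_Spaces.linear scl scl ?f" by unfold_locales (auto simp: fun_eq_iff)
  have sW: "fv.subspace ?W" using I by (simp add: fv.subspace_inter)
  have fW: "findim ?W" by (rule findim_subset[OF findim_coords[of "insert \<alpha> R \<times> {..<n}"]]) (use insert.hyps in auto)
  have "I \<inter> coords ({\<alpha>} \<times> {..<n}) \<subseteq> ?f ` ?W"
  proof
    fix z assume z: "z \<in> I \<inter> coords ({\<alpha>} \<times> {..<n})"
    then have "z = ?f z" by (auto simp: coords_def fun_eq_iff)
    moreover have "z \<in> ?W" using z by (auto simp: coords_def)
    ultimately show "z \<in> ?f ` ?W" by (rule image_eqI)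
  qed
  then have 1: "fv.dim (I \<inter> coords ({\<alpha>} \<times> {..<n})) \<le> fv.dim (?f ` ?W)"
    by (rule dim_mono[OF findim_image[OF lin fW]])
  have f0: "?f z = 0 \<longleftrightarrow> (\<forall>i. z (\<alpha>, i) = 0)" for z
    by (simp add: fun_eq_iff)
  have "z \<in> coords (insert \<alpha> R \<times> {..<n}) \<and> (\<forall>i. z (\<alpha>, i) = 0) \<longleftrightarrow> z \<in> coords (R \<times> {..<n})" for z :: "nat \<times> nat \<Rightarrow> 'a"
  proof -
    have "(\<forall>k i. \<not> (k \<in> insert \<alpha> R \<and> i < n) \<longrightarrow> z (k, i) = 0) \<and> (\<forall>i. z (\<alpha>, i) = 0) \<longleftrightarrow>
      (\<forall>k i. \<not> (k \<in> R \<and> i < n) \<longrightarrow> z (k, i) = 0)"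
      using insert.hyps(2) by (metis insert_iff)
    then show ?thesis by (simp add: coords_def)
  qed
  then have "{z \<in> ?W. ?f z = 0} = I \<inter> coords (R \<times> {..<n})"
    unfolding f0 by blast
  then have "fv.dim ?W = fv.dim (?f ` ?W) + fv.dim (I \<inter> coords (R \<times> {..<n}))"
    using rank_nullity[OF lin sW fW] by simp
  then show ?case using 1 insert by (simp del: scl_apply)
qed

definition skip :: "nat \<Rightarrow> nat \<Rightarrow> nat" where
  "skip s j = (if j < s then j else Suc j)"

lemma skip_image: "s < m \<Longrightarrow> skip s ` {..<m - 1} = {..<m} - {s}"
proof (rule subset_antisym)
  assume s: "s < m"
  show "skip s ` {..<m - 1} \<subseteq> {..<m} - {s}" using s by (auto simp: skip_def)
  show "{..<m} - {s} \<subseteq> skip s ` {..<m - 1}"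
  proof
    fix x assume x: "x \<in> {..<m} - {s}"
    show "x \<in> skip s ` {..<m - 1}"
    proof (cases "x < s")
      case True
      then show ?thesis using s by (intro image_eqI[of _ _ x]) (auto simp: skip_def)
    next
      case False
      then show ?thesis using x by (intro image_eqI[of _ _ "x - 1"]) (auto simp: skip_def)
    qed
  qed
qed

text \<open>Forgetting block row \<open>s\<close> kills only those vectors of the column space that
  are supported in this row. By \<open>sum_row_intersections\<close> these losses sum to at most the
  rank, so some row costs at most the m-th part.\<close>

lemma delete_row:
  fixes A :: "nat \<Rightarrow> nat \<Rightarrow> nat \<times> nat \<Rightarrow> 'a::field"
  assumes "m > 0"
  shows "\<exists>s<m. (m - 1) * brank m n A S \<le> m * brank (m - 1) n (\<lambda>\<alpha> \<beta>. A (skip s \<alpha>) \<beta>) S"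
proof -
  let ?I = "bspan m n A S"
  define d where "d \<alpha> = fv.dim (?I \<inter> coords ({\<alpha>} \<times> {..<n}))" for \<alpha>
  have "(\<Sum>\<alpha><m. d \<alpha>) \<le> fv.dim (?I \<inter> coords ({..<m} \<times> {..<n}))"
    unfolding d_def by (rule sum_row_intersections) auto
  also have "\<dots> \<le> fv.dim ?I" by (rule dim_mono) auto
  finally have sum: "(\<Sum>\<alpha><m. d \<alpha>) \<le> brank m n A S" by (simp add: dim_bspan)
  have "\<exists>s<m. m * d s \<le> brank m n A S"
  proof (rule ccontr)
    assume "\<not> ?thesis"
    then have "(\<Sum>s<m. brank m n A S) < (\<Sum>s<m. m * d s)" using assms by (intro sum_strict_mono) (auto simp: not_le)
    then show False using sum by (simp add: sum_distrib_left[symmetric])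
  qed
  then obtain s where s: "s < m" "m * d s \<le> brank m n A S" by blast
  let ?f = "\<lambda>(z :: nat \<times> nat \<Rightarrow> 'a) (\<alpha>, i). if \<alpha> < m - 1 then z (skip s \<alpha>, i) else 0"
  have lin: "Vector_Spaces.linear scl scl ?f" by unfold_locales (auto simp: fun_eq_iff)
  have "?f ` bcol m n A ` (S \<times> {..<n}) = bcol (m - 1) n (\<lambda>\<alpha> \<beta>. A (skip s \<alpha>) \<beta>) ` (S \<times> {..<n})"
  proof -
    have "?f (bcol m n A b) = bcol (m - 1) n (\<lambda>\<alpha> \<beta>. A (skip s \<alpha>) \<beta>) b" for b
      using s(1) by (cases b) (auto simp: bcol_def fun_eq_iff skip_def)
    then show ?thesis by (simp add: image_image)
  qed
  from arg_cong[OF this, of fv.span] have img: "?f ` ?I = bspan (m - 1) n (\<lambda>\<alpha> \<beta>. A (skip s \<alpha>) \<beta>) S"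
    unfolding bspan_def fvp.linear_span_image[OF lin] .
  have Ico: "?I \<subseteq> coords ({..<m} \<times> {..<n})" unfolding bspan_def by (rule fv.span_minimal) auto
  have ker: "{z \<in> ?I. ?f z = 0} \<subseteq> ?I \<inter> coords ({s} \<times> {..<n})"
  proof
    fix z assume z: "z \<in> {z \<in> ?I. ?f z = 0}"
    then have zc: "z \<in> coords ({..<m} \<times> {..<n})" using Ico by blast
    have "z (\<alpha>, i) = 0" if "\<not> (\<alpha> = s \<and> i < n)" for \<alpha> i
    proof (cases "\<alpha> < m \<and> \<alpha> \<noteq> s")
      case True
      then have "\<alpha> \<in> skip s ` {..<m - 1}" using skip_image[OF s(1)] by auto
      then obtain \<alpha>' where a: "\<alpha> = skip s \<alpha>'" "\<alpha>' < m - 1" by auto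
      have "?f z (\<alpha>', i) = 0" using z by simp
      then show ?thesis using a by simp
    next
      case False
      then show ?thesis using zc that by (auto simp: coords_def)
    qed
    then show "z \<in> ?I \<inter> coords ({s} \<times> {..<n})" using z by (auto simp: coords_def)
  qed
  have "fv.dim {z \<in> ?I. ?f z = 0} \<le> d s"
    unfolding d_def by (rule dim_mono[OF findim_subset[OF findim_bspan] ker]) blast
  then have "brank m n A S \<le> brank (m - 1) n (\<lambda>\<alpha> \<beta>. A (skip s \<alpha>) \<beta>) S + d s"
    using rank_nullity[OF lin subspace_bspan findim_bspan, of m n A S] unfolding img dim_bspan by linarith
  then have "m * brank m n A S \<le> m * brank (m - 1) n (\<lambda>\<alpha> \<beta>. A (skip s \<alpha>) \<beta>) S + m * d s"
    by (metis distrib_left mult_le_mono2)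
  then have "m * brank m n A S \<le> m * brank (m - 1) n (\<lambda>\<alpha> \<beta>. A (skip s \<alpha>) \<beta>) S + brank m n A S"
    using s(2) by linarith
  then have "(m - 1) * brank m n A S \<le> m * brank (m - 1) n (\<lambda>\<alpha> \<beta>. A (skip s \<alpha>) \<beta>) S"
    by (simp add: diff_mult_distrib)
  then show ?thesis using s(1) by blast
qed

lemma brank_skip:
  assumes "s < m"
  shows "brank p n (\<lambda>\<alpha> \<beta>. A \<alpha> (skip s \<beta>)) {..<m - 1} = brank p n A ({..<m} - {s})"
proof -
  have "bcol p n (\<lambda>\<alpha> \<beta>. A \<alpha> (skip s \<beta>)) ` ({..<m - 1} \<times> {..<n}) = bcol p n A ` ((skip s ` {..<m - 1}) \<times> {..<n})"
    by (force simp: bcol_def)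
  then show ?thesis by (simp only: brank_def skip_image[OF assms])
qed

text \<open>Averaging over the deleted block row and column costs less than \<open>m - 1\<close>, so rounding up closes the gap.\<close>

lemma rank_descend:
  fixes V :: "(nat \<times> nat \<Rightarrow> 'a::field_char_0) set" and h :: "'a \<Rightarrow> complex"
  assumes h: "field_hom h" and V: "fv.subspace V" and A: "\<And>\<alpha> \<beta>. A \<alpha> \<beta> \<in> V"
    and rank: "m * \<rho> \<le> brank m n A {..<m}" and m: "m > \<rho>" "m \<ge> 2"
  shows "\<exists>A'. (\<forall>\<alpha> \<beta>. A' \<alpha> \<beta> \<in> V) \<and> (m - 1) * \<rho> \<le> brank (m - 1) n A' {..<m - 1}"
proof -
  have m0: "m > 0" using m by simp
  obtain s where s: "s < m" "(m - 1) * brank m n A {..<m} \<le> m * brank m n A ({..<m} - {s})"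
    using delete_column[OF m0] by blast
  define B where "B = (\<lambda>\<alpha> \<beta>. A \<alpha> (skip s \<beta>))"
  obtain s' where s': "s' < m" "(m - 1) * brank m n B {..<m - 1} \<le> m * brank (m - 1) n (\<lambda>\<alpha> \<beta>. B (skip s' \<alpha>) \<beta>) {..<m - 1}"
    using delete_row[OF m0] by blast
  define C where "C = (\<lambda>\<alpha> \<beta>. B (skip s' \<alpha>) \<beta>)"
  have CV: "C \<alpha> \<beta> \<in> V" for \<alpha> \<beta> by (simp add: C_def B_def A)
  obtain A' k where A': "\<forall>\<alpha> \<beta>. A' \<alpha> \<beta> \<in> V" "brank (m - 1) n C {..<m - 1} \<le> k * (m - 1)"
    "k * (m - 1) \<le> brank (m - 1) n A' {..<m - 1}"
    using rank_round_up[where A = C and d = "m - 1" and n = n, OF h V CV] by blast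
  have "(m - 1) * ((m - 1) * (m * \<rho>)) \<le> (m - 1) * ((m - 1) * brank m n A {..<m})"
    using rank by (intro mult_le_mono2)
  also have "\<dots> \<le> (m - 1) * (m * brank m n B {..<m - 1})"
    unfolding B_def brank_skip[OF s(1)] by (intro mult_le_mono2 s(2))
  also have "\<dots> = m * ((m - 1) * brank m n B {..<m - 1})" by (simp only: mult_ac)
  also have "\<dots> \<le> m * (m * brank (m - 1) n C {..<m - 1})"
    unfolding C_def by (intro mult_le_mono2 s'(2))
  also have "\<dots> \<le> m * (m * (k * (m - 1)))" by (intro mult_le_mono2 A'(2))
  finally have "(m * (m - 1)) * ((m - 1) * \<rho>) \<le> (m * (m - 1)) * (m * k)" by (simp only: mult_ac)
  then have le: "(m - 1) * \<rho> \<le> m * k" using m by simp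
  \<comment> \<open>If k \<le> \<rho> - 1, then (m - 1) \<rho> \<le> m k would give m \<le>
    \<rho>.\<close>
  have "\<rho> \<le> k"
  proof (rule ccontr)
    assume "\<not> \<rho> \<le> k"
    then have "m * (k + 1) \<le> m * \<rho>" by (intro mult_le_mono2) simp
    moreover have "m * \<rho> = (m - 1) * \<rho> + \<rho>" using m0 by (metis Suc_diff_1 add.commute mult_Suc)
    ultimately show False using le m(1) by simp
  qed
  then have "(m - 1) * \<rho> \<le> k * (m - 1)" by (metis mult.commute mult_le_mono1)
  then show ?thesis using A' by (meson order_trans)
qed

theorem block_rank:
  fixes V :: "(nat \<times> nat \<Rightarrow> 'a::field_char_0) set" and h :: "'a \<Rightarrow> complex"
  assumes h: "field_hom h" and V: "fv.subspace V"
    and shrink: "\<And>U. fv.subspace U \<Longrightarrow> U \<subseteq> coords {..<n} \<Longrightarrow> fv.dim U + \<rho> \<le> fv.dim (vspan n V U) + n"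
    and r: "r \<ge> 1" "r \<ge> \<rho>"
  shows "\<exists>A. (\<forall>\<alpha> \<beta>. A \<alpha> \<beta> \<in> V) \<and> r * \<rho> \<le> brank r n A {..<r}"
proof -
  \<comment> \<open>A starting size beyond the threshold of \<open>large_rank\<close>; the maximum
    makes it at least \<open>r\<close>, where the descent ends.\<close>
  define M where "M = max r (n * (n + 2) + 3)"
  have "r \<le> M" by (simp add: M_def)
  then show ?thesis
  proof (induction rule: inc_induct)
    case base
    show ?case by (rule large_rank[OF h V shrink]) (auto simp: M_def)
  next
    case (step k)
    then obtain A where "\<forall>\<alpha> \<beta>. A \<alpha> \<beta> \<in> V" "Suc k * \<rho> \<le> brank (Suc k) n A {..<Suc k}" by blast
    \<comment> \<open>The descent starts from size k + 1, and \<rho> \<le> r \<le> k makes this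
      larger than \<rho>.\<close>
    then show ?case using rank_descend[OF h V, of A "Suc k" \<rho> n] step r by simp
  qed
qed

section \<open>Antichains and chains\<close>

lemma linear_mv: "Vector_Spaces.linear scl scl (mv n X)"
  unfolding mv_def by (rule linear_mat_act)

lemma mv_coords [simp]: "mv n X u \<in> coords {..<n}"
  by (simp add: mv_def)

definition cip :: "nat \<Rightarrow> (nat \<Rightarrow> 'a::conjugatable_ordered_field) \<Rightarrow> (nat \<Rightarrow> 'a) \<Rightarrow> 'a" where
  "cip n u w = (\<Sum>i<n. u i * conjugate (w i))"

text \<open>Orthogonality is tested on the generators of V[C]; as \<open>cip\<close> is linear on
  the left, it then holds on their span.\<close>

definition fantichain :: "nat \<Rightarrow> (nat \<times> nat \<Rightarrow> 'a::conjugatable_ordered_field) set \<Rightarrow> (nat \<Rightarrow> 'a) set \<Rightarrow> bool" where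
  "fantichain n V C \<longleftrightarrow> fv.subspace C \<and> C \<subseteq> coords {..<n} \<and>
     (\<forall>X\<in>V. \<forall>u\<in>C. \<forall>w\<in>C. cip n (mv n X u) w = 0)"

lemma subspace_cip_left: "fv.subspace {u. cip n u w = 0}"
  by (auto simp: fv.subspace_def cip_def distrib_right sum.distrib mult.assoc sum_distrib_left[symmetric])

lemma cip_commute: "cip n w u = conjugate (cip n u w)"
  by (simp add: cip_def sum_conjugate conjugate_dist_mul mult.commute)

lemma subspace_cip_right: "fv.subspace {w. cip n u w = 0}"
  using subspace_cip_left[of n u] unfolding cip_commute[of n u] by simp

lemma cip_self_eq_0:
  assumes "u \<in> coords {..<n}" "cip n u u = 0"
  shows "u = 0"
proof -
  have "\<forall>i\<in>{..<n}. u i * conjugate (u i) = 0"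
    using assms(2) sum_nonneg_eq_0_iff[of "{..<n}" "\<lambda>i. u i * conjugate (u i)"]
    by (simp add: cip_def conjugate_square_positive)
  then have "u i = 0" for i using assms(1) by (cases "i < n") (auto simp: coords_def)
  then show ?thesis by auto
qed

lemma brank_block_map:
  "brank p n A {..<q} + fv.dim {x \<in> coords ({..<q} \<times> {..<n}). (\<Sum>s<q. cmap p n (\<lambda>\<alpha>. A \<alpha> s) (\<lambda>i. x (s, i))) = 0} = q * n"
proof -
  let ?J = "{..<q} \<times> {..<n}"
  have "(\<Sum>b\<in>?J. scl (x b) (bcol p n A b)) = (\<Sum>s<q. cmap p n (\<lambda>\<alpha>. A \<alpha> s) (\<lambda>i. x (s, i)))" for x
    by (simp add: sum.cartesian_product' cmap_bcol)
  then have "{x \<in> coords ?J. (\<Sum>b\<in>?J. scl (x b) (bcol p n A b)) = 0} =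
    {x \<in> coords ?J. (\<Sum>s<q. cmap p n (\<lambda>\<alpha>. A \<alpha> s) (\<lambda>i. x (s, i))) = 0}" by auto
  then show ?thesis
    using family_rank_nullity[of ?J "bcol p n A"] by (simp add: brank_def card_cartesian_product)
qed

lemma linear_block_map:
  fixes A :: "nat \<Rightarrow> nat \<Rightarrow> nat \<times> nat \<Rightarrow> 'a::field"
  shows "Vector_Spaces.linear scl scl (\<lambda>x. \<Sum>s\<in>S. cmap p n (\<lambda>\<alpha>. A \<alpha> s) (\<lambda>i. x (s, i)))"
proof (rule fvp.linear_compose_sum, intro ballI)
  fix s
  have "Vector_Spaces.linear scl scl (\<lambda>(x :: nat \<times> nat \<Rightarrow> 'a) i. x (s, i))"
    by unfold_locales (auto simp: fun_eq_iff)
  from Vector_Spaces.linear_compose[OF this linear_cmap]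
  show "Vector_Spaces.linear scl scl (\<lambda>x. cmap p n (\<lambda>\<alpha>. A \<alpha> s) (\<lambda>i. x (s, i)))" by (simp add: o_def)
qed

text \<open>The block matrix maps U^r into V[C]^r for U = C + V[C]. The dimensions of these spaces
  differ by r dim C, which is therefore a lower bound for the nullity.\<close>

lemma fantichain_rank_bound:
  fixes V :: "(nat \<times> nat \<Rightarrow> 'a::conjugatable_ordered_field) set"
  assumes C: "fantichain n V C" and A: "\<And>\<alpha> \<beta>. A \<alpha> \<beta> \<in> V"
    and alg: "\<And>X Y u. X \<in> V \<Longrightarrow> Y \<in> V \<Longrightarrow> u \<in> coords {..<n} \<Longrightarrow> \<exists>Z\<in>V. mv n X (mv n Y u) = mv n Z u"
  shows "brank r n A {..<r} + r * fv.dim C \<le> r * n"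
proof -
  have C1: "fv.subspace C" "C \<subseteq> coords {..<n}"
    and C2: "\<And>X u w. X \<in> V \<Longrightarrow> u \<in> C \<Longrightarrow> w \<in> C \<Longrightarrow> cip n (mv n X u) w = 0"
    using C by (auto simp: fantichain_def)
  define Y where "Y = vspan n V C"
  have Y: "fv.subspace Y" "Y \<subseteq> coords {..<n}" by (simp_all add: Y_def vspan_coords)
  have fdY: "findim Y" and fdC: "findim C" using findim_subset[OF findim_coords] Y(2) C1(2) by blast+
  define U where "U = fv.span (Y \<union> C)"
  have "Y \<union> C \<subseteq> coords {..<n}" using Y(2) C1(2) by blast
  from fv.span_minimal[OF this subspace_coords]
  have U: "fv.subspace U" "U \<subseteq> coords {..<n}" by (simp_all add: U_def)
  have YC: "cip n y w = 0" if "y \<in> Y" "w \<in> C" for y w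
  proof -
    have "Y \<subseteq> {y. cip n y w = 0}"
      unfolding Y_def vspan_def by (rule fv.span_minimal[OF _ subspace_cip_left]) (use C2 that(2) in auto)
    then show ?thesis using that(1) by blast
  qed
  \<comment> \<open>Orthogonality and definiteness make the sum of \<open>C\<close> and V[C]
    direct.\<close>
  have "{u \<in> C. u \<in> Y} = {0}"
    using YC cip_self_eq_0 C1(2) fv.subspace_0[OF C1(1)] fv.subspace_0[OF Y(1)] by blast
  then have dimU: "fv.dim U = fv.dim Y + fv.dim C"
    using dim_span_union_image[OF fv.linear_id Y(1) fdY C1(1) fdC] by (simp add: U_def)
  have XU: "mv n X u \<in> Y" if X: "X \<in> V" and u: "u \<in> U" for X u
  proof -
    have sub: "fv.subspace {u. mv n X u \<in> Y}"
      using fvp.linear_subspace_vimage[OF linear_mv Y(1)] by (simp add: vimage_def)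
    have CC: "mv n X c \<in> Y" if "X \<in> V" "c \<in> C" for X c
      unfolding Y_def vspan_def by (rule fv.span_base) (use that in blast)
    have "Y \<subseteq> {u. mv n X u \<in> Y}"
      unfolding Y_def vspan_def
    proof (rule fv.span_minimal[OF _ sub[unfolded Y_def vspan_def]], safe)
      fix X' c assume "X' \<in> V" "c \<in> C"
      moreover then obtain Z where "Z \<in> V" "mv n X (mv n X' c) = mv n Z c" using alg X C1(2) by blast
      ultimately show "mv n X (mv n X' c) \<in> fv.span {mv n X u |X u. X \<in> V \<and> u \<in> C}"
        using CC[of Z c] by (simp add: Y_def vspan_def)
    qed
    then have "U \<subseteq> {u. mv n X u \<in> Y}"
      unfolding U_def by (intro fv.span_minimal[OF _ sub]) (use CC X in auto)
    then show ?thesis using u by blast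
  qed
  let ?f = "\<lambda>x. \<Sum>s<r. cmap r n (\<lambda>\<alpha>. A \<alpha> s) (\<lambda>i. x (s, i))"
  let ?P = "power_space {..<r} U" and ?Q = "power_space {..<r} Y"
  have "?f ` ?P \<subseteq> ?Q"
  proof
    fix z assume "z \<in> ?f ` ?P"
    then obtain x where x: "x \<in> ?P" "z = ?f x" by blast
    have "(\<lambda>i. z (\<alpha>, i)) \<in> Y" if "\<alpha> < r" for \<alpha>
    proof -
      have "(\<lambda>i. z (\<alpha>, i)) = (\<Sum>s<r. mv n (A \<alpha> s) (\<lambda>i. x (s, i)))"
        using that by (auto simp: x(2) sum_fun_apply cmap_def)
      also have "\<dots> \<in> Y"
        by (intro fv.subspace_sum[OF Y(1)] XU A) (use x(1) in \<open>auto simp: power_space_def\<close>)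
      finally show ?thesis .
    qed
    then show "z \<in> ?Q" by (auto simp: power_space_def x(2) sum_fun_apply cmap_def)
  qed
  moreover have "findim ?Q" by (rule findim_subset[OF findim_coords power_space_coords[OF Y(2)]]) simp
  ultimately have 1: "fv.dim (?f ` ?P) \<le> r * fv.dim Y"
    using dim_mono[of ?Q "?f ` ?P"] dim_power_space[OF finite_lessThan Y finite_lessThan, of r] by simp
  have subP: "?P \<subseteq> coords ({..<r} \<times> {..<n})" by (rule power_space_coords[OF U(2)])
  have fdP: "findim ?P" by (rule findim_subset[OF findim_coords subP]) simp
  have 2: "fv.dim ?P = r * fv.dim U" using dim_power_space[OF finite_lessThan U finite_lessThan, of r] by simp
  have 3: "fv.dim {x \<in> ?P. ?f x = 0} \<le> fv.dim {x \<in> coords ({..<r} \<times> {..<n}). ?f x = 0}"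
    by (rule dim_mono[OF findim_subset[OF findim_coords[of "{..<r} \<times> {..<n}"]]]) (use subP in auto)
  have "r * fv.dim U = fv.dim (?f ` ?P) + fv.dim {x \<in> ?P. ?f x = 0}"
    using rank_nullity[OF linear_block_map subspace_power_space[OF U(1)] fdP] 2 by simp
  then have "r * fv.dim C \<le> fv.dim {x \<in> coords ({..<r} \<times> {..<n}). ?f x = 0}"
    using 1 3 unfolding dimU distrib_left by linarith
  then show ?thesis using brank_block_map[of r n A r] by linarith
qed

text \<open>Orthogonality to V[U] imposes at most dim V[U] linear conditions on \<open>U\<close>.
  The vectors of \<open>U\<close> that satisfy them form an antichain, since V[C] lies in
  V[U].\<close>

lemma fantichain_of_subspace:
  fixes V :: "(nat \<times> nat \<Rightarrow> 'a::conjugatable_ordered_field) set"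
  assumes U: "fv.subspace U" "U \<subseteq> coords {..<n}"
  shows "\<exists>C. fantichain n V C \<and> fv.dim U \<le> fv.dim C + fv.dim (vspan n V U)"
proof -
  define Y where "Y = vspan n V U"
  have fdY: "findim Y" using findim_subset[OF findim_coords vspan_coords] by (simp add: Y_def)
  obtain B where B: "B \<subseteq> Y" "Y \<subseteq> fv.span B" "finite B" "card B = fv.dim Y"
    using findim_basis[OF fdY] by metis
  \<comment> \<open>One condition for each vector of a basis of V[U], with the basis vectors
    themselves as indices.\<close>
  define f where "f u = (\<lambda>y. if y \<in> B then cip n u y else 0)" for u
  have lin: "Vector_Spaces.linear scl scl f"
    by unfold_locales (auto simp: f_def cip_def fun_eq_iff distrib_right sum.distrib mult.assoc sum_distrib_left)
  define C where "C = {u \<in> U. f u = 0}"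
  have fdU: "findim U" using findim_subset[OF findim_coords U(2)] by simp
  have "fv.dim (f ` U) \<le> fv.dim (coords B :: ((nat \<Rightarrow> 'a) \<Rightarrow> 'a) set)"
    by (rule dim_mono[OF findim_coords[OF B(3)]]) (auto simp: f_def coords_def)
  then have "fv.dim U \<le> fv.dim C + fv.dim Y"
    using rank_nullity[OF lin U(1) fdU] B(4) unfolding C_def dim_coords[OF B(3)] by simp
  moreover have "fantichain n V C"
    unfolding fantichain_def
  proof (intro conjI ballI)
    have "C = U \<inter> {u. f u = 0}" by (auto simp: C_def)
    then show "fv.subspace C" using fv.subspace_inter[OF U(1) fvp.linear_subspace_kernel[OF lin]] by simp
    show "C \<subseteq> coords {..<n}" using U(2) by (auto simp: C_def)
    fix X u w assume X: "X \<in> V" "u \<in> C" "w \<in> C"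
    have "B \<subseteq> {y. cip n w y = 0}" using X(3) by (auto simp: C_def f_def fun_eq_iff split: if_splits)
    then have "Y \<subseteq> {y. cip n w y = 0}" using B(2) fv.span_minimal[OF _ subspace_cip_right] by blast
    moreover have "mv n X u \<in> Y" unfolding Y_def vspan_def using X by (intro fv.span_base) (auto simp: C_def)
    ultimately have "cip n w (mv n X u) = 0" by blast
    then show "cip n (mv n X u) w = 0" using cip_commute[of n "mv n X u" w] by simp
  qed
  ultimately show ?thesis by (auto simp: Y_def)
qed

text \<open>Some nonzero vector is killed by all of \<open>V\<close>, since otherwise products of
  any length with a nonzero value could be built up factor by factor. Its line is an antichain,
  which later yields \<rho> \<le> n - 1.\<close>

lemma fantichain_nilpotent:
  fixes V :: "(nat \<times> nat \<Rightarrow> 'a::conjugatable_ordered_field) set"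
  assumes n: "n \<ge> 1"
    and nil: "\<And>Xs u. length Xs = n \<Longrightarrow> set Xs \<subseteq> V \<Longrightarrow> u \<in> coords {..<n} \<Longrightarrow> foldr (mv n) Xs u = 0"
  shows "\<exists>C. fantichain n V C \<and> fv.dim C \<ge> 1"
proof -
  have "\<exists>u\<in>coords {..<n}. u \<noteq> 0 \<and> (\<forall>X\<in>V. mv n X u = 0)"
  proof (rule ccontr)
    assume "\<not> ?thesis"
    then have ex: "\<exists>X\<in>V. mv n X u \<noteq> 0" if "u \<in> coords {..<n}" "u \<noteq> 0" for u using that by blast
    have u0: "(unitf 0 :: nat \<Rightarrow> 'a) \<in> coords {..<n}" "(unitf 0 :: nat \<Rightarrow> 'a) \<noteq> 0"
      using n by (auto simp: unitf_def coords_def fun_eq_iff)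
    have "\<exists>Xs. length Xs = k \<and> set Xs \<subseteq> V \<and> foldr (mv n) Xs (unitf 0 :: nat \<Rightarrow> 'a) \<in> coords {..<n} \<and> foldr (mv n) Xs (unitf 0 :: nat \<Rightarrow> 'a) \<noteq> 0" for k
    proof (induction k)
      case 0
      then show ?case using u0 by (simp add: zero_fun_def)
    next
      case (Suc k)
      then obtain Xs where Xs: "length Xs = k" "set Xs \<subseteq> V"
        "foldr (mv n) Xs (unitf 0 :: nat \<Rightarrow> 'a) \<in> coords {..<n}" "foldr (mv n) Xs (unitf 0 :: nat \<Rightarrow> 'a) \<noteq> 0" by blast
      then obtain X where "X \<in> V" "mv n X (foldr (mv n) Xs (unitf 0)) \<noteq> 0" using ex by blast
      then show ?case using Xs by (intro exI[of _ "X # Xs"]) auto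
    qed
    then show False using nil u0(1) by blast
  qed
  then obtain u where u: "u \<in> coords {..<n}" "u \<noteq> 0" "\<And>X. X \<in> V \<Longrightarrow> mv n X u = 0" by blast
  have "mv n X w = 0" if X: "X \<in> V" and w: "w \<in> fv.span {u}" for X w
  proof -
    have "fv.span {u} \<subseteq> {w. mv n X w = 0}"
      by (rule fv.span_minimal[OF _ fvp.linear_subspace_kernel[OF linear_mv]]) (use u(3) X in auto)
    then show ?thesis using w by blast
  qed
  then have "fantichain n V (fv.span {u})"
    using u(1) by (auto simp: fantichain_def cip_def intro!: fv.span_minimal[THEN subsetD, of "{u}"])
  moreover have "fv.dim (fv.span {u}) = 1"
    using u(2) fv.dim_eq_card_independent[of "{u}"] by simp
  ultimately show ?thesis by (intro exI[of _ "fv.span {u}"]) simp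
qed

\<comment> \<open>Otherwise goals produced by induction, where \<open>scl\<close> is eta-expanded, are unfolded.\<close>
declare scl_apply [simp del]

section \<open>Chains of a nilpotent map\<close>

definition chain_of :: "(('i \<Rightarrow> 'a) \<Rightarrow> 'i \<Rightarrow> 'a) \<Rightarrow> ('i \<Rightarrow> 'a) \<times> nat \<Rightarrow> ('i \<Rightarrow> 'a) list" where
  "chain_of T p = map (\<lambda>i. (T ^^ i) (fst p)) [0..<snd p]"

text \<open>A chain may stop before reaching zero, so no Jordan basis is needed: each generator
  starts at most one chain, which is broken off when it meets the span of the vectors collected so
  far. That span stays invariant under \<open>T\<close>.\<close>

lemma chains_exist_greedy:
  fixes T :: "('i \<Rightarrow> 'a::field) \<Rightarrow> 'i \<Rightarrow> 'a"
  assumes T: "Vector_Spaces.linear scl scl T" and E: "fv.subspace E" "T ` E \<subseteq> E"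
    and nil: "\<And>x. x \<in> E \<Longrightarrow> (T ^^ m) x = 0"
    and gs: "set gs \<subseteq> E"
  shows "\<exists>ps. length ps \<le> length gs \<and> (\<forall>p\<in>set ps. fst p \<in> E \<and> snd p \<ge> 1) \<and>
    distinct (concat (map (chain_of T) ps)) \<and> fv.independent (set (concat (map (chain_of T) ps))) \<and>
    set (concat (map (chain_of T) ps)) \<subseteq> E \<and>
    T ` fv.span (set (concat (map (chain_of T) ps))) \<subseteq> fv.span (set (concat (map (chain_of T) ps))) \<and>
    set gs \<subseteq> fv.span (set (concat (map (chain_of T) ps)))"
  using gs
proof (induction gs)
  case Nil
  then show ?case
    by (intro exI[of _ "[]"]) (auto simp: zero_fun_def fvp.linear_0[OF T, unfolded zero_fun_def] fv.independent_empty fv.span_empty simp del: scl_apply)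
next
  case (Cons g gs)
  then obtain ps where ps: "length ps \<le> length gs" "\<forall>p\<in>set ps. fst p \<in> E \<and> snd p \<ge> 1"
    "distinct (concat (map (chain_of T) ps))" "fv.independent (set (concat (map (chain_of T) ps)))"
    "set (concat (map (chain_of T) ps)) \<subseteq> E"
    "T ` fv.span (set (concat (map (chain_of T) ps))) \<subseteq> fv.span (set (concat (map (chain_of T) ps)))"
    "set gs \<subseteq> fv.span (set (concat (map (chain_of T) ps)))" by auto
  define L where "L = concat (map (chain_of T) ps)"
  have g: "g \<in> E" using Cons.prems by simp
  have TE: "(T ^^ i) g \<in> E" for i by (induction i) (use g E(2) in auto)
  show ?case
  proof (cases "g \<in> fv.span (set L)")
    case True
    then show ?thesis using ps by (intro exI[of _ ps]) (auto simp: L_def)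
  next
    case False
    let ?S = "\<lambda>k. set L \<union> (\<lambda>i. (T ^^ i) g) ` {..<k}"
    \<comment> \<open>The first power that depends on the earlier chains and on the previous powers;
      nilpotency bounds it by \<open>m\<close>.\<close>
    define k where "k = (LEAST k. (T ^^ k) g \<in> fv.span (?S k))"
    have "(T ^^ m) g \<in> fv.span (?S m)" using nil[OF g] by (simp add: fv.span_zero)
    then have k: "(T ^^ k) g \<in> fv.span (?S k)" unfolding k_def by (rule LeastI)
    have less: "(T ^^ j) g \<notin> fv.span (?S j)" if "j < k" for j
      using not_less_Least that unfolding k_def by blast
    have k1: "k \<ge> 1" using k False by (cases k) auto
    define c where "c j = map (\<lambda>i. (T ^^ i) g) [0..<j]" for j
    have setc: "set (c j) = (\<lambda>i. (T ^^ i) g) ` {..<j}" for j by (auto simp: c_def)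
    have ind: "distinct (L @ c j) \<and> fv.independent (set (L @ c j))" if "j \<le> k" for j
      using that
    proof (induction j)
      case 0
      then show ?case using ps(3,4) by (simp add: c_def L_def)
    next
      case (Suc j)
      have eq: "L @ c (Suc j) = (L @ c j) @ [(T ^^ j) g]" by (simp add: c_def)
      have nin: "(T ^^ j) g \<notin> fv.span (set (L @ c j))" using less[of j] Suc.prems by (simp add: setc)
      then have "(T ^^ j) g \<notin> set (L @ c j)" using fv.span_base by blast
      moreover have "fv.independent (insert ((T ^^ j) g) (set (L @ c j)))"
        using Suc nin by (intro fv.independent_insertI) auto
      ultimately show ?case unfolding eq using Suc by auto
    qed
    define L' where "L' = L @ c k"
    have L': "L' = concat (map (chain_of T) (ps @ [(g, k)]))" by (simp add: L'_def L_def c_def chain_of_def)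
    have SL: "set L' = ?S k" by (simp add: L'_def setc)
    have mono: "fv.span (set L) \<subseteq> fv.span (set L')" by (rule fv.span_mono) (simp add: L'_def)
    have "T ` set L' \<subseteq> fv.span (set L')"
    proof
      fix y assume "y \<in> T ` set L'"
      then consider x where "x \<in> set L" "y = T x" | i where "i < k" "y = T ((T ^^ i) g)" unfolding SL by blast
      then show "y \<in> fv.span (set L')"
      proof cases
        case 1
        then have "y \<in> fv.span (set L)" using ps(6) fv.span_base[of x] unfolding L_def by blast
        then show ?thesis using mono by blast
      next
        case 2
        then have y: "y = (T ^^ Suc i) g" by simp
        show ?thesis
        proof (cases "Suc i < k")
          case True
          then show ?thesis unfolding y SL by (intro fv.span_base) blast
        next
          case False
          then have "Suc i = k" using 2 by simp
          then show ?thesis unfolding y SL using k by simp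
        qed
      qed
    qed
    then have inv: "T ` fv.span (set L') \<subseteq> fv.span (set L')"
      unfolding fvp.linear_span_image[OF T, symmetric] by (simp add: fv.span_minimal)
    have "g \<in> set L'" unfolding SL using k1 by (intro UnI2 image_eqI[of _ _ 0]) auto
    then have "set (g # gs) \<subseteq> fv.span (set L')" using ps(7) mono fv.span_base unfolding L_def by auto
    moreover have "set L' \<subseteq> E" using ps(5) TE by (auto simp: SL L_def)
    ultimately show ?thesis
      using ps(1,2) g k1 ind[OF order_refl] inv
      by (intro exI[of _ "ps @ [(g, k)]"]) (auto simp: L'[symmetric] L'_def simp del: concat_append map_append)
  qed
qed

lemma funpow_linear:
  fixes T :: "('i \<Rightarrow> 'a::field) \<Rightarrow> 'i \<Rightarrow> 'a"
  shows "Vector_Spaces.linear scl scl T \<Longrightarrow> Vector_Spaces.linear scl scl (T ^^ i)"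
proof (induction i)
  case 0
  have "T ^^ 0 = id" by (rule ext) simp
  then show ?case using fv.linear_id by (simp only:)
next
  case (Suc i)
  then show ?case using Vector_Spaces.linear_compose[of scl scl "T ^^ i" scl T] by (simp add: o_def)
qed

text \<open>By nilpotency, generators modulo the image of \<open>T\<close> generate everything, as in Nakayama's lemma.\<close>

lemma chains_exist:
  fixes T :: "('i \<Rightarrow> 'a::field) \<Rightarrow> 'i \<Rightarrow> 'a"
  assumes T: "Vector_Spaces.linear scl scl T" and E: "fv.subspace E" "findim E" "T ` E \<subseteq> E"
    and nil: "\<And>x. x \<in> E \<Longrightarrow> (T ^^ m) x = 0"
  shows "\<exists>ps. length ps + fv.dim (T ` E) \<le> fv.dim E \<and> (\<forall>p\<in>set ps. fst p \<in> E \<and> snd p \<ge> 1) \<and>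
    distinct (concat (map (chain_of T) ps)) \<and> fv.independent (set (concat (map (chain_of T) ps))) \<and>
    fv.span (set (concat (map (chain_of T) ps))) = E"
proof -
  have fdT: "findim (T ` E)" by (rule findim_image[OF T E(2)])
  obtain B where B: "B \<subseteq> T ` E" "fv.independent B" "T ` E \<subseteq> fv.span B" "finite B" "card B = fv.dim (T ` E)"
    using findim_basis[OF fdT] .
  obtain D where D: "B \<subseteq> D" "D \<subseteq> E" "fv.independent D" "E \<subseteq> fv.span D"
    using fv.maximal_independent_subset_extend[of B E] B(1,2) E(3) by blast
  have finD: "finite D" using findim_independent[OF E(2) D(3,2)] by blast
  have cD: "card D = fv.dim E" by (rule fv.basis_card_eq_dim) (use D in auto)
  \<comment> \<open>Generators of \<open>E\<close> modulo the image of \<open>T\<close>; their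
    number, dim E - dim T(E), bounds the number of chains.\<close>
  obtain gs where gs: "set gs = D - B" "length gs = card (D - B)"
    using finite_distinct_list[of "D - B"] finD distinct_card by (metis finite_Diff)
  have len: "length gs + fv.dim (T ` E) = fv.dim E"
    using gs(2) card_Diff_subset[OF B(4) D(1)] cD B(5) card_mono[OF finD D(1)] by simp
  have gsE: "set gs \<subseteq> E" using gs D(2) by auto
  obtain ps where ps: "length ps \<le> length gs" "\<forall>p\<in>set ps. fst p \<in> E \<and> snd p \<ge> 1"
    "distinct (concat (map (chain_of T) ps))" "fv.independent (set (concat (map (chain_of T) ps)))"
    "set (concat (map (chain_of T) ps)) \<subseteq> E"
    "T ` fv.span (set (concat (map (chain_of T) ps))) \<subseteq> fv.span (set (concat (map (chain_of T) ps)))"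
    "set gs \<subseteq> fv.span (set (concat (map (chain_of T) ps)))"
    using chains_exist_greedy[OF T E(1,3) nil gsE] by blast
  define S where "S = fv.span (set (concat (map (chain_of T) ps)))"
  have S: "fv.subspace S" "S \<subseteq> E" "T ` S \<subseteq> S" "set gs \<subseteq> S"
    using ps(5-7) E(1) by (auto simp: S_def fv.span_minimal)
  have step: "\<exists>s\<in>S. \<exists>y\<in>E. x = s + T y" if "x \<in> E" for x
  proof -
    have "D \<subseteq> S \<union> T ` E" using S(4) gs(1) B(1) by blast
    then have "E \<subseteq> fv.span (S \<union> T ` E)" using D(4) fv.span_mono by blast
    moreover have "fv.span (T ` E) = T ` E" "fv.span S = S"
      using fvp.linear_subspace_image[OF T E(1)] S(1) by (simp_all only: fv.span_eq_iff)
    ultimately have "x \<in> {x + y |x y. x \<in> S \<and> y \<in> T ` E}" using that unfolding fv.span_Un by auto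
    then show ?thesis by blast
  qed
  \<comment> \<open>The decomposition modulo the image is substituted into itself; at i = m the
    remainder vanishes.\<close>
  have "\<exists>s\<in>S. \<exists>y\<in>E. x = s + (T ^^ i) y" if "x \<in> E" for x i
    using that
  proof (induction i arbitrary: x)
    case 0
    then show ?case using fv.subspace_0[OF S(1)] by (metis add_0 funpow_0)
  next
    case (Suc i)
    obtain s y where sy: "s \<in> S" "y \<in> E" "x = s + (T ^^ i) y" using Suc by blast
    obtain s' y' where sy': "s' \<in> S" "y' \<in> E" "y = s' + T y'" using step[OF sy(2)] by blast
    have "(T ^^ i) s' \<in> S" for i by (induction i) (use sy'(1) S(3) in auto)
    then have "s + (T ^^ i) s' \<in> S" using sy(1) fv.subspace_add[OF S(1)] by blast
    moreover have "x = (s + (T ^^ i) s') + (T ^^ Suc i) y'"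
      unfolding sy(3) sy'(3) fvp.linear_add[OF funpow_linear[OF T]] by (simp add: add.assoc funpow_swap1)
    ultimately show ?case using sy'(2) by blast
  qed
  then have "E \<subseteq> S" using nil by (metis add.right_neutral subsetI)
  then have "S = E" using S(2) by blast
  then show ?thesis using ps(1-4) len by (intro exI[of _ ps]) (auto simp: S_def)
qed

section \<open>Transfer to vectors and matrices\<close>

text \<open>An injective linear map from an abstract vector space into a function space, through
  which span, independence, basis and dimension are transferred. Leaving the carrier general covers
  vectors, matrices and subspaces with restricted carrier alike.\<close>

locale coordinates =
  fixes M :: "('a::field, 'v, 'z) module_scheme" and \<phi> :: "'v \<Rightarrow> 'i \<Rightarrow> 'a"
  assumes vs: "vectorspace class_ring M"
    and add: "\<And>x y. x \<in> carrier M \<Longrightarrow> y \<in> carrier M \<Longrightarrow> \<phi> (x \<oplus>\<^bsub>M\<^esub> y) = \<phi> x + \<phi> y"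
    and smult: "\<And>c x. x \<in> carrier M \<Longrightarrow> \<phi> (c \<odot>\<^bsub>M\<^esub> x) = scl c (\<phi> x)"
    and inj: "inj_on \<phi> (carrier M)"
begin

sublocale V: vectorspace class_ring M by (rule vs)

lemma zero: "\<phi> \<zero>\<^bsub>M\<^esub> = 0"
  using add[of "\<zero>\<^bsub>M\<^esub>" "\<zero>\<^bsub>M\<^esub>"] by simp

lemma lincomb:
  assumes "finite A" "A \<subseteq> carrier M"
  shows "\<phi> (V.lincomb a A) = (\<Sum>v\<in>A. scl (a v) (\<phi> v))"
proof -
  have "\<phi> (\<Oplus>\<^bsub>M\<^esub>v\<in>A. a v \<odot>\<^bsub>M\<^esub> v) = (\<Sum>v\<in>A. scl (a v) (\<phi> v))"
    using assms
  proof (induction A)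
    case empty
    then show ?case by (simp add: zero)
  next
    case (insert x A)
    have f: "(\<lambda>v. a v \<odot>\<^bsub>M\<^esub> v) \<in> A \<rightarrow> carrier M" "a x \<odot>\<^bsub>M\<^esub> x \<in> carrier M"
      using insert.prems by (auto intro!: V.smult_closed)
    have "\<phi> (\<Oplus>\<^bsub>M\<^esub>v\<in>insert x A. a v \<odot>\<^bsub>M\<^esub> v) = \<phi> ((a x \<odot>\<^bsub>M\<^esub> x) \<oplus>\<^bsub>M\<^esub> (\<Oplus>\<^bsub>M\<^esub>v\<in>A. a v \<odot>\<^bsub>M\<^esub> v))"
      using insert f by (subst V.finsum_insert) auto
    also have "\<dots> = scl (a x) (\<phi> x) + (\<Sum>v\<in>A. scl (a v) (\<phi> v))"
      using insert f by (simp add: add smult)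
    finally show ?case using insert by simp
  qed
  then show ?thesis by (simp add: V.lincomb_def)
qed

lemma lincomb_closed: "A \<subseteq> carrier M \<Longrightarrow> V.lincomb a A \<in> carrier M"
  by (rule V.lincomb_closed) auto

lemma image_span:
  assumes S: "S \<subseteq> carrier M"
  shows "\<phi> ` V.span S = fv.span (\<phi> ` S)"
proof (rule subset_antisym)
  show "\<phi> ` V.span S \<subseteq> fv.span (\<phi> ` S)"
  proof
    fix y assume "y \<in> \<phi> ` V.span S"
    then obtain a A where A: "finite A" "A \<subseteq> S" "y = \<phi> (V.lincomb a A)" by (auto simp: V.span_def)
    then have "y = (\<Sum>v\<in>A. scl (a v) (\<phi> v))" using lincomb[of A a] S by auto
    also have "\<dots> \<in> fv.span (\<phi> ` S)"
      by (intro fv.span_sum fv.span_scale fv.span_base) (use A(2) in auto)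
    finally show "y \<in> fv.span (\<phi> ` S)" .
  qed
  show "fv.span (\<phi> ` S) \<subseteq> \<phi> ` V.span S"
  proof
    fix y assume "y \<in> fv.span (\<phi> ` S)"
    then obtain t u where t: "finite t" "t \<subseteq> \<phi> ` S" "y = (\<Sum>v\<in>t. scl (u v) v)"
      unfolding fv.span_explicit by blast
    obtain A where A: "A \<subseteq> S" "finite A" "t = \<phi> ` A"
      using finite_subset_image[OF t(1,2)] by blast
    have injA: "inj_on \<phi> A" using inj_on_subset[OF inj] A(1) S by blast
    have "y = (\<Sum>v\<in>A. scl (u (\<phi> v)) (\<phi> v))" unfolding t(3) A(3) by (simp add: sum.reindex[OF injA])
    also have "\<dots> = \<phi> (V.lincomb (\<lambda>v. u (\<phi> v)) A)" using lincomb[of A] A S by auto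
    finally show "y \<in> \<phi> ` V.span S" using A by (auto simp: V.span_def)
  qed
qed

lemma lin_dep_iff:
  assumes S: "S \<subseteq> carrier M"
  shows "V.lin_dep S \<longleftrightarrow> fv.dependent (\<phi> ` S)"
proof
  assume "V.lin_dep S"
  then obtain A a v where A: "finite A" "A \<subseteq> S" "V.lincomb a A = \<zero>\<^bsub>M\<^esub>" "v \<in> A" "a v \<noteq> 0"
    unfolding V.lin_dep_def by auto
  have injA: "inj_on \<phi> A" using inj_on_subset[OF inj] A(2) S by blast
  have "(\<Sum>y\<in>\<phi> ` A. scl (a (the_inv_into A \<phi> y)) y) = (\<Sum>v\<in>A. scl (a v) (\<phi> v))"
    by (simp add: sum.reindex[OF injA] the_inv_into_f_f[OF injA])
  also have "\<dots> = 0" using lincomb[of A a] A(1-3) S zero by auto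
  finally have "(\<Sum>y\<in>\<phi> ` A. scl (a (the_inv_into A \<phi> y)) y) = 0" .
  moreover have "a (the_inv_into A \<phi> (\<phi> v)) \<noteq> 0" using A(4,5) by (simp add: the_inv_into_f_f[OF injA])
  ultimately show "fv.dependent (\<phi> ` S)"
    unfolding fv.dependent_explicit using A(1,2,4) by (intro exI[of _ "\<phi> ` A"] exI conjI bexI[of _ "\<phi> v"]) auto
next
  assume "fv.dependent (\<phi> ` S)"
  then obtain t u v where t: "finite t" "t \<subseteq> \<phi> ` S" "(\<Sum>v\<in>t. scl (u v) v) = 0" "v \<in> t" "u v \<noteq> 0"
    unfolding fv.dependent_explicit by blast
  obtain A where A: "A \<subseteq> S" "finite A" "t = \<phi> ` A"
    using finite_subset_image[OF t(1,2)] by blast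
  have injA: "inj_on \<phi> A" using inj_on_subset[OF inj] A(1) S by blast
  have "\<phi> (V.lincomb (\<lambda>v. u (\<phi> v)) A) = (\<Sum>v\<in>A. scl (u (\<phi> v)) (\<phi> v))" using lincomb[of A] A S by auto
  also have "\<dots> = \<phi> \<zero>\<^bsub>M\<^esub>" using t(3) unfolding A(3) by (simp add: sum.reindex[OF injA] zero)
  finally have "V.lincomb (\<lambda>v. u (\<phi> v)) A = \<zero>\<^bsub>M\<^esub>"
    using inj_onD[OF inj] lincomb_closed[of A] A(1) S by auto
  moreover obtain w where "w \<in> A" "v = \<phi> w" using t(4) A(3) by blast
  ultimately show "V.lin_dep S"
    unfolding V.lin_dep_def using A t(5) by (intro exI[of _ A] exI[of _ "\<lambda>v. u (\<phi> v)"] exI[of _ w]) auto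
qed

lemma gen_set_iff:
  assumes S: "S \<subseteq> carrier M"
  shows "V.gen_set S \<longleftrightarrow> fv.span (\<phi> ` S) = \<phi> ` carrier M"
proof -
  have "V.span S \<subseteq> carrier M" using lincomb_closed S by (force simp: V.span_def)
  then show ?thesis
    unfolding image_span[OF S, symmetric] using inj_on_image_eq_iff[OF inj] by blast
qed

lemma basis_iff:
  "V.basis S \<longleftrightarrow> S \<subseteq> carrier M \<and> fv.independent (\<phi> ` S) \<and> fv.span (\<phi> ` S) = \<phi> ` carrier M"
  using lin_dep_iff gen_set_iff by (auto simp: V.basis_def)

lemma subspace_image: "fv.subspace (\<phi> ` carrier M)"
proof -
  have "V.gen_set (carrier M)" using V.span_self lincomb_closed
    by (force simp: V.span_def intro: V.in_own_span[THEN subsetD])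
  then show ?thesis using gen_set_iff[of "carrier M"] by (metis fv.subspace_span order_refl)
qed

lemma dim_eq:
  assumes "findim (\<phi> ` carrier M)"
  shows "V.dim = fv.dim (\<phi> ` carrier M)"
  unfolding V.dim_def
proof (rule Least_equality)
  obtain B where B: "B \<subseteq> \<phi> ` carrier M" "fv.independent B" "\<phi> ` carrier M \<subseteq> fv.span B" "finite B"
    "card B = fv.dim (\<phi> ` carrier M)" using findim_basis[OF assms] .
  obtain A where A: "A \<subseteq> carrier M" "finite A" "B = \<phi> ` A"
    using finite_subset_image[OF B(4,1)] by blast
  have "card A = card B" unfolding A(3) by (rule card_image[symmetric]) (rule inj_on_subset[OF inj A(1)])
  moreover have "fv.span B \<subseteq> \<phi> ` carrier M" using B(1) subspace_image by (rule fv.span_minimal)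
  ultimately show "\<exists>A. finite A \<and> card A = fv.dim (\<phi> ` carrier M) \<and> A \<subseteq> carrier M \<and> V.gen_set A"
    using A B(3,5) gen_set_iff[OF A(1)] by (intro exI[of _ A]) auto
  fix k assume "\<exists>A. finite A \<and> card A = k \<and> A \<subseteq> carrier M \<and> V.gen_set A"
  then obtain A where A: "finite A" "card A = k" "A \<subseteq> carrier M" "V.gen_set A" by blast
  then have "fv.dim (\<phi> ` carrier M) \<le> card (\<phi> ` A)"
    using gen_set_iff[OF A(3)] by (intro fv.dim_le_card) auto
  then show "fv.dim (\<phi> ` carrier M) \<le> k" using card_image_le[OF A(1), of \<phi>] A(2) by simp
qed

lemma restrict_carrier:
  assumes "VectorSpace.subspace class_ring C M"
  shows "coordinates (M\<lparr>carrier := C\<rparr>) \<phi>"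
proof (rule coordinates.intro)
  have C: "C \<subseteq> carrier M" using assms by (auto simp: VectorSpace.subspace_def submodule_def)
  show "vectorspace class_ring (M\<lparr>carrier := C\<rparr>)" by (rule V.subspace_is_vs[OF assms])
  show "inj_on \<phi> (carrier (M\<lparr>carrier := C\<rparr>))" using inj_on_subset[OF inj C] by simp
  show "\<phi> (x \<oplus>\<^bsub>M\<lparr>carrier := C\<rparr>\<^esub> y) = \<phi> x + \<phi> y"
    if "x \<in> carrier (M\<lparr>carrier := C\<rparr>)" "y \<in> carrier (M\<lparr>carrier := C\<rparr>)" for x y
    using add[of x y] that C by auto
  show "\<phi> (c \<odot>\<^bsub>M\<lparr>carrier := C\<rparr>\<^esub> x) = scl c (\<phi> x)" if "x \<in> carrier (M\<lparr>carrier := C\<rparr>)" for c x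
    using smult[of x c] that C by auto
qed

lemma subspace_iff:
  "VectorSpace.subspace class_ring C M \<longleftrightarrow> C \<subseteq> carrier M \<and> fv.subspace (\<phi> ` C)"
proof
  assume C: "VectorSpace.subspace class_ring C M"
  interpret C: coordinates "M\<lparr>carrier := C\<rparr>" \<phi> by (rule restrict_carrier[OF C])
  show "C \<subseteq> carrier M \<and> fv.subspace (\<phi> ` C)"
    using C C.subspace_image by (auto simp: VectorSpace.subspace_def submodule_def)
next
  assume C: "C \<subseteq> carrier M \<and> fv.subspace (\<phi> ` C)"
  have mem: "x \<in> C" if "x \<in> carrier M" "\<phi> x \<in> \<phi> ` C" for x
    using that C inj by (metis (no_types, lifting) imageE inj_onD subsetD)
  have "submodule class_ring C M"
  proof (rule submodule.intro)
    show "Module.module class_ring M" by (rule V.module_axioms)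
    show "C \<subseteq> carrier M" using C by blast
    show "\<zero>\<^bsub>M\<^esub> \<in> C" by (rule mem) (use C fv.subspace_0 zero in auto)
    show "v \<oplus>\<^bsub>M\<^esub> w \<in> C" if "v \<in> C" "w \<in> C" for v w
    proof (rule mem)
      have "v \<in> carrier M" "w \<in> carrier M" using C that by auto
      then show "v \<oplus>\<^bsub>M\<^esub> w \<in> carrier M" "\<phi> (v \<oplus>\<^bsub>M\<^esub> w) \<in> \<phi> ` C"
        using C that by (auto simp: add intro!: fv.subspace_add)
    qed
    show "c \<odot>\<^bsub>M\<^esub> v \<in> C" if "c \<in> carrier class_ring" "v \<in> C" for c v
    proof (rule mem)
      have "v \<in> carrier M" using C that by auto
      then show "c \<odot>\<^bsub>M\<^esub> v \<in> carrier M" "\<phi> (c \<odot>\<^bsub>M\<^esub> v) \<in> \<phi> ` C"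
        using C that by (auto simp: smult intro!: fv.subspace_scale V.smult_closed)
    qed
  qed
  then show "VectorSpace.subspace class_ring C M" using vs by (simp add: VectorSpace.subspace_def)
qed

end

definition vf :: "'a::zero vec \<Rightarrow> nat \<Rightarrow> 'a" where
  "vf v = (\<lambda>i. if i < dim_vec v then v $ i else 0)"

definition mf :: "'a::zero mat \<Rightarrow> nat \<times> nat \<Rightarrow> 'a" where
  "mf A = (\<lambda>(i, j). if i < dim_row A \<and> j < dim_col A then A $$ (i, j) else 0)"

lemma coordinates_vec: "coordinates (module_vec TYPE('a::field) n) vf"
proof (rule coordinates.intro)
  show "vectorspace class_ring (module_vec TYPE('a) n)" by (rule vec_vs)
  show "inj_on vf (carrier (module_vec TYPE('a) n))"
  proof (rule inj_onI)
    fix x y :: "'a vec"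
    assume xy: "x \<in> carrier (module_vec TYPE('a) n)" "y \<in> carrier (module_vec TYPE('a) n)" "vf x = vf y"
    show "x = y"
    proof (rule eq_vecI)
      fix i assume "i < dim_vec y"
      then show "x $ i = y $ i"
        using fun_cong[OF xy(3), of i] xy(1,2) by (auto simp: module_vec_simps vf_def)
    qed (use xy in \<open>auto simp: module_vec_simps\<close>)
  qed
qed (auto simp: module_vec_simps vf_def fun_eq_iff scl_apply)

lemma coordinates_mat: "coordinates (module_mat TYPE('a::field) n m) mf"
proof (rule coordinates.intro)
  show "vectorspace class_ring (module_mat TYPE('a) n m)" by (rule matrix_vs)
  show "inj_on mf (carrier (module_mat TYPE('a) n m))"
  proof (rule inj_onI)
    fix x y :: "'a mat"
    assume xy: "x \<in> carrier (module_mat TYPE('a) n m)" "y \<in> carrier (module_mat TYPE('a) n m)" "mf x = mf y"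
    show "x = y"
    proof (rule eq_matI)
      fix i j assume "i < dim_row y" "j < dim_col y"
      then show "x $$ (i, j) = y $$ (i, j)"
        using fun_cong[OF xy(3), of "(i, j)"] xy(1,2) by (auto simp: module_mat_simps mf_def)
    qed (use xy in \<open>auto simp: module_mat_simps\<close>)
  qed
qed (auto simp: module_mat_simps mf_def fun_eq_iff scl_apply)

lemma vf_image: "(vf :: 'a::field vec \<Rightarrow> nat \<Rightarrow> 'a) ` carrier_vec n = coords {..<n}"
proof (rule subset_antisym)
  show "coords {..<n} \<subseteq> (vf :: 'a vec \<Rightarrow> nat \<Rightarrow> 'a) ` carrier_vec n"
  proof
    fix f :: "nat \<Rightarrow> 'a" assume "f \<in> coords {..<n}"
    then have "f = vf (vec n f)" by (auto simp: vf_def coords_def fun_eq_iff)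
    then show "f \<in> vf ` carrier_vec n" by (rule image_eqI) simp
  qed
qed (auto simp: vf_def coords_def)

lemma vf_coords: "v \<in> carrier_vec n \<Longrightarrow> vf v \<in> coords {..<n}"
  using vf_image by blast

lemma vf_mult_mat_vec:
  fixes A :: "'a::field mat"
  shows "A \<in> carrier_mat n n \<Longrightarrow> v \<in> carrier_vec n \<Longrightarrow> vf (A *\<^sub>v v) = mv n (mf A) (vf v)"
  by (auto simp: vf_def mv_def mat_act_def mf_def fun_eq_iff scalar_prod_def atLeast0LessThan intro!: sum.cong)

lemma mv_mf_mult:
  fixes A B :: "'a::field mat"
  assumes "A \<in> carrier_mat n n" "B \<in> carrier_mat n n"
  shows "mv n (mf A) (mv n (mf B) u) = mv n (mf (A * B)) u"
proof -
  have "mat_comp n (\<lambda>i j. mf A (i, j)) (\<lambda>i j. mf B (i, j)) i j = mf (A * B) (i, j)" if "i < n" "j < n" for i j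
    using assms that by (auto simp: mat_comp_def mf_def scalar_prod_def atLeast0LessThan)
  then show ?thesis
    unfolding mv_def mat_act_comp[symmetric] by (auto simp: mat_act_def fun_eq_iff)
qed

lemma cip_vf:
  fixes v w :: "'a::conjugatable_ordered_field vec"
  assumes "v \<in> carrier_vec n" "w \<in> carrier_vec n"
  shows "w \<bullet>c v = cip n (vf w) (vf v)"
  using assms by (auto simp: scalar_prod_def cip_def vf_def atLeast0LessThan intro!: sum.cong)

lemma antichain_iff:
  fixes V :: "'a::conjugatable_ordered_field mat set"
  assumes V: "V \<subseteq> carrier_mat n n"
  shows "antichain n V C \<longleftrightarrow> C \<subseteq> carrier_vec n \<and> fantichain n (mf ` V) (vf ` C)"
proof -
  interpret cv: coordinates "module_vec TYPE('a) n" vf by (rule coordinates_vec)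
  let ?G = "{A *\<^sub>v v |A v. A \<in> V \<and> v \<in> C}"
  have "apply_span n V C \<subseteq> orth_compl n C \<longleftrightarrow> (\<forall>X\<in>mf ` V. \<forall>u\<in>vf ` C. \<forall>w\<in>vf ` C. cip n (mv n X u) w = 0)"
    (is "?L \<longleftrightarrow> ?R") if C: "C \<subseteq> carrier_vec n"
  proof -
    have Av: "A *\<^sub>v v \<in> carrier_vec n" if "A \<in> V" "v \<in> C" for A v
      using that C V by (intro mult_mat_vec_carrier[of _ n n]) auto
    have G: "?G \<subseteq> carrier (module_vec TYPE('a) n)" using Av by (auto simp: module_vec_simps)
    have img: "vf ` apply_span n V C = fv.span (vf ` ?G)"
      unfolding apply_span_def by (rule cv.image_span[OF G])
    have sub: "apply_span n V C \<subseteq> carrier_vec n"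
      unfolding apply_span_def using cv.lincomb_closed G by (force simp: cv.V.span_def module_vec_simps)
    have mult: "vf (A *\<^sub>v v) = mv n (mf A) (vf v)" if "A \<in> V" "v \<in> C" for A v
      by (rule vf_mult_mat_vec) (use that C V in auto)
    show ?thesis
    proof
      assume L: ?L
      have "cip n (mv n (mf A) (vf u)) (vf w) = 0" if "A \<in> V" "u \<in> C" "w \<in> C" for A u w
      proof -
        have "A *\<^sub>v u \<in> apply_span n V C"
        proof -
          have "vf (A *\<^sub>v u) \<in> vf ` apply_span n V C" unfolding img by (rule fv.span_base) (use that in blast)
          then obtain y where y: "y \<in> apply_span n V C" "vf (A *\<^sub>v u) = vf y" by blast
          moreover have "y \<in> carrier_vec n" using sub y(1) by blast
          ultimately have "A *\<^sub>v u = y" using inj_onD[OF cv.inj y(2)] Av[OF that(1,2)] by (simp add: module_vec_simps)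
          then show ?thesis using y(1) by simp
        qed
        then have "(A *\<^sub>v u) \<bullet>c w = 0" "A *\<^sub>v u \<in> carrier_vec n" using L that(3) by (auto simp: orth_compl_def)
        then show ?thesis using cip_vf[of w n "A *\<^sub>v u"] mult[OF that(1,2)] that(3) C by auto
      qed
      then show ?R by blast
    next
      assume R: ?R
      show ?L
      proof
        fix x assume x: "x \<in> apply_span n V C"
        have "x \<bullet>c v = 0" if v: "v \<in> C" for v
        proof -
          have "vf ` ?G \<subseteq> {u. cip n u (vf v) = 0}" using R v mult by auto
          then have "fv.span (vf ` ?G) \<subseteq> {u. cip n u (vf v) = 0}" by (rule fv.span_minimal[OF _ subspace_cip_left])
          then have "cip n (vf x) (vf v) = 0" using x img by blast
          then show ?thesis using cip_vf[of v n x] x sub v C by auto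
        qed
        then show "x \<in> orth_compl n C" using x sub by (auto simp: orth_compl_def)
      qed
    qed
  qed
  moreover have "vf ` C \<subseteq> coords {..<n}" if "C \<subseteq> carrier_vec n" using that vf_coords by blast
  ultimately show ?thesis
    using cv.subspace_iff[of C] unfolding antichain_def fantichain_def by (auto simp: module_vec_simps)
qed

lemma subspace_dim_eq:
  fixes C :: "'a::field vec set"
  assumes "VectorSpace.subspace class_ring C (module_vec TYPE('a) n)"
  shows "subspace_dim n C = fv.dim (vf ` C)"
proof -
  interpret cv: coordinates "module_vec TYPE('a) n" vf by (rule coordinates_vec)
  interpret cc: coordinates "(module_vec TYPE('a) n)\<lparr>carrier := C\<rparr>" vf by (rule cv.restrict_carrier[OF assms])
  have "vf ` C \<subseteq> coords {..<n}" using cv.subspace_iff[of C] assms vf_coords by (auto simp: module_vec_simps)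
  then have "findim (vf ` C)" by (rule findim_subset[OF findim_coords[OF finite_lessThan]])
  then show ?thesis using cc.dim_eq by (simp add: subspace_dim_def)
qed

text \<open>The block \<open>(\<alpha>, \<beta>)\<close> collects the entries whose second tensor index is \<open>(\<alpha>, \<beta>)\<close>.\<close>

definition block :: "nat \<Rightarrow> nat \<Rightarrow> (nat \<times> nat \<Rightarrow> 'a::field) \<Rightarrow> nat \<Rightarrow> nat \<Rightarrow> nat \<times> nat \<Rightarrow> 'a" where
  "block r n X \<alpha> \<beta> = (\<lambda>(i, j). if \<alpha> < r \<and> \<beta> < r \<and> i < n \<and> j < n then X (i * r + \<alpha>, j * r + \<beta>) else 0)"

lemma index_less: "\<alpha> < r \<Longrightarrow> i < n \<Longrightarrow> i * r + \<alpha> < r * (n :: nat)"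
proof -
  assume "\<alpha> < r" "i < n"
  then have "i * r + \<alpha> < (i + 1) * r" by simp
  also have "\<dots> \<le> n * r" using \<open>i < n\<close> by (intro mult_le_mono1) simp
  finally show ?thesis by (simp add: mult.commute)
qed

lemma linear_block: "Vector_Spaces.linear scl scl (\<lambda>X. block r n X \<alpha> \<beta>)"
  by unfold_locales (auto simp: block_def fun_eq_iff scl_apply)

lemma kronecker_carrier: "A \<in> carrier_mat n n \<Longrightarrow> B \<in> carrier_mat r r \<Longrightarrow> kronecker A B \<in> carrier_mat (r * n) (r * n)"
  by (auto simp: kronecker_def mult.commute)

lemma mf_kronecker:
  fixes A B :: "'a::field mat"
  assumes "A \<in> carrier_mat n n" "B \<in> carrier_mat r r" "\<alpha> < r" "\<beta> < r" "i < n" "j < n"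
  shows "mf (kronecker A B) (i * r + \<alpha>, j * r + \<beta>) = A $$ (i, j) * B $$ (\<alpha>, \<beta>)"
proof -
  have "i * r + \<alpha> < n * r" "j * r + \<beta> < n * r"
    using index_less[of \<alpha> r i n] index_less[of \<beta> r j n] assms by (simp_all add: mult.commute)
  then show ?thesis using assms by (simp add: mf_def kronecker_def)
qed

lemma tensor_full_span:
  fixes V :: "'a::field mat set"
  assumes V: "V \<subseteq> carrier_mat n n"
  shows "tensor_full n r V \<subseteq> carrier_mat (r * n) (r * n)"
    "mf ` tensor_full n r V = fv.span (mf ` {kronecker A B | A B. A \<in> V \<and> B \<in> carrier_mat r r})"
proof -
  interpret cm: coordinates "module_mat TYPE('a) (r * n) (r * n)" mf by (rule coordinates_mat)
  have G: "{kronecker A B | A B. A \<in> V \<and> B \<in> carrier_mat r r} \<subseteq> carrier (module_mat TYPE('a) (r * n) (r * n))"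
    using subsetD[OF V] by (auto simp: module_mat_simps intro!: kronecker_carrier)
  show "mf ` tensor_full n r V = fv.span (mf ` {kronecker A B | A B. A \<in> V \<and> B \<in> carrier_mat r r})"
    unfolding tensor_full_def by (rule cm.image_span[OF G])
  show "tensor_full n r V \<subseteq> carrier_mat (r * n) (r * n)"
    unfolding tensor_full_def using cm.lincomb_closed G by (force simp: cm.V.span_def module_mat_simps)
qed

lemma subspace_mf:
  fixes V :: "'a::field mat set"
  assumes "VectorSpace.subspace class_ring V (module_mat TYPE('a) n n)"
  shows "fv.subspace (mf ` V)" "V \<subseteq> carrier_mat n n"
proof -
  interpret cm: coordinates "module_mat TYPE('a) n n" mf by (rule coordinates_mat)
  show "fv.subspace (mf ` V)" "V \<subseteq> carrier_mat n n"
    using cm.subspace_iff[of V] assms by (auto simp: module_mat_simps)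
qed

text \<open>The blocks of a Kronecker product are multiples of its first factor, and taking a block
  is linear.\<close>

lemma tensor_full_block:
  fixes V :: "'a::field mat set"
  assumes V: "VectorSpace.subspace class_ring V (module_mat TYPE('a) n n)"
    and M: "M \<in> tensor_full n r V"
  shows "block r n (mf M) \<alpha> \<beta> \<in> mf ` V"
proof -
  note sV = subspace_mf[OF V]
  have "fv.span (mf ` {kronecker A B | A B. A \<in> V \<and> B \<in> carrier_mat r r}) \<subseteq> {X. block r n X \<alpha> \<beta> \<in> mf ` V}"
  proof (rule fv.span_minimal)
    show "fv.subspace {X. block r n X \<alpha> \<beta> \<in> mf ` V}"
      using fvp.linear_subspace_vimage[OF linear_block sV(1)] by (simp add: vimage_def)
    show "mf ` {kronecker A B | A B. A \<in> V \<and> B \<in> carrier_mat r r} \<subseteq> {X. block r n X \<alpha> \<beta> \<in> mf ` V}"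
    proof safe
      fix A B :: "'a mat" assume A: "A \<in> V" and B: "B \<in> carrier_mat r r"
      have Ac: "A \<in> carrier_mat n n" using A sV(2) by blast
      have "block r n (mf (kronecker A B)) \<alpha> \<beta> = scl (if \<alpha> < r \<and> \<beta> < r then B $$ (\<alpha>, \<beta>) else 0) (mf A)"
      proof
        fix k :: "nat \<times> nat"
        obtain i j where k: "k = (i, j)" by (cases k)
        show "block r n (mf (kronecker A B)) \<alpha> \<beta> k = scl (if \<alpha> < r \<and> \<beta> < r then B $$ (\<alpha>, \<beta>) else 0) (mf A) k"
          using Ac B mf_kronecker[OF Ac B, of \<alpha> \<beta> i j] by (auto simp: k block_def scl_apply mf_def[of A])
      qed
      then show "block r n (mf (kronecker A B)) \<alpha> \<beta> \<in> mf ` V"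
        using fv.subspace_scale[OF sV(1), of "mf A"] A by auto
    qed
  qed
  then show ?thesis using M tensor_full_span(2)[OF sV(2), of r] by blast
qed

text \<open>The sum of the Kronecker products of the blocks with the matrix units realises any
  prescribed blocks from \<open>V\<close>.\<close>

lemma tensor_full_exists:
  fixes V :: "'a::field mat set"
  assumes V: "VectorSpace.subspace class_ring V (module_mat TYPE('a) n n)"
    and A: "\<And>\<alpha> \<beta>. A \<alpha> \<beta> \<in> mf ` V"
  shows "\<exists>M\<in>tensor_full n r V. brank r n (block r n (mf M)) {..<r} = brank r n A {..<r}"
proof -
  note sV = subspace_mf[OF V]
  define Am where "Am \<alpha> \<beta> = inv_into V mf (A \<alpha> \<beta>)" for \<alpha> \<beta>
  have Am: "Am \<alpha> \<beta> \<in> V" "mf (Am \<alpha> \<beta>) = A \<alpha> \<beta>" for \<alpha> \<beta>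
    using A[of \<alpha> \<beta>] by (auto simp: Am_def inv_into_into f_inv_into_f)
  have Amc: "Am \<alpha> \<beta> \<in> carrier_mat n n" for \<alpha> \<beta> using Am(1) sV(2) by blast
  define E where "E \<alpha> \<beta> = mat r r (\<lambda>(a, b). if a = \<alpha> \<and> b = \<beta> then 1 else (0 :: 'a))" for \<alpha> \<beta>
  define X where "X = (\<Sum>\<alpha><r. \<Sum>\<beta><r. mf (kronecker (Am \<alpha> \<beta>) (E \<alpha> \<beta>)))"
  have "X \<in> fv.span (mf ` {kronecker A B | A B. A \<in> V \<and> B \<in> carrier_mat r r})"
    unfolding X_def
  proof (intro fv.span_sum fv.span_base imageI)
    fix \<alpha> \<beta>
    have "E \<alpha> \<beta> \<in> carrier_mat r r" by (simp add: E_def)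
    then show "kronecker (Am \<alpha> \<beta>) (E \<alpha> \<beta>) \<in> {kronecker A B | A B. A \<in> V \<and> B \<in> carrier_mat r r}" using Am(1) by blast
  qed
  then have "X \<in> mf ` tensor_full n r V" unfolding tensor_full_span(2)[OF sV(2)] .
  then obtain M where M: "M \<in> tensor_full n r V" "mf M = X" by blast
  have ent: "X (i * r + \<alpha>, j * r + \<beta>) = A \<alpha> \<beta> (i, j)" if "\<alpha> < r" "\<beta> < r" "i < n" "j < n" for \<alpha> \<beta> i j
  proof -
    have "X (i * r + \<alpha>, j * r + \<beta>) = (\<Sum>\<alpha>'<r. \<Sum>\<beta>'<r. Am \<alpha>' \<beta>' $$ (i, j) * E \<alpha>' \<beta>' $$ (\<alpha>, \<beta>))"
      unfolding X_def sum_fun_apply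
      by (intro sum.cong refl mf_kronecker[OF Amc _ that]) (simp add: E_def)
    also have "\<dots> = (\<Sum>\<alpha>'<r. \<Sum>\<beta>'<r. if \<beta>' = \<beta> then if \<alpha>' = \<alpha> then Am \<alpha>' \<beta>' $$ (i, j) else 0 else 0)"
      by (intro sum.cong refl) (use that in \<open>auto simp: E_def\<close>)
    also have "\<dots> = Am \<alpha> \<beta> $$ (i, j)" using that by simp
    also have "\<dots> = mf (Am \<alpha> \<beta>) (i, j)" using Amc[of \<alpha> \<beta>] that by (simp add: mf_def)
    finally show ?thesis by (simp add: Am(2))
  qed
  have "bcol r n (block r n (mf M)) ` ({..<r} \<times> {..<n}) = bcol r n A ` ({..<r} \<times> {..<n})"
    by (rule image_cong) (auto simp: bcol_def block_def fun_eq_iff M(2) ent)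
  then have "brank r n (block r n (mf M)) {..<r} = brank r n A {..<r}" by (simp only: brank_def)
  then show ?thesis using M(1) by blast
qed

text \<open>The change of coordinates from \<open>i * r + \<alpha>\<close> to
  \<open>(\<alpha>, i)\<close>. It intertwines a matrix of size \<open>r n\<close> with the map
  given by its blocks, see \<open>untensor_mv\<close>, and so transfers both rank and
  nilpotency.\<close>

definition untensor :: "nat \<Rightarrow> nat \<Rightarrow> (nat \<Rightarrow> 'a::field) \<Rightarrow> nat \<times> nat \<Rightarrow> 'a" where
  "untensor r n f = (\<lambda>(\<alpha>, i). if \<alpha> < r \<and> i < n then f (i * r + \<alpha>) else 0)"

lemma linear_untensor: "Vector_Spaces.linear scl scl (untensor r n)"
  by unfold_locales (auto simp: untensor_def fun_eq_iff scl_apply)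

lemma index_split: "I < r * n \<Longrightarrow> I mod r < r \<and> I div r < (n :: nat) \<and> I = (I div r) * r + I mod r"
  by (cases "r = 0") (auto simp: less_mult_imp_div_less mult.commute)

lemma untensor_inj:
  assumes "f \<in> coords {..<r * n}" "untensor r n f = 0"
  shows "f = 0"
proof
  fix I
  show "f I = 0 I"
  proof (cases "I < r * n")
    case True
    then show ?thesis using index_split[OF True] fun_cong[OF assms(2), of "(I mod r, I div r)"] by (simp add: untensor_def)
  qed (use assms(1) in \<open>auto simp: coords_def\<close>)
qed

lemma untensor_image: "untensor r n ` coords {..<r * n} = (coords ({..<r} \<times> {..<n}) :: (nat \<times> nat \<Rightarrow> 'a::field) set)"
proof (rule subset_antisym)
  show "(coords ({..<r} \<times> {..<n}) :: (nat \<times> nat \<Rightarrow> 'a) set) \<subseteq> untensor r n ` coords {..<r * n}"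
  proof
    fix g :: "nat \<times> nat \<Rightarrow> 'a" assume g: "g \<in> coords ({..<r} \<times> {..<n})"
    define f where "f I = (if I < r * n then g (I mod r, I div r) else 0)" for I
    have "g k = untensor r n f k" for k
      using g index_less by (cases k) (auto simp: untensor_def f_def coords_def)
    then have "g = untensor r n f" by blast
    moreover have "f \<in> coords {..<r * n}" by (auto simp: f_def coords_def)
    ultimately show "g \<in> untensor r n ` coords {..<r * n}" by (rule image_eqI)
  qed
qed (auto simp: untensor_def coords_def)

definition block_map :: "nat \<Rightarrow> nat \<Rightarrow> (nat \<Rightarrow> nat \<Rightarrow> nat \<times> nat \<Rightarrow> 'a::field) \<Rightarrow> (nat \<times> nat \<Rightarrow> 'a) \<Rightarrow> nat \<times> nat \<Rightarrow> 'a" where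
  "block_map r n A x = (\<Sum>s<r. cmap r n (\<lambda>\<alpha>. A \<alpha> s) (\<lambda>i. x (s, i)))"

lemma bij_index: "bij_betw (\<lambda>(s, j). j * r + s) ({..<r} \<times> {..<n}) {..<r * (n :: nat)}"
proof (rule bij_betw_byWitness[where f' = "\<lambda>I. (I mod r, I div r)"])
  show "\<forall>a\<in>{..<r} \<times> {..<n}. (\<lambda>I. (I mod r, I div r)) ((\<lambda>(s, j). j * r + s) a) = a" by auto
  show "\<forall>I\<in>{..<r * n}. (\<lambda>(s, j). j * r + s) ((\<lambda>I. (I mod r, I div r)) I) = I" by auto
  show "(\<lambda>(s, j). j * r + s) ` ({..<r} \<times> {..<n}) \<subseteq> {..<r * n}" using index_less by auto
  show "(\<lambda>I. (I mod r, I div r)) ` {..<r * n} \<subseteq> {..<r} \<times> {..<n}" using index_split by fastforce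
qed

lemma untensor_mv: "untensor r n (mv (r * n) X f) = block_map r n (block r n X) (untensor r n f)"
proof
  fix k :: "nat \<times> nat"
  obtain \<alpha> i where k: "k = (\<alpha>, i)" by (cases k)
  show "untensor r n (mv (r * n) X f) k = block_map r n (block r n X) (untensor r n f) k"
  proof (cases "\<alpha> < r \<and> i < n")
    case True
    then have "untensor r n (mv (r * n) X f) k = (\<Sum>J<r * n. X (i * r + \<alpha>, J) * f J)"
      using index_less[of \<alpha> r i n] by (simp add: k untensor_def mv_def mat_act_def)
    also have "\<dots> = (\<Sum>b\<in>{..<r} \<times> {..<n}. X (i * r + \<alpha>, (\<lambda>(s, j). j * r + s) b) * f ((\<lambda>(s, j). j * r + s) b))"
      by (rule sum.reindex_bij_betw[OF bij_index, symmetric])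
    also have "\<dots> = (\<Sum>s<r. \<Sum>j<n. X (i * r + \<alpha>, j * r + s) * f (j * r + s))"
      by (simp add: sum.cartesian_product')
    also have "\<dots> = block_map r n (block r n X) (untensor r n f) k"
      using True by (simp add: k block_map_def sum_fun_apply cmap_def mv_def mat_act_def block_def untensor_def)
    finally show ?thesis .
  next
    case False
    then show ?thesis by (auto simp: k untensor_def block_map_def sum_fun_apply cmap_def mv_def mat_act_def)
  qed
qed

lemma tensor_rank: "fv.dim (mv (r * n) X ` coords {..<r * n}) = brank r n (block r n X) {..<r}"
proof -
  let ?E = "coords {..<r * n} :: (nat \<Rightarrow> 'a) set"
  have sub: "fv.subspace (mv (r * n) X ` ?E)" by (rule fvp.linear_subspace_image[OF linear_mv subspace_coords])
  have TE: "mv (r * n) X ` ?E \<subseteq> ?E" by auto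
  have fd: "findim (mv (r * n) X ` ?E)" by (rule findim_subset[OF findim_coords[OF finite_lessThan] TE])
  have "fv.dim (mv (r * n) X ` ?E) = fv.dim (untensor r n ` mv (r * n) X ` ?E)"
    by (rule dim_image_inj[OF linear_untensor sub fd, symmetric]) (use TE untensor_inj in blast)
  also have "untensor r n ` mv (r * n) X ` ?E = block_map r n (block r n X) ` coords ({..<r} \<times> {..<n})"
    unfolding untensor_image[symmetric] image_image untensor_mv ..
  also have "fv.dim \<dots> = brank r n (block r n X) {..<r}"
  proof -
    have lin: "Vector_Spaces.linear scl scl (block_map r n (block r n X))"
      unfolding block_map_def by (rule linear_block_map)
    have "finite ({..<r} \<times> {..<n})" by simp
    from rank_nullity[OF lin subspace_coords findim_coords[OF this]]
    have "r * n = fv.dim (block_map r n (block r n X) ` coords ({..<r} \<times> {..<n})) +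
      fv.dim {x \<in> coords ({..<r} \<times> {..<n}). block_map r n (block r n X) x = 0}"
      by (simp add: dim_coords card_cartesian_product)
    then show ?thesis using brank_block_map[of r n "block r n X" r] unfolding block_map_def by linarith
  qed
  finally show ?thesis .
qed

text \<open>The components of the k-th iterate lie in the span \<open>L k\<close> of the values of
  k-fold products from \<open>V\<close>, and \<open>L n\<close> is zero.\<close>

lemma block_map_nilpotent:
  fixes V :: "(nat \<times> nat \<Rightarrow> 'a::field) set"
  assumes A: "\<And>\<alpha> \<beta>. A \<alpha> \<beta> \<in> V"
    and nil: "\<And>Xs u. length Xs = n \<Longrightarrow> set Xs \<subseteq> V \<Longrightarrow> u \<in> coords {..<n} \<Longrightarrow> foldr (mv n) Xs u = 0"
    and x: "x \<in> coords ({..<r} \<times> {..<n})"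
  shows "(block_map r n A ^^ n) x = 0"
proof -
  define L where "L k = fv.span {foldr (mv n) Xs u |Xs u. length Xs = k \<and> set Xs \<subseteq> V \<and> u \<in> coords {..<n}}" for k
  have sL: "fv.subspace (L k)" for k by (simp add: L_def)
  have step: "mv n X y \<in> L (Suc k)" if "X \<in> V" "y \<in> L k" for X y k
  proof -
    have "L k \<subseteq> {y. mv n X y \<in> L (Suc k)}"
      unfolding L_def[of k]
    proof (rule fv.span_minimal)
      show "fv.subspace {y. mv n X y \<in> L (Suc k)}"
        using fvp.linear_subspace_vimage[OF linear_mv sL] by (simp add: vimage_def)
      show "{foldr (mv n) Xs u |Xs u. length Xs = k \<and> set Xs \<subseteq> V \<and> u \<in> coords {..<n}} \<subseteq> {y. mv n X y \<in> L (Suc k)}"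
      proof safe
        fix Xs :: "(nat \<times> nat \<Rightarrow> 'a) list" and u :: "nat \<Rightarrow> 'a" assume "set Xs \<subseteq> V" "u \<in> coords {..<n}" "k = length Xs"
        then show "mv n X (foldr (mv n) Xs u) \<in> L (Suc (length Xs))"
          unfolding L_def using that(1)
          by (intro fv.span_base CollectI exI[of _ "X # Xs"] exI[of _ u]) auto
      qed
    qed
    then show ?thesis using that(2) by blast
  qed
  have "(block_map r n A ^^ k) x \<in> power_space {..<r} (L k)" for k
  proof (induction k)
    case 0
    have "(\<lambda>i. x (s, i)) \<in> coords {..<n}" for s using x by (auto simp: coords_def)
    then have "(\<lambda>i. x (s, i)) \<in> L 0" for s unfolding L_def by (intro fv.span_base) auto
    then show ?case using x by (auto simp: power_space_def coords_def)
  next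
    case (Suc k)
    let ?y = "(block_map r n A ^^ k) x"
    have "(\<lambda>i. block_map r n A ?y (\<alpha>, i)) \<in> L (Suc k)" if "\<alpha> < r" for \<alpha>
    proof -
      have "(\<lambda>i. block_map r n A ?y (\<alpha>, i)) = (\<Sum>s<r. mv n (A \<alpha> s) (\<lambda>i. ?y (s, i)))"
        using that by (auto simp: block_map_def sum_fun_apply cmap_def)
      also have "\<dots> \<in> L (Suc k)"
        by (intro fv.subspace_sum[OF sL] step A) (use Suc in \<open>auto simp: power_space_def\<close>)
      finally show ?thesis .
    qed
    then show ?case by (auto simp: power_space_def) (auto simp: block_map_def sum_fun_apply cmap_def)
  qed
  moreover have "L n \<subseteq> {0}"
    unfolding L_def by (rule fv.span_minimal) (use nil in auto)
  then have "power_space {..<r} (L n) \<subseteq> power_space {..<r} {0}" unfolding power_space_def by blast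
  ultimately have "(block_map r n A ^^ n) x \<in> power_space {..<r} {0}" by blast
  then have "(block_map r n A ^^ n) x k = 0" for k
    by (cases k) (auto simp: power_space_def fun_eq_iff)
  then show ?thesis by auto
qed

lemma foldr_mult_mat:
  fixes As :: "'a::field mat list"
  assumes "set As \<subseteq> carrier_mat n n"
  shows "foldr (*) As (1\<^sub>m n) \<in> carrier_mat n n \<and>
    (\<forall>u\<in>coords {..<n}. foldr (mv n) (map mf As) u = mv n (mf (foldr (*) As (1\<^sub>m n))) u)"
  using assms
proof (induction As)
  case Nil
  have "mv n (mf (1\<^sub>m n)) u i = u i" if "u \<in> coords {..<n}" for u :: "nat \<Rightarrow> 'a" and i
  proof (cases "i < n")
    case True
    then have "mv n (mf (1\<^sub>m n)) u i = (\<Sum>j<n. (if i = j then 1 else 0) * u j)"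
      by (simp add: mv_def mat_act_def mf_def)
    also have "\<dots> = (\<Sum>j<n. if j = i then u j else 0)" by (intro sum.cong refl) auto
    finally show ?thesis using True by simp
  qed (use that in \<open>auto simp: mv_def mat_act_def coords_def\<close>)
  then have "mv n (mf (1\<^sub>m n)) u = u" if "u \<in> coords {..<n}" for u :: "nat \<Rightarrow> 'a"
    using that by blast
  then show ?case by simp
next
  case (Cons A As)
  then show ?case by (auto simp: mv_mf_mult)
qed


lemma nilpotent_foldr:
  fixes V :: "'a::field mat set"
  assumes V: "nilpotent_algebra n V" and Xs: "length Xs = n" "set Xs \<subseteq> mf ` V" and u: "u \<in> coords {..<n}"
  shows "foldr (mv n) Xs u = 0"
proof -
  have Vc: "V \<subseteq> carrier_mat n n"
    using V subspace_mf(2) unfolding nilpotent_algebra_def by blast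
  have "Xs \<in> lists (mf ` V)" using Xs(2) by auto
  then obtain As where As: "As \<in> lists V" "Xs = map mf As" unfolding lists_image by blast
  have "set As \<subseteq> V" using As(1) by auto
  then have "foldr (*) As (1\<^sub>m n) = 0\<^sub>m n n" using V As(2) Xs(1) unfolding nilpotent_algebra_def by auto
  moreover have "foldr (mv n) Xs u = mv n (mf (foldr (*) As (1\<^sub>m n))) u"
    using foldr_mult_mat[of As n] \<open>set As \<subseteq> V\<close> Vc u As(2) by auto
  ultimately show ?thesis by (auto simp: mv_def mat_act_def mf_def)
qed

section \<open>Coherent decompositions and the rank\<close>

lemma vf_pow_mult:
  fixes M :: "'a::field mat"
  assumes M: "M \<in> carrier_mat N N" and v: "v \<in> carrier_vec N"
  shows "(M ^\<^sub>m i) *\<^sub>v v \<in> carrier_vec N \<and> vf ((M ^\<^sub>m i) *\<^sub>v v) = (mv N (mf M) ^^ i) (vf v)"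
  using v
proof (induction i arbitrary: v)
  case 0
  then show ?case using M by simp
next
  case (Suc i)
  have Mv: "M *\<^sub>v v \<in> carrier_vec N" using M Suc.prems by auto
  have "(M ^\<^sub>m Suc i) *\<^sub>v v = (M ^\<^sub>m i) *\<^sub>v (M *\<^sub>v v)"
    using M Suc.prems by (simp add: assoc_mult_mat_vec[of _ N N _ N] pow_carrier_mat)
  then show ?case
    using Suc.IH[OF Mv] vf_mult_mat_vec[OF M Suc.prems] by (simp add: funpow_swap1)
qed

text \<open>All chain elements except the heads lie in the image of the common matrix and are
  independent. Their number, \<open>N\<close> minus the number of chains, is thus at most its
  rank.\<close>

lemma decomposition_size_ge:
  fixes W :: "'a::field mat set"
  assumes dec: "coherent_decomposition N W cs" and W: "W \<subseteq> carrier_mat N N"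
    and rank: "\<And>M. M \<in> W \<Longrightarrow> fv.dim (mv N (mf M) ` coords {..<N}) + k \<le> N"
  shows "k \<le> length cs"
proof -
  interpret cv: coordinates "module_vec TYPE('a) N" vf by (rule coordinates_vec)
  obtain M where M: "M \<in> W" "\<And>c. c \<in> set cs \<Longrightarrow> coherent_chain_by N M c"
    using dec by (auto simp: coherent_decomposition_def)
  have Mc: "M \<in> carrier_mat N N" using M(1) W by blast
  have dist: "distinct (concat cs)" and bas: "cv.V.basis (set (concat cs))"
    using dec by (auto simp: coherent_decomposition_def)
  let ?B = "set (concat cs)"
  have B: "?B \<subseteq> carrier_vec N" "fv.independent (vf ` ?B)" "fv.span (vf ` ?B) = coords {..<N}"
    using bas unfolding cv.basis_iff by (simp_all add: module_vec_simps vf_image)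
  have injB: "inj_on vf ?B" using inj_on_subset[OF cv.inj] B(1) by (simp add: module_vec_simps)
  have "card (vf ` ?B) = fv.dim (coords {..<N} :: (nat \<Rightarrow> 'a) set)"
    by (simp only: B(3)[symmetric] fv.dim_span fv.dim_eq_card_independent[OF B(2)])
  then have "length (concat cs) = N"
    using card_image[OF injB] distinct_card[OF dist] by (simp add: dim_coords)
  define nh where "nh = concat (map tl cs)"
  have ne: "c \<noteq> []" if "c \<in> set cs" for c using M(2)[OF that] by (auto simp: coherent_chain_by_def)
  have "distinct nh \<and> set nh \<subseteq> ?B \<and> length nh + length cs = length (concat cs)"
    using dist ne unfolding nh_def
  proof (induction cs)
    case (Cons c cs)
    obtain a c' where c: "c = a # c'" using Cons.prems(2)[of c] by (cases c) auto
    have IH: "distinct (concat (map tl cs))" "set (concat (map tl cs)) \<subseteq> set (concat cs)"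
      "length (concat (map tl cs)) + length cs = length (concat cs)"
      using Cons by (auto simp del: set_concat)
    have "set c' \<inter> set (concat cs) = {}" "distinct c'" using Cons.prems(1) by (auto simp: c)
    then show ?case using IH by (auto simp: c simp del: set_concat)
  qed simp
  then have nh: "distinct nh" "set nh \<subseteq> ?B" "length nh + length cs = N" using \<open>length (concat cs) = N\<close> by auto
  have sub: "vf ` set nh \<subseteq> mv N (mf M) ` coords {..<N}"
  proof safe
    fix x assume "x \<in> set nh"
    then obtain c where c: "c \<in> set cs" "x \<in> set (tl c)" by (auto simp: nh_def)
    obtain v m where v: "v \<in> carrier_vec N" "c = map (\<lambda>i. (M ^\<^sub>m i) *\<^sub>v v) [0..<m]"
      using M(2)[OF c(1)] by (auto simp: coherent_chain_by_def)
    obtain i where i: "i < length (tl c)" "x = tl c ! i" using c(2) by (metis in_set_conv_nth)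
    then have "x = (M ^\<^sub>m Suc i) *\<^sub>v v" using v(2) by (simp add: nth_tl)
    then have "vf x = mv N (mf M) ((mv N (mf M) ^^ i) (vf v))" using vf_pow_mult[OF Mc v(1), of "Suc i"] by simp
    moreover have "(mv N (mf M) ^^ i) (vf v) \<in> coords {..<N}"
      using vf_pow_mult[OF Mc v(1), of i] vf_coords by metis
    ultimately show "vf x \<in> mv N (mf M) ` coords {..<N}" by blast
  qed
  have "findim (mv N (mf M) ` coords {..<N})" by (rule findim_image[OF linear_mv findim_coords]) simp
  then have "card (vf ` set nh) \<le> fv.dim (mv N (mf M) ` coords {..<N})"
    using findim_independent(2)[OF _ _ sub] fv.independent_mono[OF B(2)] nh(2) by blast
  moreover have "card (vf ` set nh) = length nh"
    using card_image[OF inj_on_subset[OF injB nh(2)]] distinct_card[OF nh(1)] by simp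
  ultimately show ?thesis using rank[OF M(1)] nh(3) by linarith
qed

lemma decomposition_exists:
  fixes W :: "'a::field mat set"
  assumes M: "M \<in> W" "M \<in> carrier_mat N N"
    and nil: "\<And>x. x \<in> coords {..<N} \<Longrightarrow> (mv N (mf M) ^^ m) x = 0"
  shows "\<exists>cs. coherent_decomposition N W cs \<and> length cs + fv.dim (mv N (mf M) ` coords {..<N}) \<le> N"
proof -
  interpret cv: coordinates "module_vec TYPE('a) N" vf by (rule coordinates_vec)
  let ?T = "mv N (mf M)" and ?E = "coords {..<N} :: (nat \<Rightarrow> 'a) set"
  have "?T ` ?E \<subseteq> ?E" by auto
  note ex = chains_exist[where T = ?T and E = ?E and m = m, OF linear_mv subspace_coords findim_coords[OF finite_lessThan] this nil]
  obtain ps where ps: "length ps + fv.dim (?T ` ?E) \<le> fv.dim ?E" "\<forall>p\<in>set ps. fst p \<in> ?E \<and> snd p \<ge> 1"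
    "distinct (concat (map (chain_of ?T) ps))" "fv.independent (set (concat (map (chain_of ?T) ps)))"
    "fv.span (set (concat (map (chain_of ?T) ps))) = ?E" using ex by blast
  define ch where "ch p = map (\<lambda>i. (M ^\<^sub>m i) *\<^sub>v vec N (fst p)) [0..<snd p]" for p :: "(nat \<Rightarrow> 'a) \<times> nat"
  define cs where "cs = map ch ps"
  have vfch: "map vf (ch p) = chain_of ?T p" if "p \<in> set ps" for p
  proof -
    have "vf (vec N (fst p)) = fst p" using ps(2) that by (auto simp: vf_def coords_def fun_eq_iff)
    then show ?thesis using vf_pow_mult[OF M(2), of "vec N (fst p)"] by (simp add: ch_def chain_of_def)
  qed
  have "map vf (concat cs) = concat (map (map vf) (map ch ps))" by (simp only: map_concat cs_def)
  also have "map (map vf) (map ch ps) = map (chain_of ?T) ps" using vfch by simp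
  finally have eq: "map vf (concat cs) = concat (map (chain_of ?T) ps)" .
  have dist: "distinct (concat cs)" using ps(3) unfolding eq[symmetric] by (simp add: distinct_map)
  have "set (concat cs) \<subseteq> carrier_vec N"
    using vf_pow_mult[OF M(2)] by (auto simp: cs_def ch_def)
  then have "cv.V.basis (set (concat cs))"
    unfolding cv.basis_iff using ps(4,5) unfolding eq[symmetric] by (simp add: module_vec_simps vf_image)
  moreover have "\<forall>c\<in>set cs. coherent_chain_by N M c"
    using ps(2) by (auto simp: cs_def ch_def coherent_chain_by_def intro!: bexI[of _ "vec N (fst _)"])
  ultimately have "coherent_decomposition N W cs"
    using M(1) dist by (auto simp: coherent_decomposition_def)
  then show ?thesis using ps(1) by (intro exI[of _ cs]) (simp add: cs_def dim_coords)
qed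

text \<open>The real and the complex case at once: \<open>h\<close> embeds the scalars into the
  complex numbers, where the roots of unity are found.\<close>

theorem minimum_size_eq:
  fixes V :: "'a::{conjugatable_ordered_field,field_char_0} mat set" and h :: "'a \<Rightarrow> complex"
  assumes h: "field_hom h" and V: "nilpotent_algebra n V" and n: "n \<ge> 1" and r: "r \<ge> 1" "r \<ge> n - 1"
  shows "\<exists>d. maximum_antichain_dim n V d \<and> minimum_decomposition_size (r * n) (tensor_full n r V) (r * d)"
proof -
  interpret cv: coordinates "module_vec TYPE('a) n" vf by (rule coordinates_vec)
  have Vs: "VectorSpace.subspace class_ring V (module_mat TYPE('a) n n)"
    and Vmult: "\<And>A B. A \<in> V \<Longrightarrow> B \<in> V \<Longrightarrow> A * B \<in> V"
    using V by (auto simp: nilpotent_algebra_def)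
  note sV = subspace_mf[OF Vs]
  let ?V = "mf ` V"
  have alg: "\<exists>Z\<in>?V. mv n X (mv n Y u) = mv n Z u" if XY: "X \<in> ?V" "Y \<in> ?V" for X Y u
  proof -
    obtain A B where "A \<in> V" "X = mf A" "B \<in> V" "Y = mf B" using XY by blast
    then show ?thesis using mv_mf_mult[of A n B u] sV(2) Vmult by blast
  qed
  note nil = nilpotent_foldr[OF V]
  have bound: "fv.dim C \<le> n" if "fantichain n ?V C" for C
  proof -
    have "C \<subseteq> coords {..<n}" using that by (simp add: fantichain_def)
    then have "fv.dim C \<le> fv.dim (coords {..<n} :: (nat \<Rightarrow> 'a) set)" by (intro dim_mono findim_coords) auto
    then show ?thesis by (simp add: dim_coords)
  qed
  \<comment> \<open>This gives d \<ge> 1 for the maximal dimension, hence n - d \<le> n - 1 \<le> r,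
    as \<open>block_rank\<close> demands.\<close>
  obtain C1 where C1: "fantichain n ?V C1" "fv.dim C1 \<ge> 1" using fantichain_nilpotent[OF n nil] by blast
  obtain C where C: "fantichain n ?V C" and Cmax: "\<And>C'. fantichain n ?V C' \<Longrightarrow> fv.dim C' \<le> fv.dim C"
    using ex_has_greatest_nat[of "fantichain n ?V" C1 "fv.dim" "Suc n"] C1(1) bound le_imp_less_Suc by metis
  define d where "d = fv.dim C"
  have d: "1 \<le> d" "d \<le> n" using Cmax[OF C1(1)] C1(2) bound[OF C] by (auto simp: d_def)
  have "maximum_antichain_dim n V d"
    unfolding maximum_antichain_dim_def
  proof (intro conjI allI impI)
    define C' where "C' = {v \<in> carrier_vec n. vf v \<in> C}"
    have "C \<subseteq> vf ` carrier_vec n" using C unfolding vf_image by (simp add: fantichain_def)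
    then have im: "vf ` C' = C" by (auto simp: C'_def)
    then have C': "antichain n V C'" using C antichain_iff[OF sV(2), of C'] by (auto simp: C'_def)
    then have "subspace_dim n C' = d" using subspace_dim_eq[of C' n] im by (simp add: antichain_def d_def)
    then show "\<exists>C. antichain n V C \<and> subspace_dim n C = d" using C' by blast
  next
    fix C' assume C': "antichain n V C'"
    then have "fantichain n ?V (vf ` C')" using antichain_iff[OF sV(2)] by blast
    then show "subspace_dim n C' \<le> d"
      using Cmax subspace_dim_eq[of C' n] C' by (simp add: antichain_def d_def)
  qed
  moreover have "minimum_decomposition_size (r * n) (tensor_full n r V) (r * d)"
  proof -
    let ?W = "tensor_full n r V"
    have Wc: "?W \<subseteq> carrier_mat (r * n) (r * n)" by (rule tensor_full_span(1)[OF sV(2)])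
    have upper: "fv.dim (mv (r * n) (mf M) ` coords {..<r * n}) + r * d \<le> r * n" if "M \<in> ?W" for M
      unfolding tensor_rank d_def
      by (rule fantichain_rank_bound[OF C tensor_full_block[OF Vs that] alg])
    \<comment> \<open>Here \<rho> is n - d: by \<open>fantichain_of_subspace\<close>, dim U - dim
      V[U] never exceeds the largest dimension d of an antichain.\<close>
    have "\<exists>A. (\<forall>\<alpha> \<beta>. A \<alpha> \<beta> \<in> ?V) \<and> r * (n - d) \<le> brank r n A {..<r}"
    proof (rule block_rank[OF h sV(1)])
      fix U :: "(nat \<Rightarrow> 'a) set" assume U: "fv.subspace U" "U \<subseteq> coords {..<n}"
      obtain C' where "fantichain n ?V C'" "fv.dim U \<le> fv.dim C' + fv.dim (vspan n ?V U)"
        using fantichain_of_subspace[OF U] by blast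
      then show "fv.dim U + (n - d) \<le> fv.dim (vspan n ?V U) + n" using Cmax[of C'] d by (simp add: d_def)
    qed (use r d in auto)
    then obtain A where A: "\<And>\<alpha> \<beta>. A \<alpha> \<beta> \<in> ?V" "r * (n - d) \<le> brank r n A {..<r}" by blast
    obtain M where M: "M \<in> ?W" "brank r n (block r n (mf M)) {..<r} = brank r n A {..<r}"
      using tensor_full_exists[where A = A, OF Vs A(1)] by blast
    have Mnil: "(mv (r * n) (mf M) ^^ n) x = 0" if x: "x \<in> coords {..<r * n}" for x
    proof -
      have "untensor r n ((mv (r * n) (mf M) ^^ i) x) = (block_map r n (block r n (mf M)) ^^ i) (untensor r n x)" for i
        by (induction i) (simp_all add: untensor_mv)
      moreover have "untensor r n x \<in> coords ({..<r} \<times> {..<n})" using x untensor_image by blast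
      ultimately have "untensor r n ((mv (r * n) (mf M) ^^ n) x) = 0"
        using block_map_nilpotent[OF tensor_full_block[OF Vs M(1)] nil] by simp
      moreover have "(mv (r * n) (mf M) ^^ i) x \<in> coords {..<r * n}" for i
        by (induction i) (use x in auto)
      ultimately show ?thesis using untensor_inj by blast
    qed
    obtain cs where cs: "coherent_decomposition (r * n) ?W cs"
      "length cs + fv.dim (mv (r * n) (mf M) ` coords {..<r * n}) \<le> r * n"
      using decomposition_exists[OF M(1) _ Mnil] M(1) Wc by blast
    have lower: "r * d \<le> length cs'" if "coherent_decomposition (r * n) ?W cs'" for cs'
      by (rule decomposition_size_ge[OF that Wc upper])
    have "r * (n - d) + r * d = r * n" using d by (simp flip: distrib_left)
    then have "length cs \<le> r * d" using cs(2) A(2) M(2) unfolding tensor_rank by linarith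
    then have "length cs = r * d" using lower[OF cs(1)] by simp
    then show ?thesis using cs(1) lower unfolding minimum_decomposition_size_def by blast
  qed
  ultimately show ?thesis by blast
qed

theorem theorem2p5:
  fixes n r :: nat
  assumes "n \<ge> 1" and "r \<ge> 1" and "r \<ge> n - 1"
  shows "(\<forall>V :: real mat set. nilpotent_algebra n V \<longrightarrow>
            (\<exists>d. maximum_antichain_dim n V d \<and>
                 minimum_decomposition_size (r * n) (tensor_full n r V) (r * d))) \<and>
         (\<forall>V :: complex mat set. nilpotent_algebra n V \<longrightarrow>
            (\<exists>d. maximum_antichain_dim n V d \<and>
                 minimum_decomposition_size (r * n) (tensor_full n r V) (r * d)))"
proof -
  have "field_hom complex_of_real" by unfold_locales auto
  from minimum_size_eq[OF this _ assms] minimum_size_eq[OF field_hom_id[where 'a = complex] _ assms]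
  show ?thesis by (intro conjI allI impI)
qed

end
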